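(* Let $n\ge 2$ and let $f:\mathbb{R}\to\mathbb{R}$ be Lipschitz and non-increasing. Let $U\subset\mathbb{H}^n$ be a bounded domain with $C^2$ boundary such that $\Omega=\mathbb{H}^n\setminus\overline{U}$ is connected, and assume that the overdetermined elliptic problem (OEP) on $\Omega$ associated with $f$ (see context) has a solution $u\in C^2(\overline{\Omega})$. Then $U$ is a geodesic ball and $u$ is radially symmetric (i.e. $u(p)$ depends only on the distance from $p$ to the center of the ball).
   Context: $\mathbb{H}^n$ is the hyperbolic space of constant curvature $-1$ and $d$ its distance. A domain is a nonempty open connected set. OEP on $\Omega$ associated with $f$: a solution is a function $u$ such that, for some constants $C$ and $\alpha\le 0$, $\Delta u+f(u)=0$ in $\Omega$; $u>0$ in $\Omega$; $u$ is bounded in $\Omega$; $u=0$ on $\partial\Omega$; $u(p)\to C$ uniformly as $d(p,\partial\Omega)\to+\infty$; and $\langle\nabla u,\vec v\rangle=\alpha$ on $\partial\Omega$, where $\Delta,\nabla,\langle\cdot,\cdot\rangle$ are taken with respect to the hyperbolic metric and $\vec v$ is the unit outward normal vector along $\partial\Omega$. *)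

theory Defs
  imports "HOL-Analysis.Analysis"
begin

text \<open>
  Hyperbolic space of dimension \<open>n = DIM('a)\<close> is the Poincare ball model: the open unit ball of
  the Euclidean space \<open>'a\<close> with the conformal metric \<open>g = \<rho>\<^sup>2 |dx|\<^sup>2\<close>, \<open>\<rho>(x) = 2 / (1 - |x|\<^sup>2)\<close>,
  which has constant curvature \<open>-1\<close>. Tangent vectors are elements of \<open>'a\<close>.
\<close>

definition hspace :: "'a::euclidean_space set" where
  "hspace = ball 0 1"

definition hconf :: "'a::euclidean_space \<Rightarrow> real" where
  "hconf x = 2 / (1 - (norm x)\<^sup>2)"

definition hinner :: "'a::euclidean_space \<Rightarrow> 'a \<Rightarrow> 'a \<Rightarrow> real" where
  "hinner p v w = (hconf p)\<^sup>2 * (v \<bullet> w)"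

definition hnorm :: "'a::euclidean_space \<Rightarrow> 'a \<Rightarrow> real" where
  "hnorm p v = sqrt (hinner p v v)"

text \<open>
  The Riemannian distance of \<open>g\<close>. It induces on the ball the Euclidean subspace topology, so
  open and connected sets are the usual ones; closures, frontiers and boundedness in hyperbolic
  space differ from the Euclidean notions and are defined below.
\<close>

definition hdist :: "'a::euclidean_space \<Rightarrow> 'a \<Rightarrow> real" where
  "hdist p q = arcosh (1 + 2 * (norm (p - q))\<^sup>2 / ((1 - (norm p)\<^sup>2) * (1 - (norm q)\<^sup>2)))"

definition hball :: "'a::euclidean_space \<Rightarrow> real \<Rightarrow> 'a set" where
  "hball c r = {p \<in> hspace. hdist c p < r}"

definition hbounded :: "'a::euclidean_space set \<Rightarrow> bool" where
  "hbounded S \<longleftrightarrow> (\<exists>c\<in>hspace. \<exists>r. S \<subseteq> hball c r)"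

definition hclosure :: "'a::euclidean_space set \<Rightarrow> 'a set" where
  "hclosure S = closure S \<inter> hspace"

definition hfrontier :: "'a::euclidean_space set \<Rightarrow> 'a set" where
  "hfrontier S = frontier S \<inter> hspace"

definition hinfdist :: "'a::euclidean_space \<Rightarrow> 'a set \<Rightarrow> real" where
  "hinfdist p S = (INF q\<in>S. hdist p q)"

definition hdomain :: "'a::euclidean_space set \<Rightarrow> bool" where
  "hdomain S \<longleftrightarrow> S \<subseteq> hspace \<and> S \<noteq> {} \<and> open S \<and> connected S"

definition dird :: "'a::euclidean_space \<Rightarrow> ('a \<Rightarrow> real) \<Rightarrow> 'a \<Rightarrow> real" where
  "dird b u x = frechet_derivative u (at x) b"

text \<open>The gradient is the metric dual of the differential, \<open>\<rho>\<^sup>-\<^sup>2\<close> times the Euclidean gradient.\<close>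

definition hgrad :: "('a::euclidean_space \<Rightarrow> real) \<Rightarrow> 'a \<Rightarrow> 'a" where
  "hgrad u x = (1 / (hconf x)\<^sup>2) *\<^sub>R (\<Sum>b\<in>Basis. dird b u x *\<^sub>R b)"

text \<open>
  In the coordinates of the ball \<open>\<surd>det g = \<rho>\<^sup>n\<close>, so this is the usual
  \<open>div X = (1 / \<surd>det g) \<Sum>\<^sub>i \<partial>\<^sub>i (\<surd>det g X\<^sup>i)\<close>.
\<close>

definition hdiv :: "('a::euclidean_space \<Rightarrow> 'a) \<Rightarrow> 'a \<Rightarrow> real" where
  "hdiv X x = (1 / hconf x ^ DIM('a)) * (\<Sum>b\<in>Basis. dird b (\<lambda>y. hconf y ^ DIM('a) * (X y \<bullet> b)) x)"

definition hlaplacian :: "('a::euclidean_space \<Rightarrow> real) \<Rightarrow> 'a \<Rightarrow> real" where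
  "hlaplacian u = hdiv (hgrad u)"

lemma hinner_hgrad:
  assumes "x \<in> hspace" "u differentiable (at x)"
  shows "hinner x (hgrad u x) v = frechet_derivative u (at x) v"
proof -
  have lin: "linear (frechet_derivative u (at x))"
    using assms(2) by (rule linear_frechet_derivative)
  have "(norm x)\<^sup>2 < 1"
    using assms(1) by (simp add: hspace_def power_less_one_iff)
  then have nz: "hconf x \<noteq> 0"
    by (simp add: hconf_def)
  have "frechet_derivative u (at x) v
      = frechet_derivative u (at x) (\<Sum>b\<in>Basis. (v \<bullet> b) *\<^sub>R b)"
    by (simp add: euclidean_representation)
  also have "\<dots> = (\<Sum>b\<in>Basis. (v \<bullet> b) * frechet_derivative u (at x) b)"
    by (simp add: linear_sum[OF lin] linear_scale[OF lin])
  also have "\<dots> = (\<Sum>b\<in>Basis. dird b u x *\<^sub>R b) \<bullet> v"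
    by (simp add: dird_def inner_sum_left inner_commute[of v] mult.commute)
  finally show ?thesis
    using nz by (simp add: hinner_def hgrad_def)
qed

text \<open>Used for open sets \<open>S\<close> only.\<close>

definition C2_on :: "'a::euclidean_space set \<Rightarrow> ('a \<Rightarrow> real) \<Rightarrow> bool" where
  "C2_on S u \<longleftrightarrow>
     (\<forall>x\<in>S. u differentiable (at x)) \<and>
     (\<forall>b\<in>Basis. \<forall>x\<in>S. dird b u differentiable (at x)) \<and>
     (\<forall>a\<in>Basis. \<forall>b\<in>Basis. continuous_on S (dird a (dird b u)))"

text \<open>
  \<open>u \<in> C\<^sup>2\<close> up to the boundary: \<open>u\<close> is \<open>C\<^sup>2\<close> on the open set \<open>S\<close>, and \<open>u\<close> and its
  partial derivatives of order at most two extend continuously to the closure of \<open>S\<close> in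
  hyperbolic space (nothing is required at infinity). The values of \<open>u\<close> on the boundary are
  those of the extension; values off the closure are irrelevant.
\<close>

definition C2_on_hclosure :: "'a::euclidean_space set \<Rightarrow> ('a \<Rightarrow> real) \<Rightarrow> bool" where
  "C2_on_hclosure S u \<longleftrightarrow>
     C2_on S u \<and>
     continuous_on (hclosure S) u \<and>
     (\<forall>b\<in>Basis. \<exists>g. continuous_on (hclosure S) g \<and> (\<forall>x\<in>S. g x = dird b u x)) \<and>
     (\<forall>a\<in>Basis. \<forall>b\<in>Basis. \<exists>g. continuous_on (hclosure S) g \<and>
        (\<forall>x\<in>S. g x = dird a (dird b u) x))"

text \<open>The gradient at a boundary point of \<open>S\<close>, as the limit of the gradient from inside \<open>S\<close>.\<close>

definition hgrad_bd :: "'a::euclidean_space set \<Rightarrow> ('a \<Rightarrow> real) \<Rightarrow> 'a \<Rightarrow> 'a" where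
  "hgrad_bd S u p = Lim (at p within S) (hgrad u)"

definition C2_local_defining ::
  "'a::euclidean_space set \<Rightarrow> 'a \<Rightarrow> 'a set \<Rightarrow> ('a \<Rightarrow> real) \<Rightarrow> bool" where
  "C2_local_defining S p V \<phi> \<longleftrightarrow>
     open V \<and> V \<subseteq> hspace \<and> p \<in> V \<and> C2_on V \<phi> \<and> (\<forall>x\<in>V. hgrad \<phi> x \<noteq> 0) \<and>
     S \<inter> V = {x \<in> V. \<phi> x < 0}"

definition C2_boundary :: "'a::euclidean_space set \<Rightarrow> bool" where
  "C2_boundary S \<longleftrightarrow> (\<forall>p\<in>hfrontier S. \<exists>V \<phi>. C2_local_defining S p V \<phi>)"

text \<open>
  The defining function is negative inside \<open>S\<close>, so its gradient points out of \<open>S\<close>. For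
  \<open>p \<in> hfrontier S\<close> the normalised gradient does not depend on the choice of \<open>V\<close> and \<open>\<phi>\<close>.
\<close>

definition is_outward_unit_normal :: "'a::euclidean_space set \<Rightarrow> 'a \<Rightarrow> 'a \<Rightarrow> bool" where
  "is_outward_unit_normal S p v \<longleftrightarrow>
     (\<exists>V \<phi>. C2_local_defining S p V \<phi> \<and> v = (1 / hnorm p (hgrad \<phi> p)) *\<^sub>R hgrad \<phi> p)"

definition OEP_solution ::
  "'a::euclidean_space set \<Rightarrow> (real \<Rightarrow> real) \<Rightarrow> ('a \<Rightarrow> real) \<Rightarrow> bool" where
  "OEP_solution \<Omega> f u \<longleftrightarrow>
     (\<exists>C \<alpha>. \<alpha> \<le> 0 \<and>
        (\<forall>p\<in>\<Omega>. hlaplacian u p + f (u p) = 0) \<and>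
        (\<forall>p\<in>\<Omega>. u p > 0) \<and>
        bounded (u ` \<Omega>) \<and>
        (\<forall>p\<in>hfrontier \<Omega>. u p = 0) \<and>
        (\<forall>\<epsilon>>0. \<exists>R. \<forall>p\<in>\<Omega>. hinfdist p (hfrontier \<Omega>) > R \<longrightarrow> \<bar>u p - C\<bar> < \<epsilon>) \<and>
        (\<forall>p\<in>hfrontier \<Omega>. \<exists>v. is_outward_unit_normal \<Omega> p v \<and>
            hinner p (hgrad_bd \<Omega> u p) v = \<alpha>))"

definition radially_symmetric_on :: "'a::euclidean_space \<Rightarrow> 'a set \<Rightarrow> ('a \<Rightarrow> real) \<Rightarrow> bool" where
  "radially_symmetric_on c S u \<longleftrightarrow> (\<forall>p\<in>S. \<forall>q\<in>S. hdist c p = hdist c q \<longrightarrow> u p = u q)"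

end

theory Submission
  imports Defs
begin

text \<open>
  The proof is the method of moving planes, in the version available when \<open>f\<close> is non-increasing:
  the comparison of \<open>u\<close> with its reflection then holds at once for every admissible
  position of the hyperplane, because both functions have the same limit \<open>C\<close> at infinity.

  Let \<open>R\<close> be the reflection in a hyperplane such that the part of \<open>U\<close> in front of the hyperplane
  is reflected into \<open>closure U\<close>, and let \<open>D\<close> be the part of \<open>\<Omega>\<close> behind it. On \<open>D\<close> the function
  \<open>w = u \<circ> R - u\<close> is \<open>\<ge> 0\<close> on the boundary and tends to \<open>0\<close> at infinity, and where \<open>w < 0\<close>
  monotonicity of \<open>f\<close> makes it superharmonic; so \<open>w \<ge> 0\<close> (\<open>w_nonneg\<close>), and then the Lipschitz
  bound gives \<open>\<Delta>w \<le> L w\<close>. A one-parameter family of hyperplanes orthogonal to a geodesic is moved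
  in from infinity until the reflected cap first fails to stay inside \<open>U\<close>
  (\<open>critical_plane\<close>). At this position either the reflected boundary touches the boundary of \<open>U\<close>
  behind the hyperplane, or the hyperplane meets that boundary orthogonally. In the first case the
  constant Neumann datum contradicts the Hopf lemma unless \<open>w\<close> has a zero (\<open>touching_interior\<close>). In
  the second case \<open>w\<close> vanishes to second order at the corner, since differentiating
  \<open>|\<nabla>u|\<^sup>2 = \<alpha>\<^sup>2\<close> along the boundary determines the mixed second derivative
  (\<open>second_order_cancel\<close>), while a barrier of the form (distance to the hyperplane) times
  (exponential Hopf barrier) forces quadratic growth (\<open>touching_orthogonal\<close>). So \<open>w\<close> has a zero; by the
  strong maximum principle its zero set is open, and a connectedness argument in \<open>\<Omega>\<close> makes \<open>u\<close> and
  \<open>\<Omega>\<close> symmetric (\<open>symmetric_of_zero\<close>).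

  The geodesics are taken through the centre \<open>p\<close> of the smallest ball containing \<open>U\<close>. Every
  hyperplane of symmetry passes through \<open>p\<close> (\<open>symmetry_through_center\<close>), so that the critical
  hyperplane of each family is the one through \<open>p\<close>. Two points at the same distance from \<open>p\<close> are
  exchanged by a reflection in a hyperplane through \<open>p\<close>; hence \<open>u\<close> is radial and \<open>\<Omega>\<close> is a union of
  spheres about \<open>p\<close>, and connectedness of \<open>U\<close> and \<open>\<Omega>\<close> leaves only a ball (\<open>ball_and_radial\<close>).

  Computations are kept short by the hyperboloid model: a point \<open>x\<close> of the ball is sent to \<open>hyp x\<close>
  with Lorentz square \<open>-1\<close>, reflections become linear, and the functions \<open>lin A\<close> (Lorentz products
  with a fixed vector) are eigenfunctions of the Laplacian whose gradients have explicit
  scalar products (\<open>jets_lin\<close>, \<open>glin_glin\<close>). All barriers are functions of them.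
\<close>

section \<open>The Lorentz form and hyperbolic reflections\<close>

text \<open>
  Vectors of Minkowski space are pairs (time, space). Isometries of hyperbolic space are linear
  isometries of this form, so hyperplanes, reflections and distances are expressed through it.
\<close>
definition lor :: "real \<times> 'a::euclidean_space \<Rightarrow> real \<times> 'a \<Rightarrow> real" where
  "lor A B = snd A \<bullet> snd B - fst A * fst B"

text \<open>
  Half the conformal factor of the metric (\<open>hconf_sg\<close>); without the factor 2 it satisfies the
  convenient identity \<open>sg x * (x \<bullet> x) = sg x - 1\<close>.
\<close>
definition sg :: "'a::euclidean_space \<Rightarrow> real" where
  "sg x = 1 / (1 - x \<bullet> x)"

text \<open>
  The point of the upper sheet of the hyperboloid \<open>lor X X = -1\<close> lying over \<open>x\<close>, by stereographic
  projection from \<open>(-1, 0)\<close>.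
\<close>
definition hyp :: "'a::euclidean_space \<Rightarrow> real \<times> 'a" where
  "hyp x = (2 * sg x - 1, (2 * sg x) *\<^sub>R x)"

definition chart :: "real \<times> 'a::euclidean_space \<Rightarrow> 'a" where
  "chart Y = (1 / (1 + fst Y)) *\<^sub>R snd Y"

text \<open>
  For \<open>lor A A = 1\<close> the equation \<open>lin A x = 0\<close> describes a hyperbolic hyperplane, and \<open>lin A\<close> is
  the hyperbolic sine of the signed distance to it; every hyperplane arises in this way.
\<close>
definition lin :: "real \<times> 'a::euclidean_space \<Rightarrow> 'a \<Rightarrow> real" where
  "lin A x = lor A (hyp x)"

text \<open>
  On the hyperplane \<open>lin A x = 0\<close> with \<open>lor A A = 1\<close> this is the Euclidean unit normal
  (by \<open>nrm_ell\<close>), pointing to the side \<open>lin A > 0\<close>.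
\<close>
definition nrm :: "real \<times> 'a::euclidean_space \<Rightarrow> 'a \<Rightarrow> 'a" where
  "nrm A x = snd A - fst A *\<^sub>R x"

text \<open>
  This is \<open>lin A\<close> without the positive factor \<open>sg\<close>: a polynomial, with Euclidean gradient
  \<open>2 * nrm A\<close>.
\<close>
definition ell :: "real \<times> 'a::euclidean_space \<Rightarrow> 'a \<Rightarrow> real" where
  "ell A x = 2 * (x \<bullet> snd A) - fst A * (1 + x \<bullet> x)"

text \<open>
  The reflection in the hyperplane \<open>lin A = 0\<close>, written in the ball so that the displacement is
  visibly along \<open>nrm A x\<close>. It is a Euclidean inversion, or a linear reflection if \<open>fst A = 0\<close>; on the
  hyperboloid it is the linear map of \<open>hyp_hrefl\<close>.
\<close>
definition hrefl :: "real \<times> 'a::euclidean_space \<Rightarrow> 'a \<Rightarrow> 'a" where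
  "hrefl A x = x - (ell A x / (nrm A x \<bullet> nrm A x)) *\<^sub>R nrm A x"

lemma hspace_iff: "x \<in> hspace \<longleftrightarrow> x \<bullet> x < 1"
  by (simp add: hspace_def norm_eq_sqrt_inner real_less_lsqrt)

lemma hspace_pos: "x \<in> hspace \<Longrightarrow> 0 < 1 - x \<bullet> x"
  by (simp add: hspace_iff)

lemma sg_mult: "x \<in> hspace \<Longrightarrow> sg x * (1 - x \<bullet> x) = 1"
  using hspace_pos[of x] by (simp add: sg_def)

lemma sg_ge1: "x \<in> hspace \<Longrightarrow> 1 \<le> sg x"
  using hspace_pos[of x] by (simp add: sg_def field_simps)

lemma sg_pos: "x \<in> hspace \<Longrightarrow> 0 < sg x"
  using sg_ge1[of x] by simp

lemma hconf_sg: "hconf x = 2 * sg x"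
  by (simp add: hconf_def sg_def power2_norm_eq_inner)

lemma open_hspace: "open (hspace :: 'a::euclidean_space set)"
  by (simp add: hspace_def)

lemma lor_commute: "lor A B = lor B A"
  by (simp add: lor_def inner_commute mult.commute)

lemma lor_add: "lor (A + B) C = lor A C + lor B C" "lor C (A + B) = lor C A + lor C B"
  by (simp_all add: lor_def algebra_simps)

lemma lor_diff: "lor (A - B) C = lor A C - lor B C" "lor C (A - B) = lor C A - lor C B"
  by (simp_all add: lor_def algebra_simps)

lemma lor_minus: "lor (- A) C = - lor A C" "lor C (- A) = - lor C A"
  by (simp_all add: lor_def algebra_simps)

lemma lor_scale: "lor (c *\<^sub>R A) C = c * lor A C" "lor C (c *\<^sub>R A) = c * lor C A"
  by (simp_all add: lor_def algebra_simps)

lemmas lor_simps = lor_add lor_diff lor_minus lor_scale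

lemma continuous_on_lor [continuous_intros]:
  "continuous_on S f \<Longrightarrow> continuous_on S g \<Longrightarrow> continuous_on S (\<lambda>x. lor (f x) (g x))"
  unfolding lor_def by (intro continuous_intros)

lemma tendsto_lor [tendsto_intros]:
  "(f \<longlongrightarrow> a) F \<Longrightarrow> (g \<longlongrightarrow> b) F \<Longrightarrow> ((\<lambda>x. lor (f x) (g x)) \<longlongrightarrow> lor a b) F"
  unfolding lor_def by (intro tendsto_intros)

lemma lin_ell: assumes "x \<in> hspace" shows "lin A x = sg x * ell A x"
proof -
  have "sg x * (x \<bullet> x) = sg x - 1" using sg_mult[OF assms] by (simp add: algebra_simps)
  then have "fst A * (sg x * (x \<bullet> x)) = fst A * (sg x - 1)" by simp
  then have "sg x * ell A x = 2 * (sg x * (x \<bullet> snd A)) - fst A * (sg x + (sg x - 1))"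
    unfolding ell_def by (simp add: algebra_simps)
  also have "\<dots> = lin A x" by (simp add: lin_def lor_def hyp_def inner_commute algebra_simps)
  finally show ?thesis by simp
qed

lemma lin_sign:
  assumes "x \<in> hspace"
  shows "lin A x < 0 \<longleftrightarrow> ell A x < 0" "lin A x = 0 \<longleftrightarrow> ell A x = 0" "lin A x > 0 \<longleftrightarrow> ell A x > 0"
  using sg_pos[OF assms] by (auto simp: lin_ell[OF assms] mult_less_0_iff zero_less_mult_iff)

lemma continuous_on_sg [continuous_intros]: "continuous_on hspace sg"
  unfolding sg_def using hspace_pos by (intro continuous_intros) force

lemma continuous_on_hyp: "continuous_on hspace hyp"
  unfolding hyp_def by (intro continuous_intros)

lemma continuous_on_lin: "continuous_on hspace (lin A)"
  unfolding lin_def by (intro continuous_intros continuous_on_hyp)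

lemma lor_hyp_self: assumes "x \<in> hspace" shows "lor (hyp x) (hyp x) = -1"
proof -
  have "sg x * (x \<bullet> x) = sg x - 1" using sg_mult[OF assms] by (simp add: algebra_simps)
  then have "4 * sg x * (sg x * (x \<bullet> x)) = 4 * sg x * (sg x - 1)" by simp
  then show ?thesis
    by (simp add: lor_def hyp_def power2_eq_square algebra_simps)
qed

text \<open>
  The negative of this product is the hyperbolic cosine of the distance, see \<open>hdist_lor\<close>.
\<close>
lemma lor_hyp_hyp:
  assumes "x \<in> hspace" "y \<in> hspace"
  shows "lor (hyp x) (hyp y) = - (1 + 2 * ((x - y) \<bullet> (x - y)) * sg x * sg y)"
proof -
  have x: "sg x * (x \<bullet> x) = sg x - 1" using sg_mult[OF assms(1)] by (simp add: algebra_simps)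
  have y: "sg y * (y \<bullet> y) = sg y - 1" using sg_mult[OF assms(2)] by (simp add: algebra_simps)
  have "2 * ((x - y) \<bullet> (x - y)) * sg x * sg y
     = 2 * (sg x * (x \<bullet> x)) * sg y + 2 * sg x * (sg y * (y \<bullet> y)) - 4 * sg x * sg y * (x \<bullet> y)"
    by (simp add: inner_diff inner_commute algebra_simps)
  also have "\<dots> = 2 * (sg x - 1) * sg y + 2 * sg x * (sg y - 1) - 4 * sg x * sg y * (x \<bullet> y)"
    by (simp only: x y)
  finally show ?thesis
    by (simp add: lor_def hyp_def algebra_simps)
qed

lemma hdist_lor:
  assumes "x \<in> hspace" "y \<in> hspace"
  shows "hdist x y = arcosh (- lor (hyp x) (hyp y))"
  unfolding lor_hyp_hyp[OF assms] hdist_def by (simp add: sg_def power2_norm_eq_inner add.commute)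

lemma lor_hyp_le: "x \<in> hspace \<Longrightarrow> y \<in> hspace \<Longrightarrow> lor (hyp x) (hyp y) \<le> -1"
  using sg_pos[of x] sg_pos[of y] by (simp add: lor_hyp_hyp)

lemma lor_hyp_lt: "x \<in> hspace \<Longrightarrow> y \<in> hspace \<Longrightarrow> x \<noteq> y \<Longrightarrow> lor (hyp x) (hyp y) < -1"
  using sg_pos[of x] sg_pos[of y] by (simp add: lor_hyp_hyp)

lemma chart_hyp: assumes "x \<in> hspace" shows "chart (hyp x) = x"
  using sg_pos[OF assms] by (simp add: chart_def hyp_def)

lemma hyp_chart:
  assumes "lor Y Y = -1" "0 < fst Y"
  shows "chart Y \<in> hspace" "hyp (chart Y) = Y"
proof -
  define a where "a = fst Y"
  define v where "v = snd Y"
  have Y: "Y = (a, v)" by (simp add: a_def v_def)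
  have vv: "v \<bullet> v = (a + 1) * (a - 1)" using assms(1) by (simp add: Y lor_def algebra_simps)
  have a: "a > 0" using assms(2) by (simp add: Y)
  have c: "chart Y = (1 / (1 + a)) *\<^sub>R v" by (simp add: chart_def Y)
  have "chart Y \<bullet> chart Y = (v \<bullet> v) / (1 + a) / (1 + a)" by (simp add: c)
  also have "\<dots> = (a - 1) / (1 + a)" using a by (simp add: vv add.commute)
  finally have cc: "chart Y \<bullet> chart Y = (a - 1) / (1 + a)" .
  show h: "chart Y \<in> hspace" using a by (simp add: hspace_iff cc)
  have s: "sg (chart Y) = (1 + a) / 2" using a by (simp add: sg_def cc field_simps)
  show "hyp (chart Y) = Y" using a unfolding hyp_def s unfolding c by (simp add: Y field_simps)
qed

lemma hyp_fst_pos: assumes "x \<in> hspace" shows "0 < fst (hyp x)"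
  using sg_ge1[OF assms] by (simp add: hyp_def)

lemma hyp_inj: "x \<in> hspace \<Longrightarrow> y \<in> hspace \<Longrightarrow> hyp x = hyp y \<Longrightarrow> x = y"
  by (metis chart_hyp)

lemma nrm_ell:
  assumes "lor A A = 1"
  shows "nrm A x \<bullet> nrm A x = 1 - fst A * ell A x"
  using assms by (simp add: lor_def nrm_def ell_def inner_diff inner_commute algebra_simps power2_eq_square)

lemma nrm_pos:
  assumes "lor A A = 1" "x \<in> hspace"
  shows "0 < nrm A x \<bullet> nrm A x"
proof -
  have "nrm A x \<noteq> 0"
  proof
    assume "nrm A x = 0"
    then have "snd A = fst A *\<^sub>R x" by (simp add: nrm_def)
    then have "fst A * fst A * (x \<bullet> x - 1) = 1" using assms(1) by (simp add: lor_def algebra_simps)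
    moreover have "fst A * fst A * (x \<bullet> x - 1) \<le> 0"
      using assms(2) by (intro mult_nonneg_nonpos) (auto simp: hspace_iff)
    ultimately show False by simp
  qed
  then show ?thesis by simp
qed

text \<open>
  The conformal factor of the reflection at \<open>x\<close> is \<open>1 / (nrm A x \<bullet> nrm A x)\<close>; preserving the
  hyperbolic metric means that \<open>1 - x \<bullet> x\<close> scales by the same factor.
\<close>
lemma hrefl_norm:
  assumes "lor A A = 1" "x \<in> hspace"
  shows "1 - hrefl A x \<bullet> hrefl A x = (1 - x \<bullet> x) / (nrm A x \<bullet> nrm A x)"
proof -
  define m where "m = nrm A x"
  define e where "e = m \<bullet> m"
  define l where "l = ell A x"
  have e: "e > 0" using nrm_pos[OF assms] by (simp add: e_def m_def)
  have e2: "e = 1 - fst A * l" using nrm_ell[OF assms(1)] by (simp add: e_def m_def l_def)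
  have xm: "2 * (x \<bullet> m) = l + fst A * (1 - x \<bullet> x)"
    by (simp add: m_def nrm_def l_def ell_def inner_diff algebra_simps)
  have "hrefl A x \<bullet> hrefl A x = x \<bullet> x - 2 * (l / e) * (x \<bullet> m) + (l / e) * (l / e) * e"
    by (simp add: hrefl_def m_def[symmetric] l_def[symmetric] e_def[symmetric] inner_diff inner_commute)
  also have "\<dots> = x \<bullet> x - (l / e) * (2 * (x \<bullet> m)) + l * l / e" using e by simp
  also have "\<dots> = x \<bullet> x - (l / e) * (l + fst A * (1 - x \<bullet> x)) + l * l / e" by (simp only: xm)
  also have "\<dots> = x \<bullet> x - (fst A * l) * (1 - x \<bullet> x) / e" using e by (simp add: field_simps)
  also have "\<dots> = x \<bullet> x - (1 - e) * (1 - x \<bullet> x) / e" by (simp add: e2)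
  finally show ?thesis using e by (simp add: m_def[symmetric] e_def[symmetric] field_simps)
qed

lemma hrefl_hspace: assumes "lor A A = 1" "x \<in> hspace" shows "hrefl A x \<in> hspace"
  using hrefl_norm[OF assms] nrm_pos[OF assms] hspace_pos[OF assms(2)]
  by (metis divide_pos_pos diff_gt_0_iff_gt hspace_iff)

lemma sg_hrefl: assumes "lor A A = 1" "x \<in> hspace"
  shows "sg (hrefl A x) = sg x * (nrm A x \<bullet> nrm A x)"
  by (simp add: sg_def hrefl_norm[OF assms])

text \<open>
  In the hyperboloid model a reflection is linear. Involutivity, the invariance of distances and
  the change of sign of \<open>lin A\<close> are immediate from this formula.
\<close>
lemma hyp_hrefl:
  assumes "lor A A = 1" "x \<in> hspace"
  shows "hyp (hrefl A x) = hyp x - (2 * lin A x) *\<^sub>R A"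
proof -
  define m where "m = nrm A x"
  define e where "e = m \<bullet> m"
  define l where "l = ell A x"
  have e: "e > 0" using nrm_pos[OF assms] by (simp add: e_def m_def)
  have e2: "e = 1 - fst A * l" using nrm_ell[OF assms(1)] by (simp add: e_def m_def l_def)
  have s: "sg (hrefl A x) = sg x * e" by (simp add: sg_hrefl[OF assms] e_def m_def)
  have li: "lin A x = sg x * l" using lin_ell[OF assms(2)] by (simp add: l_def)
  have 1: "2 * sg (hrefl A x) - 1 = 2 * sg x - 1 - 2 * lin A x * fst A"
    by (simp add: s li e2 algebra_simps)
  have "(2 * sg (hrefl A x)) *\<^sub>R hrefl A x = (2 * sg x) *\<^sub>R (e *\<^sub>R x - l *\<^sub>R m)"
    using e by (simp only: s) (simp add: hrefl_def l_def[symmetric] m_def[symmetric] e_def[symmetric] scaleR_diff_right mult.assoc)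
  also have "e *\<^sub>R x - l *\<^sub>R m = x - l *\<^sub>R snd A"
    by (simp add: e2 m_def nrm_def algebra_simps)
  finally have 2: "(2 * sg (hrefl A x)) *\<^sub>R hrefl A x = (2 * sg x) *\<^sub>R x - (2 * lin A x) *\<^sub>R snd A"
    by (simp add: li algebra_simps)
  show ?thesis using 1 2 by (simp add: hyp_def prod_eq_iff)
qed

lemma lin_hrefl: assumes "lor A A = 1" "x \<in> hspace" shows "lin A (hrefl A x) = - lin A x"
  using assms by (simp add: lin_def hyp_hrefl lor_simps)

lemma hrefl_hrefl: assumes "lor A A = 1" "x \<in> hspace" shows "hrefl A (hrefl A x) = x"
proof (rule hyp_inj)
  show "hyp (hrefl A (hrefl A x)) = hyp x"
    using assms by (simp add: hyp_hrefl hrefl_hspace lin_hrefl)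
qed (use assms hrefl_hspace[OF assms(1) hrefl_hspace[OF assms]] in auto)

lemma hrefl_fix: assumes "lin A x = 0" "x \<in> hspace" shows "hrefl A x = x"
  using assms by (simp add: hrefl_def lin_sign)

lemma continuous_on_hrefl: assumes "lor A A = 1" shows "continuous_on hspace (hrefl A)"
  unfolding hrefl_def ell_def nrm_def
  using nrm_pos[OF assms] by (intro continuous_intros) (force simp: nrm_def)

lemma hrefl_cont_joint:
  assumes "\<And>k. lor (A k) (A k) = 1" "lor A0 A0 = 1" "A \<longlonglongrightarrow> A0" "x \<longlonglongrightarrow> x0"
    "x0 \<in> hspace"
  shows "(\<lambda>k. hrefl (A k) (x k)) \<longlonglongrightarrow> hrefl A0 x0"
proof -
  have "nrm A0 x0 \<bullet> nrm A0 x0 \<noteq> 0" using nrm_pos[OF assms(2,5)] by simp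
  moreover have "(\<lambda>k. nrm (A k) (x k)) \<longlonglongrightarrow> nrm A0 x0"
    unfolding nrm_def by (intro tendsto_intros assms)
  moreover have "(\<lambda>k. ell (A k) (x k)) \<longlonglongrightarrow> ell A0 x0"
    unfolding ell_def by (intro tendsto_intros assms)
  ultimately show ?thesis
    unfolding hrefl_def by (intro tendsto_intros assms)
qed

lemma lin_tendsto:
  assumes "A \<longlonglongrightarrow> A0" "x \<longlonglongrightarrow> x0" "x0 \<in> hspace" "\<And>k. x k \<in> hspace"
  shows "(\<lambda>k. lin (A k) (x k)) \<longlonglongrightarrow> lin A0 x0"
proof -
  have "(\<lambda>k. hyp (x k)) \<longlonglongrightarrow> hyp x0"
    using continuous_on_tendsto_compose[OF continuous_on_hyp assms(2,3)] assms(4) by simp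
  then show ?thesis unfolding lin_def by (intro tendsto_intros assms)
qed

section \<open>Gradients, Hessians and the hyperbolic Laplacian\<close>

text \<open>
  The gradient and the Hessian are carried along as explicit functions, so that the rules below
  compute them for sums, products, compositions and reflections. Continuity of the Hessian is not
  part of the notion: the maximum principle uses it only pointwise.
\<close>
definition jets :: "'a::euclidean_space set \<Rightarrow> ('a \<Rightarrow> real) \<Rightarrow> ('a \<Rightarrow> 'a) \<Rightarrow> ('a \<Rightarrow> 'a \<Rightarrow> 'a) \<Rightarrow> bool" where
  "jets S u G H \<longleftrightarrow> open S \<and>
     (\<forall>x\<in>S. (u has_derivative (\<lambda>h. G x \<bullet> h)) (at x) \<and> (G has_derivative H x) (at x))"

definition trace_op :: "('a::euclidean_space \<Rightarrow> 'a) \<Rightarrow> real" where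
  "trace_op T = (\<Sum>b\<in>Basis. T b \<bullet> b)"

text \<open>
  The hyperbolic Laplacian at \<open>x\<close> of a function with Euclidean gradient \<open>g\<close> and Hessian \<open>T\<close>
  there, see \<open>hlaplacian_jets\<close>.
\<close>
definition lapl :: "'a::euclidean_space \<Rightarrow> 'a \<Rightarrow> ('a \<Rightarrow> 'a) \<Rightarrow> real" where
  "lapl x g T = trace_op T / (4 * (sg x)\<^sup>2) + (real DIM('a) - 2) * (x \<bullet> g) / (2 * sg x)"

lemma jetsD:
  assumes "jets S u G H" "x \<in> S"
  shows "(u has_derivative (\<lambda>h. G x \<bullet> h)) (at x)" "(G has_derivative H x) (at x)"
  using assms by (auto simp: jets_def)

lemma jets_open: "jets S u G H \<Longrightarrow> open S" by (simp add: jets_def)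

lemma jets_subset: "jets S u G H \<Longrightarrow> open T \<Longrightarrow> T \<subseteq> S \<Longrightarrow> jets T u G H"
  by (auto simp: jets_def)

lemma jets_continuous:
  assumes "jets S u G H"
  shows "continuous_on S u" "continuous_on S G"
  using jetsD[OF assms]
  by (auto intro!: continuous_at_imp_continuous_on intro: has_derivative_continuous)

lemma jets_cong:
  assumes "jets S u G H" "\<And>x. x \<in> S \<Longrightarrow> v x = u x"
  shows "jets S v G H"
  unfolding jets_def
proof (intro conjI ballI)
  show "open S" using jets_open[OF assms(1)] .
  fix x assume x: "x \<in> S"
  show "(v has_derivative (\<lambda>h. G x \<bullet> h)) (at x)"
    using has_derivative_transform_within_open[OF jetsD(1)[OF assms(1) x] jets_open[OF assms(1)] x]
      assms(2) by simp
  show "(G has_derivative H x) (at x)" using jetsD(2)[OF assms(1) x] .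
qed

lemma jets_add:
  assumes "jets S u G H" "jets S v G' H'"
  shows "jets S (\<lambda>x. u x + v x) (\<lambda>x. G x + G' x) (\<lambda>x h. H x h + H' x h)"
  unfolding jets_def using jets_open[OF assms(1)]
  by (auto intro!: jetsD[OF assms(1)] jetsD[OF assms(2)] has_derivative_add
      has_derivative_eq_rhs[OF has_derivative_add[OF jetsD(1)[OF assms(1)] jetsD(1)[OF assms(2)]]]
      simp: inner_add_left fun_eq_iff)

lemma jets_diff:
  assumes "jets S u G H" "jets S v G' H'"
  shows "jets S (\<lambda>x. u x - v x) (\<lambda>x. G x - G' x) (\<lambda>x h. H x h - H' x h)"
  unfolding jets_def using jets_open[OF assms(1)]
  by (auto intro!: jetsD[OF assms(1)] jetsD[OF assms(2)] has_derivative_diff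
      has_derivative_eq_rhs[OF has_derivative_diff[OF jetsD(1)[OF assms(1)] jetsD(1)[OF assms(2)]]]
      simp: inner_diff_left fun_eq_iff)

lemma jets_scale:
  assumes "jets S u G H"
  shows "jets S (\<lambda>x. c * u x) (\<lambda>x. c *\<^sub>R G x) (\<lambda>x h. c *\<^sub>R H x h)"
  unfolding jets_def using jets_open[OF assms(1)]
  by (auto intro!: jetsD[OF assms(1)] has_derivative_scaleR_right
      has_derivative_eq_rhs[OF has_derivative_mult_right[OF jetsD(1)[OF assms(1)]]]
      simp: fun_eq_iff)

lemma jets_const: "open S \<Longrightarrow> jets S (\<lambda>x. c) (\<lambda>x. 0) (\<lambda>x h. 0)"
  by (auto simp: jets_def)

lemma jets_inner: "open S \<Longrightarrow> jets S (\<lambda>x. x \<bullet> a) (\<lambda>x. a) (\<lambda>x h. 0)"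
  by (auto simp: jets_def intro!: derivative_eq_intros simp: inner_commute)

lemma jets_mult:
  assumes "jets S u G H" "jets S v G' H'"
  shows "jets S (\<lambda>x. u x * v x) (\<lambda>x. u x *\<^sub>R G' x + v x *\<^sub>R G x)
     (\<lambda>x h. u x *\<^sub>R H' x h + (G x \<bullet> h) *\<^sub>R G' x + (v x *\<^sub>R H x h + (G' x \<bullet> h) *\<^sub>R G x))"
  unfolding jets_def
proof (intro conjI ballI)
  show "open S" using jets_open[OF assms(1)] .
  fix x assume x: "x \<in> S"
  note d = jetsD[OF assms(1) x] jetsD[OF assms(2) x]
  show "((\<lambda>x. u x * v x) has_derivative (\<lambda>h. (u x *\<^sub>R G' x + v x *\<^sub>R G x) \<bullet> h)) (at x)"
    by (rule has_derivative_eq_rhs[OF has_derivative_mult[OF d(1) d(3)]])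
       (simp add: fun_eq_iff inner_add_left mult.commute)
  show "((\<lambda>x. u x *\<^sub>R G' x + v x *\<^sub>R G x) has_derivative
     (\<lambda>h. u x *\<^sub>R H' x h + (G x \<bullet> h) *\<^sub>R G' x + (v x *\<^sub>R H x h + (G' x \<bullet> h) *\<^sub>R G x))) (at x)"
    by (intro has_derivative_add has_derivative_scaleR d)
qed

lemma jets_compose:
  assumes "jets S u G H"
    and "\<And>x. x \<in> S \<Longrightarrow> (F has_real_derivative F' (u x)) (at (u x))"
    and "\<And>x. x \<in> S \<Longrightarrow> (F' has_real_derivative F'' (u x)) (at (u x))"
  shows "jets S (\<lambda>x. F (u x)) (\<lambda>x. F' (u x) *\<^sub>R G x)
     (\<lambda>x h. F' (u x) *\<^sub>R H x h + (F'' (u x) * (G x \<bullet> h)) *\<^sub>R G x)"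
  unfolding jets_def
proof (intro conjI ballI)
  show "open S" using jets_open[OF assms(1)] .
  fix x assume x: "x \<in> S"
  show "((\<lambda>x. F (u x)) has_derivative (\<lambda>h. (F' (u x) *\<^sub>R G x) \<bullet> h)) (at x)"
    using has_derivative_compose[OF jetsD(1)[OF assms(1) x] assms(2)[OF x, unfolded has_field_derivative_def]]
    by simp
  have 1: "((\<lambda>x. F' (u x)) has_derivative (\<lambda>h. F'' (u x) * (G x \<bullet> h))) (at x)"
    using has_derivative_compose[OF jetsD(1)[OF assms(1) x] assms(3)[OF x, unfolded has_field_derivative_def]]
    by simp
  show "((\<lambda>x. F' (u x) *\<^sub>R G x) has_derivative
          (\<lambda>h. F' (u x) *\<^sub>R H x h + (F'' (u x) * (G x \<bullet> h)) *\<^sub>R G x)) (at x)"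
    using has_derivative_scaleR[OF 1 jetsD(2)[OF assms(1) x]] by simp
qed

lemma trace_op_simps:
  "trace_op (\<lambda>h. S h + T h) = trace_op S + trace_op T"
  "trace_op (\<lambda>h. S h - T h) = trace_op S - trace_op T"
  "trace_op (\<lambda>h. c *\<^sub>R S h) = c * trace_op S"
  "trace_op (\<lambda>h. (k * (a \<bullet> h)) *\<^sub>R b) = k * (a \<bullet> b)"
  "trace_op (\<lambda>h. (k * (h \<bullet> a)) *\<^sub>R b) = k * (a \<bullet> b)"
  "trace_op (\<lambda>h. (a \<bullet> h) *\<^sub>R b) = a \<bullet> b"
  "trace_op (\<lambda>h. (h \<bullet> a) *\<^sub>R b) = a \<bullet> b"
  "trace_op (\<lambda>h. h :: 'a::euclidean_space) = DIM('a)"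
  "trace_op (\<lambda>h. 0) = 0"
  by (simp_all add: trace_op_def inner_add_left inner_diff_left sum.distrib sum_subtractf
      sum_distrib_left euclidean_inner[of a b] mult.assoc inner_commute[of _ a])

lemma lapl_simps:
  "lapl x (g + g') (\<lambda>h. T h + T' h) = lapl x g T + lapl x g' T'"
  "lapl x (g - g') (\<lambda>h. T h - T' h) = lapl x g T - lapl x g' T'"
  "lapl x (c *\<^sub>R g) (\<lambda>h. c *\<^sub>R T h) = c * lapl x g T"
  "lapl x 0 (\<lambda>h. 0) = 0"
  by (simp_all add: lapl_def trace_op_simps algebra_simps add_divide_distrib diff_divide_distrib)

lemma lapl_mult:
  "lapl x (u *\<^sub>R g' + v *\<^sub>R g) (\<lambda>h. u *\<^sub>R H' h + (g \<bullet> h) *\<^sub>R g' + (v *\<^sub>R H h + (g' \<bullet> h) *\<^sub>R g))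
   = u * lapl x g' H' + v * lapl x g H + 2 * ((g \<bullet> g') / (4 * (sg x)\<^sup>2))"
  unfolding lapl_def trace_op_simps
  by (simp add: inner_commute algebra_simps add_divide_distrib diff_divide_distrib)

lemma lapl_compose:
  "lapl x (c *\<^sub>R g) (\<lambda>h. c *\<^sub>R H h + (d * (g \<bullet> h)) *\<^sub>R g)
   = c * lapl x g H + d * ((g \<bullet> g) / (4 * (sg x)\<^sup>2))"
  unfolding lapl_def trace_op_simps
  by (simp add: inner_commute algebra_simps add_divide_distrib diff_divide_distrib)

lemma sg_deriv:
  assumes "x \<in> hspace"
  shows "(sg has_derivative (\<lambda>h. (2 * (sg x)\<^sup>2) *\<^sub>R x \<bullet> h)) (at x)"
proof -
  have "1 - x \<bullet> x \<noteq> 0" using hspace_pos[OF assms] by simp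
  then show ?thesis
    unfolding sg_def
    by (auto intro!: derivative_eq_intros simp: inner_commute power2_eq_square field_simps)
qed

text \<open>
  Expanding the divergence, \<open>\<Delta>u = \<rho>\<^sup>-\<^sup>2 tr(D\<^sup>2u) + (n - 2) \<rho>\<^sup>-\<^sup>1 x \<bullet> Du\<close>, because the
  gradient of \<open>\<rho>\<close> is \<open>\<rho>\<^sup>2 x\<close>.
\<close>
lemma hlaplacian_jets:
  fixes x :: "'a::euclidean_space"
  assumes J: "jets S u G H" and x: "x \<in> S" and S: "S \<subseteq> hspace" and n: "2 \<le> DIM('a)"
  shows "hlaplacian u x = lapl x (G x) (H x)"
proof -
  define n where "n = DIM('a)"
  \<comment> \<open>The factor \<open>\<rho>\<^sup>n\<close> in the divergence absorbs the \<open>\<rho>\<^sup>-\<^sup>2\<close> of the gradient, leaving \<open>\<rho>\<^sup>n\<^sup>-\<^sup>2\<close>.\<close>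
  define k where "k = n - 2"
  have nk: "n = k + 2" using n by (simp add: n_def k_def)
  have xh: "x \<in> hspace" using x S by auto
  have fd: "dird b u y = G y \<bullet> b" if "y \<in> S" for b y
    unfolding dird_def using frechet_derivative_at[OF jetsD(1)[OF J that]] by metis
  have hg: "hgrad u y = (1 / (hconf y)\<^sup>2) *\<^sub>R G y" if "y \<in> S" for y
    unfolding hgrad_def by (simp add: fd[OF that] euclidean_representation)
  have hp: "hconf y \<noteq> 0" if "y \<in> S" for y
    using sg_pos[of y] S that by (auto simp: hconf_sg)
  have eq: "hconf y ^ k * (G y \<bullet> b) = hconf y ^ n * (hgrad u y \<bullet> b)" if "y \<in> S" for y b
    using hp[OF that] by (simp add: hg[OF that] nk power_add power2_eq_square)
  have dh: "(hconf has_derivative (\<lambda>h. (hconf x)\<^sup>2 * (x \<bullet> h))) (at x)"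
  proof -
    have e: "hconf = (\<lambda>y::'a. 2 * sg y)" by (rule ext) (rule hconf_sg)
    show ?thesis unfolding e
      using has_derivative_mult_right[OF sg_deriv[OF xh], of 2] by (simp add: power_mult_distrib mult.assoc)
  qed
  have d: "((\<lambda>y. hconf y ^ k * (G y \<bullet> b)) has_derivative
     (\<lambda>h. hconf x ^ k * (H x h \<bullet> b) + of_nat k * (hconf x)\<^sup>2 * (x \<bullet> h) * hconf x ^ (k - 1) * (G x \<bullet> b))) (at x)" for b
    by (auto intro!: derivative_eq_intros dh jetsD(2)[OF J x] simp: algebra_simps)
  have pw: "of_nat k * (hconf x)\<^sup>2 * (x \<bullet> h) * hconf x ^ (k - 1) * c
      = hconf x ^ k * (of_nat k * hconf x * (x \<bullet> h) * c)" for h :: 'a and c :: real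
    by (cases k) (simp_all add: power2_eq_square)
  have db: "dird b (\<lambda>y. hconf y ^ n * (hgrad u y \<bullet> b)) x
     = hconf x ^ k * (H x b \<bullet> b + of_nat k * hconf x * (x \<bullet> b) * (G x \<bullet> b))" for b
  proof -
    have "((\<lambda>y. hconf y ^ n * (hgrad u y \<bullet> b)) has_derivative
     (\<lambda>h. hconf x ^ k * (H x h \<bullet> b) + of_nat k * (hconf x)\<^sup>2 * (x \<bullet> h) * hconf x ^ (k - 1) * (G x \<bullet> b))) (at x)"
      using has_derivative_transform_within_open[OF d jets_open[OF J] x eq] .
    from frechet_derivative_at[OF this] show ?thesis
      unfolding dird_def by (metis (no_types, lifting) pw distrib_left)
  qed
  have "hlaplacian u x = (1 / hconf x ^ n) * (\<Sum>b\<in>Basis. hconf x ^ k * (H x b \<bullet> b + of_nat k * hconf x * (x \<bullet> b) * (G x \<bullet> b)))"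
    unfolding hlaplacian_def hdiv_def n_def[symmetric] by (simp add: db)
  also have "\<dots> = (1 / (hconf x)\<^sup>2) * (\<Sum>b\<in>Basis. H x b \<bullet> b + of_nat k * hconf x * (x \<bullet> b) * (G x \<bullet> b))"
    using hp[OF x] by (simp add: nk power_add sum_distrib_left[symmetric] power2_eq_square)
  also have "(\<Sum>b\<in>Basis. H x b \<bullet> b + of_nat k * hconf x * (x \<bullet> b) * (G x \<bullet> b))
     = trace_op (H x) + of_nat k * hconf x * (x \<bullet> G x)"
    by (simp add: sum.distrib trace_op_def euclidean_inner[of x "G x"] sum_distrib_left mult.assoc)
  also have "(1 / (hconf x)\<^sup>2) * \<dots> = lapl x (G x) (H x)"
    using hp[OF x] nk by (simp add: lapl_def hconf_sg n_def[symmetric] field_simps power2_eq_square)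
  finally show ?thesis .
qed

text \<open>
  The Euclidean gradient of \<open>lin A\<close>.
\<close>
definition glin :: "real \<times> 'a::euclidean_space \<Rightarrow> 'a \<Rightarrow> 'a" where
  "glin A x = (2 * sg x) *\<^sub>R snd A + (4 * (sg x)\<^sup>2 * (x \<bullet> snd A - fst A)) *\<^sub>R x"

lemma jets_sg: "jets hspace sg (\<lambda>x. (2 * (sg x)\<^sup>2) *\<^sub>R x)
   (\<lambda>x h. (2 * (sg x)\<^sup>2) *\<^sub>R h + (8 * (sg x) ^ 3 * (x \<bullet> h)) *\<^sub>R x)"
  unfolding jets_def
proof (intro conjI ballI)
  show "open (hspace :: 'a set)" by (rule open_hspace)
  fix x :: 'a assume x: "x \<in> hspace"
  show "(sg has_derivative (\<lambda>h. (2 * (sg x)\<^sup>2) *\<^sub>R x \<bullet> h)) (at x)" by (rule sg_deriv[OF x])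
  have "((\<lambda>x. (2 * (sg x * sg x)) *\<^sub>R x) has_derivative
     (\<lambda>h. (2 * (sg x * sg x)) *\<^sub>R h + (2 * (sg x * ((2 * (sg x)\<^sup>2) *\<^sub>R x \<bullet> h) + ((2 * (sg x)\<^sup>2) *\<^sub>R x \<bullet> h) * sg x)) *\<^sub>R x)) (at x)"
    by (intro has_derivative_scaleR has_derivative_mult_right has_derivative_mult sg_deriv[OF x] has_derivative_ident)
  then show "((\<lambda>x. (2 * (sg x)\<^sup>2) *\<^sub>R x) has_derivative
      (\<lambda>h. (2 * (sg x)\<^sup>2) *\<^sub>R h + (8 * (sg x) ^ 3 * (x \<bullet> h)) *\<^sub>R x)) (at x)"
    unfolding power2_eq_square power3_eq_cube by (rule has_derivative_eq_rhs) (simp add: fun_eq_iff algebra_simps)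
qed

lemma lapl_sg:
  fixes x :: "'a::euclidean_space"
  assumes "x \<in> hspace"
  shows "lapl x ((2 * (sg x)\<^sup>2) *\<^sub>R x) (\<lambda>h. (2 * (sg x)\<^sup>2) *\<^sub>R h + (8 * (sg x) ^ 3 * (x \<bullet> h)) *\<^sub>R x)
    = real DIM('a) * (sg x - 1/2)"
proof -
  have s: "sg x * (x \<bullet> x) = sg x - 1" using sg_mult[OF assms] by (simp add: algebra_simps)
  have "lapl x ((2 * (sg x)\<^sup>2) *\<^sub>R x) (\<lambda>h. (2 * (sg x)\<^sup>2) *\<^sub>R h + (8 * (sg x) ^ 3 * (x \<bullet> h)) *\<^sub>R x)
     = real DIM('a) / 2 + real DIM('a) * (sg x * (x \<bullet> x))"
    using sg_pos[OF assms] unfolding lapl_def trace_op_simps by (simp add: field_simps power2_eq_square power3_eq_cube)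
  then show ?thesis unfolding s by (simp add: algebra_simps)
qed

text \<open>
  Restrictions of linear functions to the hyperboloid are eigenfunctions of the Laplacian.
\<close>
lemma jets_lin:
  fixes A :: "real \<times> 'a::euclidean_space"
  shows "\<exists>H. jets hspace (lin A) (glin A) H \<and> (\<forall>x\<in>hspace. lapl x (glin A x) (H x) = real DIM('a) * lin A x)"
proof -
  let ?G = "\<lambda>x. (2 * (sg x)\<^sup>2) *\<^sub>R x"
  let ?H = "\<lambda>x h. (2 * (sg x)\<^sup>2) *\<^sub>R h + (8 * (sg x) ^ 3 * (x \<bullet> h)) *\<^sub>R x"
  note J1 = jets_mult[OF jets_sg jets_inner[OF open_hspace, of "snd A"]]
  note J = jets_diff[OF jets_scale[OF J1, of 2] jets_scale[OF jets_diff[OF jets_scale[OF jets_sg, of 2] jets_const[OF open_hspace, of 1]], of "fst A"]]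
  have le: "lin A x = 2 * (sg x * (x \<bullet> snd A)) - fst A * (2 * sg x - 1)" for x
    by (simp add: lin_def lor_def hyp_def inner_commute algebra_simps)
  have ge: "2 *\<^sub>R (sg x *\<^sub>R snd A + (x \<bullet> snd A) *\<^sub>R ?G x) - fst A *\<^sub>R (2 *\<^sub>R ?G x - 0) = glin A x" for x
    by (simp add: glin_def algebra_simps)
  define H where "H x h = 2 *\<^sub>R (sg x *\<^sub>R 0 + (?G x \<bullet> h) *\<^sub>R snd A + ((x \<bullet> snd A) *\<^sub>R ?H x h + (snd A \<bullet> h) *\<^sub>R ?G x))
      - fst A *\<^sub>R (2 *\<^sub>R ?H x h - 0)" for x h
  have "jets hspace (lin A) (\<lambda>x. 2 *\<^sub>R (sg x *\<^sub>R snd A + (x \<bullet> snd A) *\<^sub>R ?G x) - fst A *\<^sub>R (2 *\<^sub>R ?G x - 0)) H"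
    unfolding H_def by (rule jets_cong[OF J]) (simp add: le)
  then have "jets hspace (lin A) (glin A) H" unfolding ge .
  moreover have "lapl x (glin A x) (H x) = real DIM('a) * lin A x" if x: "x \<in> hspace" for x
  proof -
    have s: "sg x * (x \<bullet> x) = sg x - 1" using sg_mult[OF x] by (simp add: algebra_simps)
    have 0: "lapl x (snd A) (\<lambda>h. 0) = (real DIM('a) - 2) * (x \<bullet> snd A) / (2 * sg x)"
      by (simp add: lapl_def trace_op_simps)
    have "lapl x (glin A x) (H x) = 2 * (sg x * lapl x (snd A) (\<lambda>h. 0) + (x \<bullet> snd A) * lapl x (?G x) (?H x)
        + 2 * ((?G x \<bullet> snd A) / (4 * (sg x)\<^sup>2)))
        - fst A * (2 * lapl x (?G x) (?H x) - 0)"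
      unfolding ge[symmetric] H_def[abs_def] by (simp only: lapl_mult lapl_simps(2-4))
    also have "\<dots> = real DIM('a) * lin A x"
      unfolding lapl_sg[OF x] 0 le using sg_pos[OF x] by (simp add: field_simps)
    finally show ?thesis .
  qed
  ultimately show ?thesis by blast
qed

text \<open>
  The hyperbolic scalar product of two such gradients: the tangential part of a constant vector of
  Minkowski space is obtained by adding its component along \<open>hyp x\<close>, whose Lorentz square is \<open>-1\<close>.
\<close>
lemma glin_glin:
  assumes "x \<in> hspace"
  shows "(glin A x \<bullet> glin B x) / (4 * (sg x)\<^sup>2) = lor A B + lin A x * lin B x"
proof -
  define s where "s = sg x"
  define p where "p = x \<bullet> snd A"
  define q where "q = x \<bullet> snd B"
  have s: "s > 0" using sg_pos[OF assms] by (simp add: s_def)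
  have sx: "s * (x \<bullet> x) = s - 1" using sg_mult[OF assms] by (simp add: algebra_simps s_def)
  have "glin A x \<bullet> glin B x = 4 * s\<^sup>2 * (snd A \<bullet> snd B + 2 * s * p * (q - fst B) + 2 * s * q * (p - fst A)
      + 4 * s * (s * (x \<bullet> x)) * (p - fst A) * (q - fst B))"
    by (simp add: glin_def s_def p_def q_def inner_add_left inner_add_right inner_commute power2_eq_square algebra_simps)
  then have 1: "(glin A x \<bullet> glin B x) / (4 * s\<^sup>2) = snd A \<bullet> snd B + 2 * s * p * (q - fst B) + 2 * s * q * (p - fst A)
      + 4 * s * (s - 1) * (p - fst A) * (q - fst B)"
    unfolding sx using s by simp
  have la: "lin A x = 2 * s * p - fst A * (2 * s - 1)" "lin B x = 2 * s * q - fst B * (2 * s - 1)"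
    by (simp_all add: lin_def lor_def hyp_def inner_commute s_def p_def q_def algebra_simps)
  show ?thesis unfolding s_def[symmetric] 1 la lor_def by (simp add: algebra_simps)
qed

lemma jets_line:
  assumes "jets S u G H" "x + s *\<^sub>R k \<in> S"
  shows "((\<lambda>s. u (x + s *\<^sub>R k)) has_real_derivative G (x + s *\<^sub>R k) \<bullet> k) (at s)"
proof -
  have 1: "((\<lambda>s. x + s *\<^sub>R k) has_derivative (\<lambda>h. h *\<^sub>R k)) (at s)"
    by (auto intro!: derivative_eq_intros)
  show ?thesis
    unfolding has_field_derivative_def
    using has_derivative_compose[OF 1 jetsD(1)[OF assms]] by (simp add: mult_commute_abs)
qed

lemma jets_min:
  assumes J: "jets S u G H" and x: "x \<in> S" and m: "\<And>y. y \<in> S \<Longrightarrow> u x \<le> u y"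
  shows "G x = 0" "H x h \<bullet> h \<ge> 0"
proof -
  have "(\<lambda>h. G x \<bullet> h) = (\<lambda>h. 0)"
    by (rule differential_zero_maxmin[OF x jets_open[OF J] jetsD(1)[OF J x]]) (use m in auto)
  then have "G x \<bullet> G x = 0" by metis
  then show g0: "G x = 0" by simp
  show "H x h \<bullet> h \<ge> 0"
  proof (rule ccontr)
    assume neg: "\<not> H x h \<bullet> h \<ge> 0"
    have 1: "((\<lambda>s. x + s *\<^sub>R h) has_derivative (\<lambda>d. d *\<^sub>R h)) (at 0)"
      by (auto intro!: derivative_eq_intros)
    have GH: "(G has_derivative H x) (at (x + 0 *\<^sub>R h))" using jetsD(2)[OF J x] by simp
    have lin: "linear (H x)" using jetsD(2)[OF J x] by (rule has_derivative_linear)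
    have "((\<lambda>s. G (x + s *\<^sub>R h)) has_derivative (\<lambda>d. H x (d *\<^sub>R h))) (at 0)"
      by (rule has_derivative_compose[OF 1 GH])
    then have "((\<lambda>s. G (x + s *\<^sub>R h) \<bullet> h) has_derivative (\<lambda>d. H x (d *\<^sub>R h) \<bullet> h)) (at 0)"
      by (rule has_derivative_inner_left)
    then have "((\<lambda>s. G (x + s *\<^sub>R h) \<bullet> h) has_real_derivative H x h \<bullet> h) (at 0)"
      by (simp add: has_field_derivative_def linear_scale[OF lin] mult_commute_abs)
    then obtain d where d: "d > 0" "\<forall>s>0. s < d \<longrightarrow> G (x + (0 + s) *\<^sub>R h) \<bullet> h < G (x + 0 *\<^sub>R h) \<bullet> h"
      using has_real_derivative_neg_dec_right[of "\<lambda>s. G (x + s *\<^sub>R h) \<bullet> h" "H x h \<bullet> h" 0 UNIV] neg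
      by (auto simp: not_le)
    have "continuous_on UNIV (\<lambda>s. x + s *\<^sub>R h)" by (intro continuous_intros)
    then have "open ((\<lambda>s. x + s *\<^sub>R h) -` S)" using jets_open[OF J] by (simp add: open_vimage)
    moreover have "0 \<in> (\<lambda>s. x + s *\<^sub>R h) -` S" using x by simp
    ultimately obtain r where r: "r > 0" "ball 0 r \<subseteq> (\<lambda>s. x + s *\<^sub>R h) -` S"
      by (meson openE)
    define s where "s = min d r / 2"
    have s: "0 < s" "s < d" "s < r" using d(1) r(1) by (auto simp: s_def min_def)
    have inS: "x + t *\<^sub>R h \<in> S" if "0 \<le> t" "t \<le> s" for t
      using that s r(2) by (auto simp: subset_eq dist_real_def)
    have "\<exists>z>0. z < s \<and> u (x + s *\<^sub>R h) - u (x + 0 *\<^sub>R h) = (s - 0) * (G (x + z *\<^sub>R h) \<bullet> h)"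
      by (rule MVT2[OF s(1)]) (use jets_line[OF J inS] in auto)
    then obtain z where z: "0 < z" "z < s" "u (x + s *\<^sub>R h) - u x = s * (G (x + z *\<^sub>R h) \<bullet> h)" by auto
    have "G (x + z *\<^sub>R h) \<bullet> h < 0" using d(2) z s g0 by auto
    then have "u (x + s *\<^sub>R h) < u x" using z(3) s(1) by (smt (verit) mult_pos_neg)
    then show False using m[OF inS[of s]] s(1) by simp
  qed
qed

lemma jets_lapl_min:
  fixes x :: "'a::euclidean_space"
  assumes J: "jets S u G H" and x: "x \<in> S" and m: "\<And>y. y \<in> S \<Longrightarrow> u x \<le> u y"
  shows "lapl x (G x) (H x) \<ge> 0"
  using jets_min[OF assms] by (simp add: lapl_def trace_op_def sum_nonneg)

text \<open>
  Adding a small multiple of \<open>1 - x \<bullet> x\<close>, which is positive and strictly superharmonic on the whole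
  ball, turns a negative value into a negative minimum attained inside \<open>S\<close>, where the Laplacian
  would have to be both \<open>\<ge> 0\<close> and \<open>< 0\<close>. The boundary condition is stated with compact subsets of \<open>S\<close>;
  in this form it covers functions that are not defined on the boundary, and unbounded domains, for
  which points at infinity are treated like boundary points.
\<close>
lemma max_principle:
  fixes v :: "'a::euclidean_space \<Rightarrow> real"
  assumes J: "jets S v G H" and S: "S \<subseteq> hspace" and n: "2 \<le> DIM('a)"
    and neg: "\<And>x. x \<in> S \<Longrightarrow> v x < 0 \<Longrightarrow> lapl x (G x) (H x) \<le> 0"
    and bd: "\<And>\<delta>. \<delta> > 0 \<Longrightarrow> \<exists>K. compact K \<and> K \<subseteq> S \<and> (\<forall>x\<in>S - K. v x > - \<delta>)"
    and x: "x \<in> S"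
  shows "v x \<ge> 0"
proof (rule ccontr)
  assume "\<not> v x \<ge> 0"
  define \<delta> where "\<delta> = - v x / 2"
  have d: "\<delta> > 0" "v x = - 2 * \<delta>" using \<open>\<not> v x \<ge> 0\<close> by (auto simp: \<delta>_def)
  obtain K where K: "compact K" "K \<subseteq> S" "\<forall>x\<in>S - K. v x > - \<delta>" using bd[OF d(1)] by auto
  have J2: "jets S (\<lambda>x. - (x \<bullet> x)) (\<lambda>x. (-2) *\<^sub>R x) (\<lambda>x h. (-2) *\<^sub>R h)"
    unfolding jets_def using jets_open[OF J]
    by (auto intro!: derivative_eq_intros simp: inner_commute)
  define q where "q = \<delta> / 2"
  define w where "w x = v x + q * (1 + - (x \<bullet> x))" for x
  note J3 = jets_add[OF J jets_scale[OF jets_add[OF jets_const[OF jets_open[OF J], of 1] J2], of q], folded w_def]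
  have xK: "x \<in> K" using K(3) x d by force
  have "continuous_on K w"
    using jets_continuous(1)[OF J3] K(2) continuous_on_subset by blast
  then obtain z where z: "z \<in> K" "\<forall>y\<in>K. w z \<le> w y"
    using continuous_attains_inf[OF K(1)] xK by auto
  have hb: "0 < 1 + - (y \<bullet> y)" "1 + - (y \<bullet> y) \<le> 1" if "y \<in> S" for y
    using that S by (auto simp: hspace_iff subset_eq)
  have q: "q > 0" using d by (simp add: q_def)
  have "w x \<le> v x + q * 1" unfolding w_def using hb[OF x] q by (intro add_mono mult_left_mono) auto
  then have wx: "w x < - \<delta>" using d by (simp add: q_def)
  have zS: "z \<in> S" using z K by auto
  have wz: "w z \<le> w y" if y: "y \<in> S" for y
  proof (cases "y \<in> K")
    case False
    then have "v y > - \<delta>" using K(3) y by auto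
    moreover have "w y > v y" using hb[OF y] q by (simp add: w_def)
    moreover have "w z \<le> w x" using z(2) xK by auto
    ultimately show ?thesis using wx by linarith
  qed (use z in auto)
  have "v z < w z" using hb[OF zS] q by (simp add: w_def)
  also have "\<dots> \<le> w x" using z(2) xK by auto
  finally have "v z < 0" using wx d by linarith
  then have "lapl z (G z) (H z) \<le> 0" using neg[OF zS] by auto
  moreover have "lapl z (0 + (-2) *\<^sub>R z) (\<lambda>h. 0 + (-2) *\<^sub>R h) < 0"
  proof -
    have "sg z > 0" using zS S sg_pos by auto
    moreover have "trace_op (\<lambda>h::'a. 0 + (-2) *\<^sub>R h) = -2 * real DIM('a)" by (simp only: trace_op_simps add_0_left)
    ultimately show ?thesis using n
      unfolding lapl_def by (intro add_neg_nonpos) (auto simp: divide_neg_pos divide_nonpos_pos mult_nonneg_nonpos)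
  qed
  moreover have "lapl z (G z + q *\<^sub>R (0 + (-2) *\<^sub>R z)) (\<lambda>h. H z h + q *\<^sub>R (0 + (-2) *\<^sub>R h)) \<ge> 0"
    using jets_lapl_min[OF J3 zS wz] by simp
  ultimately show False
    using q by (simp only: lapl_simps) (smt (verit) mult_pos_neg)
qed

text \<open>
  Schwarz's theorem by the symmetric second difference; differentiability of the gradient at the
  one point \<open>x\<close> is enough.
\<close>
lemma second_difference:
  assumes J: "jets S u G H" and x: "x \<in> S" and e: "e > 0"
  shows "\<exists>d>0. \<forall>s. 0 < s \<and> s < d \<longrightarrow>
    \<bar>u (x + s *\<^sub>R h + s *\<^sub>R k) - u (x + s *\<^sub>R h) - u (x + s *\<^sub>R k) + u x - s * s * (H x h \<bullet> k)\<bar> \<le> e * (s * s)"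
proof -
  define c where "c = 2 * (norm h + norm k) * norm k + 1"
  have c: "c > 0" by (simp add: c_def add_nonneg_pos)
  define e' where "e' = e / c"
  have e': "e' > 0" using e c by (simp add: e'_def)
  have lin: "linear (H x)" using jetsD(2)[OF J x] by (rule has_derivative_linear)
  obtain d1 where d1: "d1 > 0" "\<And>y. norm (y - x) < d1 \<Longrightarrow> norm (G y - G x - H x (y - x)) \<le> e' * norm (y - x)"
    using jetsD(2)[OF J x] e' unfolding has_derivative_at_alt by blast
  obtain r where r: "r > 0" "ball x r \<subseteq> S" using jets_open[OF J] x openE by blast
  define d where "d = min d1 r / (norm h + norm k + 1)"
  have hk: "norm h + norm k + 1 > 0" by (simp add: add_nonneg_pos)
  have d: "d > 0" using d1 r hk by (simp add: d_def)
  show ?thesis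
  proof (intro exI[of _ d] conjI allI impI)
    fix s assume s: "0 < s \<and> s < d"
    have sm: "s * (norm h + norm k + 1) < min d1 r"
      using s hk by (simp add: d_def pos_less_divide_eq)
    have nb: "norm (a *\<^sub>R h + t *\<^sub>R k) \<le> s * (norm h + norm k)" if "0 \<le> a" "a \<le> s" "0 \<le> t" "t \<le> s" for a t
    proof -
      have "norm (a *\<^sub>R h + t *\<^sub>R k) \<le> a * norm h + t * norm k"
        using norm_triangle_ineq[of "a *\<^sub>R h" "t *\<^sub>R k"] that by simp
      also have "\<dots> \<le> s * norm h + s * norm k" using that by (intro add_mono mult_right_mono) auto
      finally show ?thesis by (simp add: algebra_simps)
    qed
    have nb2: "norm (a *\<^sub>R h + t *\<^sub>R k) < min d1 r" if "0 \<le> a" "a \<le> s" "0 \<le> t" "t \<le> s" for a t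
      using nb[OF that] sm s by (simp add: algebra_simps)
    have inS: "x + a *\<^sub>R h + t *\<^sub>R k \<in> S" if "0 \<le> a" "a \<le> s" "0 \<le> t" "t \<le> s" for a t
    proof -
      have dxv: "dist x (x + v) = norm v" for v by (simp add: dist_norm)
      have "dist x (x + (a *\<^sub>R h + t *\<^sub>R k)) < r" using nb2[OF that] dxv[of "a *\<^sub>R h + t *\<^sub>R k"] by simp
      then show ?thesis using r(2) by (auto simp: subset_eq add.assoc)
    qed
    have "\<exists>z>0. z < s \<and> (\<lambda>t. u (x + s *\<^sub>R h + t *\<^sub>R k) - u (x + t *\<^sub>R k)) s - (\<lambda>t. u (x + s *\<^sub>R h + t *\<^sub>R k) - u (x + t *\<^sub>R k)) 0
        = (s - 0) * (G (x + s *\<^sub>R h + z *\<^sub>R k) \<bullet> k - G (x + z *\<^sub>R k) \<bullet> k)"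
      using s inS[of 0] inS[of s] by (intro MVT2 DERIV_diff jets_line[OF J]) auto
    then obtain z where z: "0 < z" "z < s" and
      D: "u (x + s *\<^sub>R h + s *\<^sub>R k) - u (x + s *\<^sub>R h) - u (x + s *\<^sub>R k) + u x
        = s * ((G (x + s *\<^sub>R h + z *\<^sub>R k) - G (x + z *\<^sub>R k)) \<bullet> k)"
      by (auto simp: inner_diff_left algebra_simps)
    define E where "E = G (x + s *\<^sub>R h + z *\<^sub>R k) - G (x + z *\<^sub>R k) - s *\<^sub>R H x h"
    have "E = (G (x + (s *\<^sub>R h + z *\<^sub>R k)) - G x - H x (s *\<^sub>R h + z *\<^sub>R k)) - (G (x + (0 *\<^sub>R h + z *\<^sub>R k)) - G x - H x (0 *\<^sub>R h + z *\<^sub>R k))"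
      by (simp add: E_def linear_add[OF lin] linear_scale[OF lin] linear_0[OF lin] algebra_simps)
    then have "norm E \<le> e' * norm (s *\<^sub>R h + z *\<^sub>R k) + e' * norm (0 *\<^sub>R h + z *\<^sub>R k)"
      using d1(2)[of "x + (s *\<^sub>R h + z *\<^sub>R k)"] d1(2)[of "x + (0 *\<^sub>R h + z *\<^sub>R k)"] nb2[of s z] nb2[of 0 z] z s
        norm_triangle_ineq4
      by (smt (verit) add_diff_cancel_left' min_less_iff_conj)
    also have "\<dots> \<le> e' * (s * (norm h + norm k)) + e' * (s * (norm h + norm k))"
      using nb[of s z] nb[of 0 z] z s e' by (intro add_mono mult_left_mono) auto
    finally have nE: "norm E \<le> e' * s * (2 * (norm h + norm k))" by (simp add: algebra_simps)
    have "\<bar>E \<bullet> k\<bar> \<le> norm E * norm k" by (rule Cauchy_Schwarz_ineq2)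
    also have "\<dots> \<le> e' * s * (2 * (norm h + norm k)) * norm k" using nE by (rule mult_right_mono) simp
    also have "\<dots> \<le> e' * s * c" using e' s by (simp add: c_def mult.assoc)
    also have "\<dots> = e * s" using c by (simp add: e'_def)
    finally have Ek: "\<bar>E \<bullet> k\<bar> \<le> e * s" .
    have "u (x + s *\<^sub>R h + s *\<^sub>R k) - u (x + s *\<^sub>R h) - u (x + s *\<^sub>R k) + u x - s * s * (H x h \<bullet> k) = s * (E \<bullet> k)"
      unfolding D by (simp add: E_def inner_diff_left algebra_simps)
    then show "\<bar>u (x + s *\<^sub>R h + s *\<^sub>R k) - u (x + s *\<^sub>R h) - u (x + s *\<^sub>R k) + u x - s * s * (H x h \<bullet> k)\<bar> \<le> e * (s * s)"
      using mult_left_mono[OF Ek, of s] s by (simp add: abs_mult mult.left_commute)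
  qed (rule d)
qed

lemma hessian_symmetric:
  assumes J: "jets S u G H" and x: "x \<in> S"
  shows "H x h \<bullet> k = H x k \<bullet> h"
proof -
  have "\<bar>H x h \<bullet> k - H x k \<bullet> h\<bar> \<le> e" if e: "e > 0" for e
  proof -
    from e have e2: "e / 2 > 0" by simp
    obtain d1 where d1: "d1 > 0" "\<And>s. 0 < s \<Longrightarrow> s < d1 \<Longrightarrow>
      \<bar>u (x + s *\<^sub>R h + s *\<^sub>R k) - u (x + s *\<^sub>R h) - u (x + s *\<^sub>R k) + u x - s * s * (H x h \<bullet> k)\<bar> \<le> e / 2 * (s * s)"
      using second_difference[OF J x e2, of h k] by blast
    obtain d2 where d2: "d2 > 0" "\<And>s. 0 < s \<Longrightarrow> s < d2 \<Longrightarrow>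
      \<bar>u (x + s *\<^sub>R k + s *\<^sub>R h) - u (x + s *\<^sub>R k) - u (x + s *\<^sub>R h) + u x - s * s * (H x k \<bullet> h)\<bar> \<le> e / 2 * (s * s)"
      using second_difference[OF J x e2, of k h] by blast
    define s where "s = min d1 d2 / 2"
    have s: "0 < s" "s < d1" "s < d2" using d1 d2 by (auto simp: s_def)
    have sw: "x + s *\<^sub>R k + s *\<^sub>R h = x + s *\<^sub>R h + s *\<^sub>R k" by simp
    have "\<bar>s * s * (H x h \<bullet> k) - s * s * (H x k \<bullet> h)\<bar> \<le> e * (s * s)"
      using d1(2)[OF s(1,2)] d2(2)[OF s(1,3)] unfolding sw by (simp add: algebra_simps abs_if split: if_splits)
    then have "(s * s) * \<bar>H x h \<bullet> k - H x k \<bullet> h\<bar> \<le> (s * s) * e"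
      by (simp add: right_diff_distrib[symmetric] abs_mult mult.commute)
    then show ?thesis using s(1) by simp
  qed
  then have "\<bar>H x h \<bullet> k - H x k \<bullet> h\<bar> \<le> 0" by (rule field_le_epsilon[where y=0, simplified])
  then show ?thesis by simp
qed

section \<open>Invariance of the Laplacian under reflections\<close>

text \<open>
  The derivative of the reflection: a scalar multiple of a Euclidean reflection, and in particular
  a symmetric matrix, which is why it also transports gradients.
\<close>
definition drefl :: "real \<times> 'a::euclidean_space \<Rightarrow> 'a \<Rightarrow> 'a \<Rightarrow> 'a" where
  "drefl A x h = (1 / (nrm A x \<bullet> nrm A x)) *\<^sub>R (h - (2 * (1 / (nrm A x \<bullet> nrm A x)) * (nrm A x \<bullet> h)) *\<^sub>R nrm A x)"

text \<open>
  The derivative in direction \<open>h\<close> of \<open>drefl A x g\<close> as a function of \<open>x\<close>, for fixed \<open>g\<close>.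
\<close>
definition d2refl :: "real \<times> 'a::euclidean_space \<Rightarrow> 'a \<Rightarrow> 'a \<Rightarrow> 'a \<Rightarrow> 'a" where
  "d2refl A x g h = (let m = nrm A x; e = 1 / (m \<bullet> m) in
     (2 * e\<^sup>2 * fst A) *\<^sub>R ((m \<bullet> h) *\<^sub>R g - ((4 * e * (m \<bullet> g)) * (m \<bullet> h)) *\<^sub>R m + ((g \<bullet> h) *\<^sub>R m + (m \<bullet> g) *\<^sub>R h)))"

lemma nrm_deriv: "(nrm A has_derivative (\<lambda>h. - (fst A *\<^sub>R h))) (at x)"
  unfolding nrm_def by (auto intro!: derivative_eq_intros)

lemma ell_deriv: "(ell A has_derivative (\<lambda>h. 2 * (nrm A x \<bullet> h))) (at x)"
  unfolding ell_def nrm_def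
  by (auto intro!: derivative_eq_intros simp: inner_diff_left inner_commute algebra_simps)

lemma enrm_deriv:
  assumes "nrm A x \<noteq> 0"
  shows "((\<lambda>x. 1 / (nrm A x \<bullet> nrm A x)) has_derivative
     (\<lambda>h. 2 * (1 / (nrm A x \<bullet> nrm A x))\<^sup>2 * fst A * (nrm A x \<bullet> h))) (at x)"
  by (rule has_derivative_eq_rhs,
      rule has_derivative_divide[OF has_derivative_const has_derivative_inner[OF nrm_deriv nrm_deriv]])
     (use assms in \<open>auto simp: fun_eq_iff power2_eq_square inner_commute field_simps\<close>)

lemma hrefl_deriv:
  assumes "lor A A = 1" "x \<in> hspace"
  shows "(hrefl A has_derivative drefl A x) (at x)"
proof -
  define m where "m = nrm A x"
  define e where "e = 1 / (m \<bullet> m)"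
  define l where "l = ell A x"
  have m0: "m \<bullet> m > 0" using nrm_pos[OF assms] by (simp add: m_def)
  have e: "e > 0" using m0 by (simp add: e_def)
  have ml: "fst A * l = 1 - m \<bullet> m" using nrm_ell[OF assms(1)] by (simp add: m_def l_def)
  have eml: "1 + fst A * l * e = e" using m0 unfolding ml e_def by (simp add: field_simps)
  have nz: "nrm A x \<noteq> 0" using m0 by (auto simp: m_def)
  have eq: "hrefl A = (\<lambda>x. x - (ell A x * (1 / (nrm A x \<bullet> nrm A x))) *\<^sub>R nrm A x)"
    by (auto simp: hrefl_def)
  have "((\<lambda>x. x - (ell A x * (1 / (nrm A x \<bullet> nrm A x))) *\<^sub>R nrm A x) has_derivative
    (\<lambda>h. h - ((ell A x * (1 / (nrm A x \<bullet> nrm A x))) *\<^sub>R (- (fst A *\<^sub>R h)) +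
        (ell A x * (2 * (1 / (nrm A x \<bullet> nrm A x))\<^sup>2 * fst A * (nrm A x \<bullet> h)) + 2 * (nrm A x \<bullet> h) * (1 / (nrm A x \<bullet> nrm A x))) *\<^sub>R nrm A x))) (at x)"
    by (intro has_derivative_diff has_derivative_ident has_derivative_scaleR has_derivative_mult
        nrm_deriv ell_deriv enrm_deriv nz)
  then show ?thesis unfolding eq
  proof (rule has_derivative_eq_rhs, intro ext)
    fix h
    have "h - ((l * e) *\<^sub>R (- (fst A *\<^sub>R h)) + (l * (2 * e\<^sup>2 * fst A * (m \<bullet> h)) + 2 * (m \<bullet> h) * e) *\<^sub>R m)
      = (1 + fst A * l * e) *\<^sub>R h - (2 * e * (m \<bullet> h) * (1 + fst A * l * e)) *\<^sub>R m"
      by (simp add: algebra_simps power2_eq_square)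
    also have "\<dots> = drefl A x h" unfolding eml drefl_def m_def[symmetric] e_def[symmetric]
      by (simp add: algebra_simps)
    finally show "h - ((ell A x * (1 / (nrm A x \<bullet> nrm A x))) *\<^sub>R (- (fst A *\<^sub>R h)) +
        (ell A x * (2 * (1 / (nrm A x \<bullet> nrm A x))\<^sup>2 * fst A * (nrm A x \<bullet> h)) + 2 * (nrm A x \<bullet> h) * (1 / (nrm A x \<bullet> nrm A x))) *\<^sub>R nrm A x)
       = drefl A x h" unfolding m_def[symmetric] e_def[symmetric] l_def[symmetric] .
  qed
qed

lemma drefl_sym: "drefl A x h \<bullet> k = h \<bullet> drefl A x k"
  by (simp add: drefl_def inner_diff_left inner_diff_right inner_commute)

lemma drefl_norm:
  assumes "lor A A = 1" "x \<in> hspace"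
  shows "norm (drefl A x h) = norm h / (nrm A x \<bullet> nrm A x)"
proof -
  define m where "m = nrm A x"
  have m0: "m \<bullet> m > 0" using nrm_pos[OF assms] by (simp add: m_def)
  have "(norm (h - (2 * (1 / (m \<bullet> m)) * (m \<bullet> h)) *\<^sub>R m))\<^sup>2 = (norm h)\<^sup>2"
    using m0 by (simp add: power2_norm_eq_inner inner_diff_left inner_diff_right inner_commute field_simps)
  then have "norm (h - (2 * (1 / (m \<bullet> m)) * (m \<bullet> h)) *\<^sub>R m) = norm h" by simp
  then show ?thesis using m0 unfolding drefl_def m_def[symmetric] by simp
qed

lemma drefl_comp_deriv:
  assumes "nrm A x \<noteq> 0" "(g has_derivative g') (at x)"
  shows "((\<lambda>x. drefl A x (g x)) has_derivative (\<lambda>h. drefl A x (g' h) + d2refl A x (g x) h)) (at x)"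
proof -
  let ?m = "nrm A x" and ?e = "1 / (nrm A x \<bullet> nrm A x)"
  have "((\<lambda>x. (1 / (nrm A x \<bullet> nrm A x)) *\<^sub>R (g x - (2 * (1 / (nrm A x \<bullet> nrm A x)) * (nrm A x \<bullet> g x)) *\<^sub>R nrm A x))
    has_derivative (\<lambda>h. ?e *\<^sub>R (g' h - ((2 * ?e * (?m \<bullet> g x)) *\<^sub>R (- (fst A *\<^sub>R h)) +
        (2 * ?e * (?m \<bullet> g' h + (- (fst A *\<^sub>R h)) \<bullet> g x) + 2 * (2 * ?e\<^sup>2 * fst A * (?m \<bullet> h)) * (?m \<bullet> g x)) *\<^sub>R ?m))
      + (2 * ?e\<^sup>2 * fst A * (?m \<bullet> h)) *\<^sub>R (g x - (2 * ?e * (?m \<bullet> g x)) *\<^sub>R ?m))) (at x)"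
    by (intro has_derivative_diff has_derivative_scaleR has_derivative_mult has_derivative_inner
        has_derivative_mult_right nrm_deriv enrm_deriv assms)
  then show ?thesis
    unfolding drefl_def
  proof (rule has_derivative_eq_rhs, intro ext)
    fix h
    define e where "e = ?e"
    define m where "m = ?m"
    define a where "a = fst A"
    show "?e *\<^sub>R (g' h - ((2 * ?e * (?m \<bullet> g x)) *\<^sub>R (- (fst A *\<^sub>R h)) +
        (2 * ?e * (?m \<bullet> g' h + (- (fst A *\<^sub>R h)) \<bullet> g x) + 2 * (2 * ?e\<^sup>2 * fst A * (?m \<bullet> h)) * (?m \<bullet> g x)) *\<^sub>R ?m))
      + (2 * ?e\<^sup>2 * fst A * (?m \<bullet> h)) *\<^sub>R (g x - (2 * ?e * (?m \<bullet> g x)) *\<^sub>R ?m)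
      = ?e *\<^sub>R (g' h - (2 * ?e * (?m \<bullet> g' h)) *\<^sub>R ?m) + d2refl A x (g x) h"
      unfolding d2refl_def Let_def unfolding e_def[symmetric] unfolding m_def[symmetric] a_def[symmetric]
      by (simp add: algebra_simps power2_eq_square inner_commute) (simp add: scaleR_left.add[symmetric])
  qed
qed

lemma jets_hrefl:
  assumes J: "jets S u G H" and A: "lor A A = 1" and T: "open T" "T \<subseteq> hspace" "\<And>x. x \<in> T \<Longrightarrow> hrefl A x \<in> S"
  shows "jets T (\<lambda>x. u (hrefl A x)) (\<lambda>x. drefl A x (G (hrefl A x)))
    (\<lambda>x h. drefl A x (H (hrefl A x) (drefl A x h)) + d2refl A x (G (hrefl A x)) h)"
  unfolding jets_def
proof (intro conjI ballI)
  show "open T" by fact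
  fix x assume x: "x \<in> T"
  then have xh: "x \<in> hspace" using T by auto
  note d = hrefl_deriv[OF A xh]
  show "((\<lambda>x. u (hrefl A x)) has_derivative (\<lambda>h. drefl A x (G (hrefl A x)) \<bullet> h)) (at x)"
    using has_derivative_compose[OF d jetsD(1)[OF J T(3)[OF x]]] by (simp add: drefl_sym)
  have nz: "nrm A x \<noteq> 0" using nrm_pos[OF A xh] by auto
  show "((\<lambda>x. drefl A x (G (hrefl A x))) has_derivative
     (\<lambda>h. drefl A x (H (hrefl A x) (drefl A x h)) + d2refl A x (G (hrefl A x)) h)) (at x)"
    by (rule drefl_comp_deriv[OF nz has_derivative_compose[OF d jetsD(2)[OF J T(3)[OF x]]]])
qed

lemma trace_op_drefl:
  fixes T :: "'a::euclidean_space \<Rightarrow> 'a"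
  assumes T: "linear T" and A: "lor A A = 1" and x: "x \<in> hspace"
  shows "trace_op (\<lambda>h. drefl A x (T (drefl A x h))) = trace_op T / (nrm A x \<bullet> nrm A x)\<^sup>2"
proof -
  define m where "m = nrm A x"
  define e where "e = 1 / (m \<bullet> m)"
  have m0: "m \<bullet> m > 0" using nrm_pos[OF A x] by (simp add: m_def)
  have em: "e * (m \<bullet> m) = 1" using m0 by (simp add: e_def)
  have "drefl A x (T (drefl A x h)) = e\<^sup>2 *\<^sub>R (T h - (2 * e * (m \<bullet> h)) *\<^sub>R T m
     - ((2 * e * (m \<bullet> T h)) *\<^sub>R m - (4 * e\<^sup>2 * (m \<bullet> T m) * (m \<bullet> h)) *\<^sub>R m))" for h
    unfolding drefl_def m_def[symmetric] e_def[symmetric]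
    by (simp add: linear_scale[OF T] linear_diff[OF T] algebra_simps power2_eq_square inner_diff_right)
  then have "trace_op (\<lambda>h. drefl A x (T (drefl A x h))) =
     e\<^sup>2 * (trace_op T - 2 * e * (m \<bullet> T m) - (trace_op (\<lambda>h. (2 * e * (m \<bullet> T h)) *\<^sub>R m) - 4 * e\<^sup>2 * (m \<bullet> T m) * (m \<bullet> m)))"
    by (simp only: trace_op_simps)
  also have "trace_op (\<lambda>h. (2 * e * (m \<bullet> T h)) *\<^sub>R m) = 2 * e * (m \<bullet> T m)"
  proof -
    have "T m = T (\<Sum>b\<in>Basis. (m \<bullet> b) *\<^sub>R b)" by (simp add: euclidean_representation)
    also have "\<dots> = (\<Sum>b\<in>Basis. (m \<bullet> b) *\<^sub>R T b)" by (simp add: linear_sum[OF T] linear_scale[OF T])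
    finally have "m \<bullet> T m = (\<Sum>b\<in>Basis. (m \<bullet> b) * (m \<bullet> T b))" by (simp add: inner_sum_right)
    then show ?thesis by (simp add: trace_op_def sum_distrib_left mult_ac)
  qed
  also have "e\<^sup>2 * (trace_op T - 2 * e * (m \<bullet> T m) - (2 * e * (m \<bullet> T m) - 4 * e\<^sup>2 * (m \<bullet> T m) * (m \<bullet> m)))
     = e\<^sup>2 * (trace_op T - 4 * e * (m \<bullet> T m) + 4 * e * (m \<bullet> T m) * (e * (m \<bullet> m)))"
    by (simp add: power2_eq_square algebra_simps)
  finally show ?thesis unfolding em by (simp add: e_def m_def power_divide)
qed

text \<open>
  Reflections are isometries, so they commute with the Laplacian. In coordinates the trace of
  the second-order part rescales by the square of the conformal factor, and the first-order terms
  match because of \<open>2 * (x \<bullet> nrm A x) = ell A x + fst A * (1 - x \<bullet> x)\<close>.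
\<close>
lemma lapl_hrefl:
  fixes T :: "'a::euclidean_space \<Rightarrow> 'a"
  assumes T: "linear T" and A: "lor A A = 1" and x: "x \<in> hspace"
  shows "lapl x (drefl A x g) (\<lambda>h. drefl A x (T (drefl A x h)) + d2refl A x g h) = lapl (hrefl A x) g T"
proof -
  define m where "m = nrm A x"
  define e where "e = 1 / (m \<bullet> m)"
  define s where "s = sg x"
  define l where "l = ell A x"
  define n where "n = real DIM('a)"
  have s: "s > 0" using sg_pos[OF x] by (simp add: s_def)
  have m0: "m \<bullet> m > 0" using nrm_pos[OF A x] by (simp add: m_def)
  have e: "e > 0" "m \<bullet> m = 1 / e" using m0 by (simp_all add: e_def)
  have sR: "sg (hrefl A x) = s / e" unfolding sg_hrefl[OF A x] by (simp add: s_def m_def[symmetric] e_def)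
  have R: "hrefl A x = x - (l * e) *\<^sub>R m" by (simp add: hrefl_def l_def m_def e_def)
  have t2: "trace_op (\<lambda>h. d2refl A x g h) = 2 * e\<^sup>2 * fst A * ((n - 2) * (m \<bullet> g))"
  proof -
    have "trace_op (\<lambda>h. d2refl A x g h) = 2 * e\<^sup>2 * fst A * (m \<bullet> g - 4 * e * (m \<bullet> g) * (m \<bullet> m) + (g \<bullet> m + (m \<bullet> g) * n))"
      unfolding d2refl_def Let_def m_def[symmetric] e_def[symmetric] n_def by (simp only: trace_op_simps)
    also have "4 * e * (m \<bullet> g) * (m \<bullet> m) = 4 * (m \<bullet> g)" using e by simp
    finally show ?thesis by (simp add: inner_commute algebra_simps)
  qed
  have xm: "2 * (x \<bullet> m) = l + fst A * (1 - x \<bullet> x)"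
    by (simp add: m_def nrm_def l_def ell_def inner_diff algebra_simps)
  have sx: "s * (1 - x \<bullet> x) = 1" using sg_mult[OF x] by (simp add: s_def)
  have "x \<bullet> drefl A x g = e * (x \<bullet> g - (e * (m \<bullet> g)) * (2 * (x \<bullet> m)))"
    unfolding drefl_def m_def[symmetric] e_def[symmetric] by (simp add: inner_diff_right algebra_simps)
  also have "\<dots> = e * (x \<bullet> g - (e * (m \<bullet> g)) * (l + fst A * (1 - x \<bullet> x)))" unfolding xm ..
  finally have 1: "x \<bullet> drefl A x g = e * (x \<bullet> g - (e * (m \<bullet> g)) * (l + fst A * (1 - x \<bullet> x)))" .
  have sx2: "1 - x \<bullet> x = 1 / s" using sx s by (simp add: field_simps)
  have "lapl x (drefl A x g) (\<lambda>h. drefl A x (T (drefl A x h)) + d2refl A x g h)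
    = (trace_op T * e\<^sup>2 + 2 * e\<^sup>2 * fst A * ((n - 2) * (m \<bullet> g))) / (4 * s\<^sup>2)
     + (n - 2) * (e * (x \<bullet> g - (e * (m \<bullet> g)) * (l + fst A * (1 / s)))) / (2 * s)"
    unfolding lapl_def trace_op_simps t2 trace_op_drefl[OF T A x] 1 sx2 s_def[symmetric] n_def[symmetric] m_def[symmetric]
    using e by (simp add: power_divide)
  also have "\<dots> = trace_op T / (4 * (s / e)\<^sup>2) + (n - 2) * ((x - (l * e) *\<^sub>R m) \<bullet> g) / (2 * (s / e))"
    using s e(1) by (simp add: inner_diff_left field_simps power2_eq_square)
  also have "\<dots> = lapl (hrefl A x) g T"
    unfolding lapl_def sR n_def unfolding R ..
  finally show ?thesis .
qed

section \<open>Barriers, the Hopf lemma and the strong maximum principle\<close>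

text \<open>
  The hyperbolic cosine of the distance (\<open>hdist_cosh_dist\<close>). Unlike the distance it is smooth at \<open>c\<close> and
  of the form \<open>lin B\<close>; its sublevel sets are the geodesic balls about \<open>c\<close>.
\<close>
definition cosh_dist :: "'a::euclidean_space \<Rightarrow> 'a \<Rightarrow> real" where
  "cosh_dist c x = - lor (hyp c) (hyp x)"

lemma cosh_dist_lin: "cosh_dist c x = lin (- hyp c) x"
  by (simp add: cosh_dist_def lin_def lor_simps)

lemma cosh_dist_eq: "c \<in> hspace \<Longrightarrow> x \<in> hspace \<Longrightarrow> cosh_dist c x = 1 + 2 * ((x - c) \<bullet> (x - c)) * sg x * sg c"
  by (simp add: cosh_dist_def lor_hyp_hyp inner_diff inner_commute algebra_simps)

lemma cosh_dist_ge1: "c \<in> hspace \<Longrightarrow> x \<in> hspace \<Longrightarrow> cosh_dist c x \<ge> 1"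
  using lor_hyp_le by (auto simp: cosh_dist_def)

lemma continuous_on_cosh_dist: "continuous_on hspace (cosh_dist c)"
  using continuous_on_lin[of "- hyp c"] by (simp add: cosh_dist_lin[abs_def])

lemma compact_cosh_dist:
  fixes c :: "'a::euclidean_space"
  assumes c: "c \<in> hspace"
  shows "compact {x \<in> hspace. cosh_dist c x \<le> k}"
proof -
  have "{x \<in> hspace. cosh_dist c x \<le> k} = cball 0 1 \<inter> {x. 2 * ((x - c) \<bullet> (x - c)) * sg c \<le> (k - 1) * (1 - x \<bullet> x)}"
  proof (intro equalityI subsetI)
    fix x assume "x \<in> {x \<in> hspace. cosh_dist c x \<le> k}"
    then have x: "x \<in> hspace" "cosh_dist c x \<le> k" by auto
    have "2 * ((x - c) \<bullet> (x - c)) * sg c = 2 * ((x - c) \<bullet> (x - c)) * sg c * (sg x * (1 - x \<bullet> x))"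
      using sg_mult[OF x(1)] by simp
    also have "\<dots> = (2 * ((x - c) \<bullet> (x - c)) * sg x * sg c) * (1 - x \<bullet> x)" by (simp add: mult_ac)
    also have "\<dots> \<le> (k - 1) * (1 - x \<bullet> x)"
      using x(2) cosh_dist_eq[OF c x(1)] hspace_pos[OF x(1)] by (intro mult_right_mono) auto
    finally show "x \<in> cball 0 1 \<inter> {x. 2 * ((x - c) \<bullet> (x - c)) * sg c \<le> (k - 1) * (1 - x \<bullet> x)}"
      using x(1) by (simp add: hspace_def)
  next
    fix x assume "x \<in> cball 0 1 \<inter> {x. 2 * ((x - c) \<bullet> (x - c)) * sg c \<le> (k - 1) * (1 - x \<bullet> x)}"
    then have x: "norm x \<le> 1" and le: "2 * ((x - c) \<bullet> (x - c)) * sg c \<le> (k - 1) * (1 - x \<bullet> x)" by auto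
    have xh: "x \<in> hspace"
    proof (rule ccontr)
      assume "x \<notin> hspace"
      then have nx: "norm x = 1" using x by (simp add: hspace_def)
      then have "x \<bullet> x = 1" by (simp add: norm_eq_1)
      then have "2 * ((x - c) \<bullet> (x - c)) * sg c \<le> 0" using le by simp
      then have "(x - c) \<bullet> (x - c) \<le> 0" using sg_pos[OF c] by (simp add: mult_le_0_iff)
      then have "x = c" using inner_ge_zero[of "x - c"] by (metis antisym inner_eq_zero_iff right_minus_eq)
      then show False using c nx by (simp add: hspace_def)
    qed
    have "(2 * ((x - c) \<bullet> (x - c)) * sg c) * sg x \<le> ((k - 1) * (1 - x \<bullet> x)) * sg x"
      using le sg_pos[OF xh] by (intro mult_right_mono) auto
    also have "\<dots> = k - 1" using sg_mult[OF xh] by (metis mult.assoc mult.commute mult.right_neutral)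
    finally show "x \<in> {x \<in> hspace. cosh_dist c x \<le> k}" using xh cosh_dist_eq[OF c xh] by (simp add: mult_ac)
  qed
  also have "compact \<dots>"
    by (intro compact_Int_closed compact_cball closed_Collect_le continuous_intros)
  finally show ?thesis .
qed

lemma open_cosh_dist: "open {x \<in> hspace. cosh_dist c x < k}" "open {x \<in> hspace. k < cosh_dist c x}"
proof -
  have "open (hspace \<inter> cosh_dist c -` {..<k})" "open (hspace \<inter> cosh_dist c -` {k<..})"
    by (intro continuous_open_preimage continuous_on_cosh_dist open_hspace; simp)+
  then show "open {x \<in> hspace. cosh_dist c x < k}" "open {x \<in> hspace. k < cosh_dist c x}"
    by (simp_all add: vimage_def Int_def)
qed

lemma open_lin: "open {x \<in> hspace. lin A x < 0}" "open {x \<in> hspace. lin A x > 0}"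
proof -
  have "open (hspace \<inter> lin A -` {..<0})" "open (hspace \<inter> lin A -` {0<..})"
    by (intro continuous_open_preimage continuous_on_lin open_hspace; simp)+
  then show "open {x \<in> hspace. lin A x < 0}" "open {x \<in> hspace. lin A x > 0}"
    by (simp_all add: vimage_def Int_def)
qed

text \<open>
  Where \<open>w < m z\<close>, the hypotheses give \<open>\<Delta>(w - m z) \<le> L (w - m z) \<le> 0\<close>, so the maximum principle
  applies. Near the boundary of \<open>S\<close> either the claim is already known or \<open>z\<close> is small, and then \<open>w \<ge> 0\<close> suffices.
\<close>
lemma barrier_compare:
  fixes w z :: "'a::euclidean_space \<Rightarrow> real"
  assumes Jw: "jets S w G H" and Jz: "jets S z Gz Hz" and S: "S \<subseteq> hspace" and n: "2 \<le> DIM('a)"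
    and L: "L \<ge> 0" and m: "m > 0"
    and lw: "\<And>x. x \<in> S \<Longrightarrow> lapl x (G x) (H x) \<le> L * w x"
    and lz: "\<And>x. x \<in> S \<Longrightarrow> lapl x (Gz x) (Hz x) \<ge> L * z x"
    and w0: "\<And>x. x \<in> S \<Longrightarrow> w x \<ge> 0"
    and bd: "\<And>\<delta>. \<delta> > 0 \<Longrightarrow> \<exists>K. compact K \<and> K \<subseteq> S \<and> (\<forall>x\<in>S - K. w x \<ge> m * z x \<or> z x < \<delta>)"
    and x: "x \<in> S"
  shows "w x \<ge> m * z x"
proof -
  note J = jets_diff[OF Jw jets_scale[OF Jz, of m]]
  have "w x - m * z x \<ge> 0"
  proof (rule max_principle[OF J S n _ _ x])
    fix y assume y: "y \<in> S" and neg: "w y - m * z y < 0"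
    have "lapl y (G y) (H y) - m * lapl y (Gz y) (Hz y) \<le> L * w y - m * (L * z y)"
      using lw[OF y] lz[OF y] m by (intro diff_mono mult_left_mono) auto
    also have "\<dots> = L * (w y - m * z y)" by (simp add: algebra_simps)
    also have "\<dots> \<le> 0" using L neg by (simp add: mult_nonneg_nonpos)
    finally show "lapl y (G y - m *\<^sub>R Gz y) (\<lambda>h. H y h - m *\<^sub>R Hz y h) \<le> 0" by (simp only: lapl_simps)
  next
    fix \<delta> :: real assume d: "\<delta> > 0"
    then obtain K where K: "compact K" "K \<subseteq> S" "\<forall>x\<in>S - K. w x \<ge> m * z x \<or> z x < \<delta> / m"
      using bd[of "\<delta> / m"] m by auto
    have "w y - m * z y > - \<delta>" if y: "y \<in> S - K" for y
    proof -
      consider "w y \<ge> m * z y" | "z y < \<delta> / m" using K(3) y by auto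
      then show ?thesis
      proof cases
        case 2
        then have "m * z y < \<delta>" using m by (simp add: field_simps)
        then show ?thesis using w0[of y] y by simp
      qed (use d in simp)
    qed
    then show "\<exists>K. compact K \<and> K \<subseteq> S \<and> (\<forall>x\<in>S - K. w x - m * z x > - \<delta>)" using K by blast
  qed
  then show ?thesis by simp
qed

text \<open>
  The steepness \<open>a\<close> of the exponential barriers: the quadratic term in \<open>a\<close> wins as long as \<open>k\<close>, the
  hyperbolic cosine of the distance to the centre, stays away from \<open>1\<close>.
\<close>
lemma barrier_constant:
  assumes "1 < k1" "0 \<le> L" "0 \<le> (d::real)"
  shows "\<exists>a\<ge>1. \<forall>k. k1 \<le> k \<longrightarrow> k \<le> k0 \<longrightarrow> L \<le> a\<^sup>2 * (k\<^sup>2 - 1) - a * d * k"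
proof -
  define D where "D = k1\<^sup>2 - 1"
  have D: "D > 0" using assms(1) by (simp add: D_def power2_eq_square less_1_mult)
  define a where "a = (d * \<bar>k0\<bar> + L) / D + 1"
  have a: "a \<ge> 1" "a * D \<ge> d * \<bar>k0\<bar> + L" using D assms by (simp_all add: a_def field_simps)
  have "L \<le> a\<^sup>2 * (k\<^sup>2 - 1) - a * d * k" if "k1 \<le> k" "k \<le> k0" for k
  proof -
    have "k1\<^sup>2 \<le> k\<^sup>2" using that assms by (intro power_mono) auto
    then have "a * D \<le> a * (k\<^sup>2 - 1)" using a by (simp add: D_def)
    moreover have "d * k \<le> d * \<bar>k0\<bar>" using that assms by (intro mult_left_mono) auto
    ultimately have "L \<le> a * (k\<^sup>2 - 1) - d * k" using a by linarith
    also have "\<dots> \<le> a * (a * (k\<^sup>2 - 1) - d * k)"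
      using mult_right_mono[OF a(1), of "a * (k\<^sup>2 - 1) - d * k"] calculation assms by simp
    finally show ?thesis by (simp add: algebra_simps power2_eq_square)
  qed
  then show ?thesis using a by blast
qed

lemma jets_exp_cosh_dist:
  fixes c :: "'a::euclidean_space"
  assumes c: "c \<in> hspace"
  shows "\<exists>H. jets hspace (\<lambda>x. exp (- a * cosh_dist c x) - exp (- a * k0)) (\<lambda>x. (- a * exp (- a * cosh_dist c x)) *\<^sub>R glin (- hyp c) x) H \<and>
    (\<forall>x\<in>hspace. lapl x ((- a * exp (- a * cosh_dist c x)) *\<^sub>R glin (- hyp c) x) (H x)
       = exp (- a * cosh_dist c x) * (a\<^sup>2 * ((cosh_dist c x)\<^sup>2 - 1) - a * real DIM('a) * cosh_dist c x))"
proof -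
  obtain H where H: "jets hspace (lin (- hyp c)) (glin (- hyp c)) H"
     "\<forall>x\<in>hspace. lapl x (glin (- hyp c) x) (H x) = real DIM('a) * lin (- hyp c) x"
    using jets_lin by blast
  have J: "jets hspace (\<lambda>x. exp (- a * cosh_dist c x) - exp (- a * k0)) (\<lambda>x. (- a * exp (- a * cosh_dist c x)) *\<^sub>R glin (- hyp c) x)
     (\<lambda>x h. (- a * exp (- a * cosh_dist c x)) *\<^sub>R H x h + (a\<^sup>2 * exp (- a * cosh_dist c x) * (glin (- hyp c) x \<bullet> h)) *\<^sub>R glin (- hyp c) x)"
    unfolding cosh_dist_lin
    by (rule jets_compose[OF H(1)]) (auto intro!: derivative_eq_intros simp: power2_eq_square)
  show ?thesis
  proof (intro exI conjI ballI, rule J)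
    fix x :: 'a assume x: "x \<in> hspace"
    have g: "(glin (- hyp c) x \<bullet> glin (- hyp c) x) / (4 * (sg x)\<^sup>2) = (cosh_dist c x)\<^sup>2 - 1"
      unfolding glin_glin[OF x] by (simp add: lor_simps lor_hyp_self[OF c] cosh_dist_lin power2_eq_square)
    show "lapl x ((- a * exp (- a * cosh_dist c x)) *\<^sub>R glin (- hyp c) x)
      (\<lambda>h. (- a * exp (- a * cosh_dist c x)) *\<^sub>R H x h + (a\<^sup>2 * exp (- a * cosh_dist c x) * (glin (- hyp c) x \<bullet> h)) *\<^sub>R glin (- hyp c) x)
       = exp (- a * cosh_dist c x) * (a\<^sup>2 * ((cosh_dist c x)\<^sup>2 - 1) - a * real DIM('a) * cosh_dist c x)"
      unfolding lapl_compose g using H(2) x by (simp add: cosh_dist_lin algebra_simps)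
  qed
qed

text \<open>
  The barrier is a subsolution only away from the centre, so the comparison takes place in a shell
  of the ball. On its inner part \<open>w\<close> is bounded below by compactness; at the outer sphere the barrier
  vanishes.
\<close>
lemma hopf_barrier:
  fixes w :: "'a::euclidean_space \<Rightarrow> real"
  assumes J: "jets S w G H" and S: "S \<subseteq> hspace" and n: "2 \<le> DIM('a)" and c: "c \<in> hspace"
    and k: "1 < k1" "k1 < k0" and L: "L \<ge> 0"
    and sub: "{x \<in> hspace. cosh_dist c x < k0} \<subseteq> S"
    and pos: "\<And>x. x \<in> hspace \<Longrightarrow> cosh_dist c x < k0 \<Longrightarrow> w x > 0"
    and lw: "\<And>x. x \<in> hspace \<Longrightarrow> cosh_dist c x < k0 \<Longrightarrow> lapl x (G x) (H x) \<le> L * w x"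
  shows "\<exists>m>0. \<exists>a>0. \<forall>x\<in>hspace. k1 < cosh_dist c x \<longrightarrow> cosh_dist c x < k0 \<longrightarrow> w x \<ge> m * (exp (- a * cosh_dist c x) - exp (- a * k0))"
proof -
  obtain a where a: "a \<ge> 1" "\<And>k. k1 \<le> k \<Longrightarrow> k \<le> k0 \<Longrightarrow> L \<le> a\<^sup>2 * (k\<^sup>2 - 1) - a * real DIM('a) * k"
    using barrier_constant[OF k(1) L, of "real DIM('a)" k0] by auto
  define z where "z x = exp (- a * cosh_dist c x) - exp (- a * k0)" for x
  obtain Hz where Hz: "jets hspace z (\<lambda>x. (- a * exp (- a * cosh_dist c x)) *\<^sub>R glin (- hyp c) x) Hz"
     "\<forall>x\<in>hspace. lapl x ((- a * exp (- a * cosh_dist c x)) *\<^sub>R glin (- hyp c) x) (Hz x)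
       = exp (- a * cosh_dist c x) * (a\<^sup>2 * ((cosh_dist c x)\<^sup>2 - 1) - a * real DIM('a) * cosh_dist c x)"
    using jets_exp_cosh_dist[OF c, of a k0] unfolding z_def[abs_def] by blast
  define k2 where "k2 = (k1 + k0) / 2"
  have k2: "k1 < k2" "k2 < k0" using k by (auto simp: k2_def)
  define Q where "Q = {x \<in> hspace. k1 < cosh_dist c x} \<inter> {x \<in> hspace. cosh_dist c x < k0}"
  have oQ: "open Q" unfolding Q_def by (intro open_Int open_cosh_dist)
  have Qs: "Q \<subseteq> S" "Q \<subseteq> hspace" using sub by (auto simp: Q_def)
  have cK: "compact {x \<in> hspace. cosh_dist c x \<le> k2}" by (rule compact_cosh_dist[OF c])
  have "\<exists>m>0. \<forall>x\<in>{x \<in> hspace. cosh_dist c x \<le> k2}. w x \<ge> m"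
  proof (cases "{x \<in> hspace. cosh_dist c x \<le> k2} = {}")
    case False
    have "continuous_on {x \<in> hspace. cosh_dist c x \<le> k2} w"
      by (rule continuous_on_subset[OF jets_continuous(1)[OF J]]) (use sub k2 in force)
    from continuous_attains_inf[OF cK False this] obtain y where
      y: "y \<in> hspace" "cosh_dist c y \<le> k2" "\<forall>x\<in>{x \<in> hspace. cosh_dist c x \<le> k2}. w y \<le> w x" by blast
    then show ?thesis using pos[of y] k2 by (intro exI[of _ "w y"]) auto
  qed (auto intro: exI[of _ 1])
  then obtain m where m: "m > 0" "\<And>x. x \<in> hspace \<Longrightarrow> cosh_dist c x \<le> k2 \<Longrightarrow> w x \<ge> m" by auto
  have z1: "z x \<le> 1" if "x \<in> hspace" for x
  proof -
    have "exp (- a * cosh_dist c x) \<le> 1" using a(1) cosh_dist_ge1[OF c that] by simp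
    then show ?thesis unfolding z_def by (smt (verit) exp_ge_zero)
  qed
  have main: "w x \<ge> m * z x" if xQ: "x \<in> Q" for x
  proof (rule barrier_compare[OF jets_subset[OF J oQ Qs(1)] jets_subset[OF Hz(1) oQ Qs(2)] Qs(2) n L m(1) _ _ _ _ xQ])
    fix y assume y: "y \<in> Q"
    then have y': "y \<in> hspace" "k1 < cosh_dist c y" "cosh_dist c y < k0" by (auto simp: Q_def)
    show "lapl y (G y) (H y) \<le> L * w y" using lw y' by auto
    show "0 \<le> w y" using pos[OF y'(1,3)] by simp
    have "L * z y \<le> L * exp (- a * cosh_dist c y)" using L by (intro mult_left_mono) (auto simp: z_def)
    also have "\<dots> \<le> (a\<^sup>2 * ((cosh_dist c y)\<^sup>2 - 1) - a * real DIM('a) * cosh_dist c y) * exp (- a * cosh_dist c y)"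
      using a(2)[of "cosh_dist c y"] y' by (intro mult_right_mono) auto
    finally show "L * z y \<le> lapl y ((- a * exp (- a * cosh_dist c y)) *\<^sub>R glin (- hyp c) y) (Hz y)"
      using Hz(2) y' by (simp add: mult.commute)
  next
    fix \<delta> :: real assume d: "\<delta> > 0"
    define K where "K = {x \<in> hspace. cosh_dist c x \<le> k0} \<inter> ({x \<in> hspace. cosh_dist c x \<le> k0} \<inter> (\<lambda>x. (cosh_dist c x, z x)) -` ({k2..} \<times> {\<delta>..}))"
    have "closed ({x \<in> hspace. cosh_dist c x \<le> k0} \<inter> (\<lambda>x. (cosh_dist c x, z x)) -` ({k2..} \<times> {\<delta>..}))"
    proof (rule continuous_closed_preimage)
      show "continuous_on {x \<in> hspace. cosh_dist c x \<le> k0} (\<lambda>x. (cosh_dist c x, z x))"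
        by (intro continuous_on_Pair continuous_on_subset[OF continuous_on_cosh_dist] continuous_on_subset[OF jets_continuous(1)[OF Hz(1)]]) auto
    qed (use compact_cosh_dist[OF c] compact_imp_closed in \<open>auto intro: closed_Times\<close>)
    then have "compact K" unfolding K_def using compact_cosh_dist[OF c] by (rule compact_Int_closed[rotated])
    moreover have "K \<subseteq> Q"
    proof
      fix x assume "x \<in> K"
      then have x: "x \<in> hspace" "cosh_dist c x \<le> k0" "cosh_dist c x \<ge> k2" "z x \<ge> \<delta>" by (auto simp: K_def)
      then have "cosh_dist c x \<noteq> k0" using d by (auto simp: z_def)
      then show "x \<in> Q" using x k2 by (auto simp: Q_def)
    qed
    moreover have "w x \<ge> m * z x \<or> z x < \<delta>" if "x \<in> Q - K" for x
    proof (cases "cosh_dist c x \<le> k2")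
      case True
      have "x \<in> hspace" using that by (auto simp: Q_def)
      then have "w x \<ge> m * 1" using m(2) True by simp
      moreover have "m * z x \<le> m * 1" using z1[OF \<open>x \<in> hspace\<close>] m(1) by (intro mult_left_mono) auto
      ultimately show ?thesis by simp
    next
      case False
      then show ?thesis using that by (auto simp: Q_def K_def)
    qed
    ultimately show "\<exists>K. compact K \<and> K \<subseteq> Q \<and> (\<forall>x\<in>Q - K. w x \<ge> m * z x \<or> z x < \<delta>)" by blast
  qed
  show ?thesis
    using m(1) a(1) main by (intro exI[of _ m] conjI exI[of _ a]) (auto simp: Q_def z_def)
qed

lemma slope_neg:
  assumes "(f has_real_derivative D) (at 0)" "D < 0"
  shows "\<exists>c>0. \<forall>\<^sub>F s in at_right 0. f s \<le> f 0 - c * s"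
proof -
  have "((\<lambda>s. (f s - f 0) / s) \<longlongrightarrow> D) (at_right 0)"
    using assms(1) unfolding has_field_derivative_iff by (auto intro: tendsto_mono at_le)
  then have "\<forall>\<^sub>F s in at_right 0. (f s - f 0) / s < D / 2"
    using assms(2) by (intro order_tendstoD(2)) auto
  moreover have "\<forall>\<^sub>F s in at_right (0::real). s > 0" by (simp add: eventually_at_right_less)
  ultimately have "\<forall>\<^sub>F s in at_right 0. f s \<le> f 0 - (- D / 2) * s"
  proof eventually_elim
    case (elim s)
    then have "f s - f 0 < D / 2 * s" by (simp only: pos_divide_less_eq)
    then show ?case by simp
  qed
  then show ?thesis using assms(2) by (intro exI[of _ "- D / 2"]) auto
qed

lemma exp_diff_ge:
  fixes a :: real assumes "a > 0" "k \<le> k0"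
  shows "exp (- a * k) - exp (- a * k0) \<ge> a * exp (- a * k0) * (k0 - k)"
proof -
  have "exp (- a * k) = exp (- a * k0) * exp (a * (k0 - k))" by (simp add: exp_add[symmetric] algebra_simps)
  moreover have "1 + a * (k0 - k) \<le> exp (a * (k0 - k))" by (rule exp_ge_add_one_self)
  ultimately have "exp (- a * k) \<ge> exp (- a * k0) * (1 + a * (k0 - k))" by simp
  then show ?thesis by (simp add: algebra_simps)
qed

lemma cosh_dist_decay:
  assumes c: "c \<in> hspace" and p: "p \<in> hspace" and k0: "cosh_dist c p = k0" and k1: "k1 < k0"
    and dir: "glin (- hyp c) p \<bullet> h < 0"
  shows "\<exists>b>0. \<forall>\<^sub>F s in at_right 0. p + s *\<^sub>R h \<in> hspace \<and> k1 < cosh_dist c (p + s *\<^sub>R h) \<and> cosh_dist c (p + s *\<^sub>R h) \<le> k0 - b * s"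
proof -
  obtain H where H: "jets hspace (lin (- hyp c)) (glin (- hyp c)) H" using jets_lin by blast
  have d1: "((\<lambda>s. cosh_dist c (p + s *\<^sub>R h)) has_real_derivative glin (- hyp c) (p + 0 *\<^sub>R h) \<bullet> h) (at 0)"
    unfolding cosh_dist_lin by (rule jets_line[OF H]) (use p in simp)
  have d2: "glin (- hyp c) (p + 0 *\<^sub>R h) \<bullet> h < 0" using dir by simp
  obtain b where b: "b > 0" "\<forall>\<^sub>F s in at_right 0. cosh_dist c (p + s *\<^sub>R h) \<le> cosh_dist c (p + 0 *\<^sub>R h) - b * s"
    using slope_neg[OF d1 d2] by blast
  have t: "((\<lambda>s. p + s *\<^sub>R h) \<longlongrightarrow> p) (at_right 0)" by (auto intro!: tendsto_eq_intros)
  have "open {x \<in> hspace. k1 < cosh_dist c x}" by (rule open_cosh_dist)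
  then have "\<forall>\<^sub>F s in at_right 0. p + s *\<^sub>R h \<in> {x \<in> hspace. k1 < cosh_dist c x}"
    using t p k1 k0 by (intro topological_tendstoD) auto
  with b(2) have "\<forall>\<^sub>F s in at_right 0. p + s *\<^sub>R h \<in> hspace \<and> k1 < cosh_dist c (p + s *\<^sub>R h) \<and> cosh_dist c (p + s *\<^sub>R h) \<le> k0 - b * s"
    by eventually_elim (auto simp: k0)
  then show ?thesis using b(1) by blast
qed

text \<open>
  The Hopf lemma: \<open>w\<close> grows at least linearly along every ray that enters the ball transversally
  at its boundary point \<open>p\<close>.
\<close>
lemma hopf_slope:
  fixes w :: "'a::euclidean_space \<Rightarrow> real"
  assumes J: "jets S w G H" and S: "S \<subseteq> hspace" and n: "2 \<le> DIM('a)" and c: "c \<in> hspace"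
    and L: "L \<ge> 0"
    and sub: "{x \<in> hspace. cosh_dist c x < k0} \<subseteq> S"
    and pos: "\<And>x. x \<in> hspace \<Longrightarrow> cosh_dist c x < k0 \<Longrightarrow> w x > 0"
    and lw: "\<And>x. x \<in> hspace \<Longrightarrow> cosh_dist c x < k0 \<Longrightarrow> lapl x (G x) (H x) \<le> L * w x"
    and p: "p \<in> hspace" "cosh_dist c p = k0" "1 < k0" and dir: "glin (- hyp c) p \<bullet> h < 0"
  shows "\<exists>b>0. \<forall>\<^sub>F s in at_right 0. p + s *\<^sub>R h \<in> hspace \<and> cosh_dist c (p + s *\<^sub>R h) < k0 \<and> w (p + s *\<^sub>R h) \<ge> b * s"
proof -
  define k1 where "k1 = (1 + k0) / 2"
  have k1: "1 < k1" "k1 < k0" using p by (auto simp: k1_def)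
  obtain m a where ma: "m > 0" "a > 0"
    "\<forall>x\<in>hspace. k1 < cosh_dist c x \<longrightarrow> cosh_dist c x < k0 \<longrightarrow> w x \<ge> m * (exp (- a * cosh_dist c x) - exp (- a * k0))"
    using hopf_barrier[OF J S n c k1 L sub pos lw] by blast
  obtain b where b: "b > 0" "\<forall>\<^sub>F s in at_right 0. p + s *\<^sub>R h \<in> hspace \<and> k1 < cosh_dist c (p + s *\<^sub>R h) \<and> cosh_dist c (p + s *\<^sub>R h) \<le> k0 - b * s"
    using cosh_dist_decay[OF c p(1,2) k1(2) dir] by blast
  define r where "r = m * (a * exp (- a * k0) * b)"
  have r: "r > 0" using ma b by (simp add: r_def)
  moreover have "\<forall>\<^sub>F s in at_right 0. p + s *\<^sub>R h \<in> hspace \<and> cosh_dist c (p + s *\<^sub>R h) < k0 \<and> w (p + s *\<^sub>R h) \<ge> r * s"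
    using b(2) eventually_at_right_less[of "0::real"]
  proof eventually_elim
    case (elim s)
    let ?k = "cosh_dist c (p + s *\<^sub>R h)"
    have bs: "b * s > 0" using b(1) elim by simp
    then have lt: "?k < k0" using elim by linarith
    have "r * s = m * (a * exp (- a * k0) * (b * s))" by (simp add: r_def)
    also have "\<dots> \<le> m * (a * exp (- a * k0) * (k0 - ?k))" using ma elim by (intro mult_left_mono) auto
    also have "\<dots> \<le> m * (exp (- a * ?k) - exp (- a * k0))"
      using exp_diff_ge[OF ma(2), of ?k k0] lt ma(1) by (intro mult_left_mono) auto
    also have "\<dots> \<le> w (p + s *\<^sub>R h)" using ma(3) elim lt by auto
    finally show ?case using lt elim by auto
  qed
  ultimately show ?thesis by blast
qed

lemma deriv_ge:
  assumes "(f has_real_derivative D) (at 0)" "f 0 = 0" "\<forall>\<^sub>F s in at_right 0. f s \<ge> b * s"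
  shows "D \<ge> b"
proof -
  have t: "((\<lambda>s. (f s - f 0) / s) \<longlongrightarrow> D) (at_right 0)"
    using assms(1) unfolding has_field_derivative_iff by (auto intro: tendsto_mono at_le)
  have "\<forall>\<^sub>F s in at_right 0. b \<le> (f s - f 0) / s"
    using assms(3) eventually_at_right_less[of "0::real"]
    by eventually_elim (simp add: assms(2) pos_le_divide_eq)
  then show ?thesis using tendsto_lowerbound[OF t] by simp
qed

text \<open>
  If a zero \<open>z\<close> of \<open>w\<close> had a point \<open>c\<close> with \<open>w c > 0\<close> close to it, a ball about \<open>c\<close> could be enlarged
  until its boundary first meets a zero \<open>y\<close>. There the gradient of \<open>w\<close> vanishes, because \<open>y\<close> is a
  minimum, which contradicts the Hopf lemma.
\<close>
lemma strong_max_principle: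
  fixes w :: "'a::euclidean_space \<Rightarrow> real"
  assumes J: "jets S w G H" and S: "S \<subseteq> hspace" and n: "2 \<le> DIM('a)" and L: "L \<ge> 0"
    and w0: "\<And>x. x \<in> S \<Longrightarrow> w x \<ge> 0"
    and lw: "\<And>x. x \<in> S \<Longrightarrow> lapl x (G x) (H x) \<le> L * w x"
  shows "open {x \<in> S. w x = 0}"
proof (rule openI)
  fix z assume "z \<in> {x \<in> S. w x = 0}"
  then have z: "z \<in> S" "w z = 0" "z \<in> hspace" using S by auto
  obtain r where r: "r > 0" "ball z r \<subseteq> S" using jets_open[OF J] z openE by blast
  \<comment> \<open>This radius is small enough for the geodesic ball about \<open>c\<close> through \<open>z\<close> to stay in \<open>ball z r\<close>.\<close>
  define d where "d = r / (2 * sg z)"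
  have sz: "sg z \<ge> 1" using sg_ge1[OF z(3)] .
  have d: "d > 0" using r sz by (simp add: d_def)
  have d2: "d \<le> r / 2" using r sz by (simp add: d_def field_simps)
  have "w c = 0" if cb: "c \<in> ball z d" for c
  proof (rule ccontr)
    assume "w c \<noteq> 0"
    have cS: "c \<in> S" using cb r d2 by (auto simp: subset_eq)
    then have ch: "c \<in> hspace" and wc: "w c > 0" using S w0[of c] \<open>w c \<noteq> 0\<close> by auto
    define K where "K = {x \<in> hspace. cosh_dist c x \<le> cosh_dist c z}"
    have KS: "K \<subseteq> S"
    proof
      fix x assume "x \<in> K"
      then have x: "x \<in> hspace" "cosh_dist c x \<le> cosh_dist c z" by (auto simp: K_def)
      have "((x - c) \<bullet> (x - c)) * sg x \<le> ((z - c) \<bullet> (z - c)) * sg z"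
        using x(2) sg_pos[OF ch] by (simp add: cosh_dist_eq[OF ch] x(1) z(3))
      moreover have "((x - c) \<bullet> (x - c)) * 1 \<le> ((x - c) \<bullet> (x - c)) * sg x"
        using sg_ge1[OF x(1)] by (intro mult_left_mono) auto
      moreover have "((z - c) \<bullet> (z - c)) * sg z \<le> ((z - c) \<bullet> (z - c)) * (sg z * sg z)"
        using sz by (intro mult_left_mono) auto
      ultimately have "(norm (x - c))\<^sup>2 \<le> (norm (z - c) * sg z)\<^sup>2"
        by (simp add: power2_norm_eq_inner power_mult_distrib power2_eq_square[of "sg z"])
      then have "norm (x - c) \<le> norm (z - c) * sg z"
        by (rule power2_le_imp_le) (use sz in auto)
      also have "\<dots> < d * sg z" using cb sz by (intro mult_strict_right_mono) (auto simp: dist_norm)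
      also have "\<dots> = r / 2" using sz by (simp add: d_def)
      finally have "dist x c < r / 2" by (simp add: dist_norm)
      then have "dist z x < r" using cb d2 dist_triangle[of z x c] by (simp add: dist_commute)
      then show "x \<in> S" using r by auto
    qed
    have cK: "compact K" unfolding K_def by (rule compact_cosh_dist[OF ch])
    define Z where "Z = K \<inter> (K \<inter> w -` {0})"
    have "closed (K \<inter> w -` {0})"
      by (rule continuous_closed_preimage[OF continuous_on_subset[OF jets_continuous(1)[OF J] KS]])
         (use cK compact_imp_closed in auto)
    then have cZ: "compact Z" unfolding Z_def using cK by blast
    have zZ: "z \<in> Z" using z by (auto simp: Z_def K_def)
    have "continuous_on Z (cosh_dist c)"
      by (rule continuous_on_subset[OF continuous_on_cosh_dist]) (auto simp: Z_def K_def)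
    then obtain y where y: "y \<in> Z" "\<And>x. x \<in> Z \<Longrightarrow> cosh_dist c y \<le> cosh_dist c x"
      using continuous_attains_inf[OF cZ] zZ by blast
    have yS: "y \<in> S" "y \<in> hspace" "w y = 0" "cosh_dist c y \<le> cosh_dist c z" using y(1) KS by (auto simp: Z_def K_def)
    have "y \<noteq> c" using yS wc by auto
    then have k1: "cosh_dist c y > 1" using lor_hyp_lt[OF ch yS(2)] by (auto simp: cosh_dist_def)
    have sub: "{x \<in> hspace. cosh_dist c x < cosh_dist c y} \<subseteq> S" using KS yS(4) by (auto simp: K_def)
    have pos: "w x > 0" if "x \<in> hspace" "cosh_dist c x < cosh_dist c y" for x
    proof -
      have "x \<in> S" using sub that by auto
      moreover have "w x \<noteq> 0" using y(2)[of x] that yS(4) by (auto simp: Z_def K_def)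
      ultimately show ?thesis using w0[of x] by auto
    qed
    define h where "h = - glin (- hyp c) y"
    have "(glin (- hyp c) y \<bullet> glin (- hyp c) y) / (4 * (sg y)\<^sup>2) = (cosh_dist c y)\<^sup>2 - 1"
      unfolding glin_glin[OF yS(2)] by (simp add: lor_simps lor_hyp_self[OF ch] cosh_dist_lin power2_eq_square)
    moreover have "(cosh_dist c y)\<^sup>2 - 1 > 0" using k1 by (simp add: power2_eq_square less_1_mult)
    ultimately have "glin (- hyp c) y \<noteq> 0" by auto
    then have dir: "glin (- hyp c) y \<bullet> h < 0" by (simp add: h_def)
    obtain b where b: "b > 0" "\<forall>\<^sub>F s in at_right 0. y + s *\<^sub>R h \<in> hspace \<and> cosh_dist c (y + s *\<^sub>R h) < cosh_dist c y \<and> w (y + s *\<^sub>R h) \<ge> b * s"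
      using hopf_slope[OF J S n ch L sub pos _ yS(2) refl k1 dir] lw sub by blast
    have D: "((\<lambda>s. w (y + s *\<^sub>R h)) has_real_derivative G (y + 0 *\<^sub>R h) \<bullet> h) (at 0)"
      by (rule jets_line[OF J]) (use yS in simp)
    have "G (y + 0 *\<^sub>R h) \<bullet> h \<ge> b"
      by (rule deriv_ge[OF D]) (use b yS in \<open>auto elim: eventually_mono\<close>)
    moreover have "G y = 0" by (rule jets_min(1)[OF J yS(1)]) (use w0 yS in auto)
    ultimately show False using b by simp
  qed
  moreover have "ball z d \<subseteq> S" using r d2 by (auto simp: subset_eq)
  ultimately show "\<exists>e>0. ball z e \<subseteq> {x \<in> S. w x = 0}" using d by (intro exI[of _ d]) auto
qed

text \<open>
  The geodesic ball of radius \<open>r\<close> touching at \<open>p\<close> from the side of \<open>\<nu>\<close>, with \<open>sinh r = 1 / (|M| + 1)\<close>.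
  Its centre is the point at distance \<open>r\<close> from \<open>p\<close> on the geodesic in direction \<open>\<nu>\<close>, so it lies on every
  hyperplane through \<open>p\<close> that contains \<open>\<nu>\<close>; this is used for the corner. The ball lies in the set
  \<open>(x - p) \<bullet> \<nu> > M |x - p|\<^sup>2\<close>, for \<open>M > 0\<close> a Euclidean ball of diameter \<open>1 / M\<close> touching at \<open>p\<close>.
\<close>
lemma tangent_ball:
  fixes p \<nu> :: "'a::euclidean_space"
  assumes p: "p \<in> hspace" and \<nu>: "\<nu> \<bullet> \<nu> = 1"
  obtains c b where "c \<in> hspace" "b > 0" "cosh_dist c p > 1" "glin (- hyp c) p = - (b *\<^sub>R \<nu>)"
    "\<And>x. x \<in> hspace \<Longrightarrow> cosh_dist c x < cosh_dist c p \<Longrightarrow> (x - p) \<bullet> \<nu> > M * ((x - p) \<bullet> (x - p))"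
    "\<And>A. lin A p = 0 \<Longrightarrow> nrm A p \<bullet> \<nu> = 0 \<Longrightarrow> lor A (hyp c) = 0"
proof -
  define s where "s = sg p"
  define g where "g = p \<bullet> \<nu>"
  \<comment> \<open>\<open>t\<close> and \<open>q\<close> are the hyperbolic sine and cosine of the radius.\<close>
  define t where "t = 1 / (\<bar>M\<bar> + 1)"
  define q where "q = sqrt (1 + t\<^sup>2)"
  have s: "s \<ge> 1" using sg_ge1[OF p] by (simp add: s_def)
  have sp: "s * (p \<bullet> p) = s - 1" using sg_mult[OF p] by (simp add: s_def algebra_simps)
  have t: "t > 0" by (simp add: t_def add_nonneg_pos)
  have q2: "q\<^sup>2 = 1 + t\<^sup>2" by (simp add: q_def)
  have q1: "q \<ge> 1" by (simp add: q_def)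
  have qt: "q > t" unfolding q_def by (rule real_less_rsqrt) simp
  \<comment> \<open>The unit vector tangent to the hyperboloid at \<open>hyp p\<close> that corresponds to \<open>\<nu>\<close>.\<close>
  define V where "V = (2 * s * g, \<nu> + (2 * s * g) *\<^sub>R p)"
  define C where "C = q *\<^sub>R hyp p + t *\<^sub>R V"
  have lX: "lor V (hyp x) = 2 * sg x * ((x - p) \<bullet> \<nu> - g * s * ((x - p) \<bullet> (x - p)))" if x: "x \<in> hspace" for x
  proof -
    have sx: "sg x * (x \<bullet> x) = sg x - 1" using sg_mult[OF x] by (simp add: algebra_simps)
    have "2 * sg x * ((x - p) \<bullet> \<nu> - g * s * ((x - p) \<bullet> (x - p)))
      = 2 * sg x * (x \<bullet> \<nu>) - 2 * sg x * g - 2 * g * s * (sg x * (x \<bullet> x)) + 4 * g * s * sg x * (x \<bullet> p) - 2 * g * sg x * (s * (p \<bullet> p))"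
      by (simp add: inner_diff inner_commute g_def algebra_simps)
    also have "\<dots> = lor V (hyp x)"
      unfolding sx sp by (simp add: V_def lor_def hyp_def inner_add inner_commute algebra_simps)
    finally show ?thesis by simp
  qed
  have VV: "lor V V = 1"
  proof -
    have "lor V V = \<nu> \<bullet> \<nu> + 4 * s * g * g + 4 * s * g * g * (s * (p \<bullet> p)) - 4 * s * s * g * g"
      by (simp add: V_def lor_def inner_add inner_commute g_def algebra_simps)
    then show ?thesis unfolding sp by (simp add: \<nu> algebra_simps)
  qed
  have Vp: "lor V (hyp p) = 0" using lX[OF p] by simp
  have CC: "lor C C = -1"
    using q2 VV Vp lor_hyp_self[OF p]
    by (simp add: C_def lor_simps lor_commute[of "hyp p" V] power2_eq_square)
  have fC: "0 < fst C"
  proof -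
    have "\<bar>g\<bar> \<le> norm p * norm \<nu>" unfolding g_def by (rule Cauchy_Schwarz_ineq2)
    then have g: "\<bar>g\<bar> \<le> norm p" using \<nu> by (simp add: norm_eq_1[symmetric])
    have "norm p < 1" using p by (simp add: hspace_def)
    then have "0 < (1 - norm p)\<^sup>2" by simp
    then have "2 * norm p < 1 + p \<bullet> p" by (simp add: power2_eq_square algebra_simps power2_norm_eq_inner[symmetric])
    then have "s * (2 * norm p) < s * (1 + p \<bullet> p)" using s by (intro mult_strict_left_mono) auto
    then have "2 * s * norm p < 2 * s - 1" using sp by (simp add: algebra_simps)
    moreover have "2 * s * \<bar>g\<bar> \<le> 2 * s * norm p" using g s by simp
    ultimately have 1: "2 * s * \<bar>g\<bar> < 2 * s - 1" by linarith
    have "t * (2 * s * \<bar>g\<bar>) \<le> q * (2 * s * \<bar>g\<bar>)" using qt s by (intro mult_right_mono) auto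
    also have "\<dots> < q * (2 * s - 1)" using 1 q1 by (intro mult_strict_left_mono) auto
    finally have "t * (2 * s * \<bar>g\<bar>) < q * (2 * s - 1)" .
    moreover have "(t * (2 * s)) * (- \<bar>g\<bar>) \<le> (t * (2 * s)) * g" using t s by (intro mult_left_mono) auto
    moreover have "fst C = q * (2 * s - 1) + t * (2 * s * g)" by (simp add: C_def V_def hyp_def s_def[symmetric])
    ultimately show ?thesis by (simp only: mult.assoc mult_minus_right)
  qed
  define c where "c = chart C"
  have c: "c \<in> hspace" and hc: "hyp c = C" using hyp_chart[OF CC fC] by (simp_all add: c_def)
  have kp: "cosh_dist c p = q" by (simp add: cosh_dist_def hc C_def lor_simps lor_hyp_self[OF p] Vp)
  have "q > 1" using t by (simp add: q_def)
  have gl: "glin (- hyp c) p = - ((2 * s * t) *\<^sub>R \<nu>)"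
  proof -
    have glinear: "glin (- (q *\<^sub>R A + t *\<^sub>R B)) p = - (q *\<^sub>R glin A p + t *\<^sub>R glin B p)" for A B
      by (simp add: glin_def inner_add_right algebra_simps)
    have "glin (hyp p) p = ((2 * s) * (2 * s) + 4 * s\<^sup>2 * (p \<bullet> ((2 * s) *\<^sub>R p) - (2 * s - 1))) *\<^sub>R p"
      unfolding glin_def hyp_def s_def[symmetric] fst_conv snd_conv scaleR_scaleR scaleR_add_left ..
    also have "(2 * s) * (2 * s) + 4 * s\<^sup>2 * (p \<bullet> ((2 * s) *\<^sub>R p) - (2 * s - 1)) = 4 * s\<^sup>2 * (2 + 2 * (s * (p \<bullet> p)) - 2 * s)"
      by (simp add: algebra_simps power2_eq_square)
    also have "\<dots> = 0" unfolding sp by simp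
    finally have 1: "glin (hyp p) p = 0" by simp
    have "glin V p = (2 * s) *\<^sub>R \<nu> + ((2 * s) * (2 * s * g) + 4 * s\<^sup>2 * (p \<bullet> (\<nu> + (2 * s * g) *\<^sub>R p) - 2 * s * g)) *\<^sub>R p"
      unfolding glin_def V_def s_def[symmetric] fst_conv snd_conv scaleR_add_right scaleR_scaleR scaleR_add_left add.assoc ..
    also have "(2 * s) * (2 * s * g) + 4 * s\<^sup>2 * (p \<bullet> (\<nu> + (2 * s * g) *\<^sub>R p) - 2 * s * g) = 4 * s\<^sup>2 * g * (2 + 2 * (s * (p \<bullet> p)) - 2 * s)"
      by (simp add: algebra_simps power2_eq_square g_def[symmetric])
    also have "\<dots> = 0" unfolding sp by simp
    finally have 2: "glin V p = (2 * s) *\<^sub>R \<nu>" by simp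
    show ?thesis unfolding hc C_def glinear 1 2 by (simp add: mult_ac)
  qed
  have in_ball: "(x - p) \<bullet> \<nu> > M * ((x - p) \<bullet> (x - p))" if x: "x \<in> hspace" "cosh_dist c x < cosh_dist c p" for x
  proof -
    define D where "D = (x - p) \<bullet> (x - p)"
    have D: "D \<ge> 0" by (simp add: D_def)
    have sx: "sg x > 0" using sg_pos[OF x(1)] .
    have "cosh_dist c x = q * (1 + 2 * D * sg x * s) - t * (2 * sg x * ((x - p) \<bullet> \<nu> - g * s * D))"
      unfolding cosh_dist_def hc C_def lor_simps lX[OF x(1)] lor_commute[of "hyp p"] lor_hyp_hyp[OF x(1) p] D_def s_def
      by (simp add: algebra_simps)
    then have "2 * sg x * (q * D * s) < 2 * sg x * (t * ((x - p) \<bullet> \<nu> - g * s * D))"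
      using x(2) unfolding kp by (simp add: algebra_simps)
    then have "q * D * s < t * ((x - p) \<bullet> \<nu> - g * s * D)" using sx by simp
    then have 1: "q * D * s / t + g * s * D < (x - p) \<bullet> \<nu>" using t by (simp add: field_simps)
    have "\<bar>g\<bar> \<le> norm p * norm \<nu>" unfolding g_def by (rule Cauchy_Schwarz_ineq2)
    then have "\<bar>g\<bar> \<le> 1" using \<nu> p by (simp add: norm_eq_1[symmetric] hspace_def)
    moreover have "1 / t \<le> q / t" using q1 t by (simp add: divide_right_mono)
    ultimately have "q / t + g \<ge> 1 / t - 1" by linarith
    moreover have "1 / t - 1 = \<bar>M\<bar>" by (simp add: t_def)
    ultimately have qtg: "\<bar>M\<bar> \<le> q / t + g" by simp
    then have "0 \<le> q / t + g" by linarith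
    then have "(q / t + g) * 1 \<le> (q / t + g) * s" using s by (intro mult_left_mono) auto
    moreover have "M \<le> (q / t + g) * 1" using abs_le_D1[OF qtg] by simp
    ultimately have "M \<le> (q / t + g) * s" by (rule order_trans[rotated])
    then have "M * D \<le> (q / t + g) * s * D" using D by (intro mult_right_mono) auto
    also have "\<dots> = q * D * s / t + g * s * D" by (simp add: algebra_simps add_divide_distrib)
    finally show ?thesis using 1 by (simp add: D_def)
  qed
  have orth: "lor A (hyp c) = 0" if "lin A p = 0" "nrm A p \<bullet> \<nu> = 0" for A
  proof -
    have a: "snd A \<bullet> \<nu> = fst A * g" using that(2) by (simp add: nrm_def inner_diff_left g_def)
    have "lor A V = snd A \<bullet> \<nu> + 2 * s * g * (snd A \<bullet> p - fst A)" by (simp add: V_def lor_def inner_add_right algebra_simps)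
    also have "\<dots> = g * lin A p" unfolding a by (simp add: lin_def lor_def hyp_def s_def algebra_simps)
    finally have "lor A V = 0" using that by simp
    then show ?thesis using that(1) by (simp add: hc C_def lor_simps lin_def)
  qed
  show ?thesis
    by (rule that[OF c _ _ gl in_ball orth]) (use s t kp \<open>q > 1\<close> in auto)
qed

text \<open>
  A function odd under the reflection and positive behind the hyperplane has non-zero normal
  derivative at \<open>c\<close>, by the Hopf lemma for a ball touching the hyperplane at \<open>c\<close>. By oddness,
  \<open>w x\<close> is half the increment of \<open>w\<close> along the segment from the mirror image of \<open>x\<close> to \<open>x\<close>, and the
  mean value theorem turns the derivative at \<open>c\<close> into a lower bound near \<open>c\<close>.
\<close>
lemma hopf_at_hyperplane:
  fixes w :: "'a::euclidean_space \<Rightarrow> real"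
  assumes J: "jets S w G H" and S: "S \<subseteq> hspace" and n: "2 \<le> DIM('a)" and L: "L \<ge> 0"
    and A: "lor A A = 1" and c: "c \<in> S" "lin A c = 0"
    and odd: "\<And>x. x \<in> S \<Longrightarrow> hrefl A x \<in> S \<Longrightarrow> w (hrefl A x) = - w x"
    and pos: "\<And>x. x \<in> S \<Longrightarrow> lin A x < 0 \<Longrightarrow> w x > 0"
    and lw: "\<And>x. x \<in> S \<Longrightarrow> lin A x < 0 \<Longrightarrow> lapl x (G x) (H x) \<le> L * w x"
  shows "\<exists>m>0. \<exists>B. open B \<and> c \<in> B \<and> (\<forall>x\<in>B. lin A x < 0 \<longrightarrow> w x \<ge> m * (- lin A x))"
proof -
  have ch: "c \<in> hspace" using c S by auto
  have ec: "ell A c = 0" using c ch by (simp add: lin_sign)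
  define N where "N = nrm A c"
  have N: "N \<bullet> N = 1" unfolding N_def nrm_ell[OF A] ec by simp
  have Rc: "hrefl A c = c" by (rule hrefl_fix[OF c(2) ch])
  obtain r where r: "r > 0" "ball c r \<subseteq> S" using jets_open[OF J] c openE by blast
  \<comment> \<open>The tangent ball has to lie in \<open>ball c r\<close> and to be smaller than the sphere of radius \<open>1 / |fst A|\<close> that contains the hyperplane.\<close>
  define M where "M = max \<bar>fst A\<bar> (1 / r)"
  have M: "M \<ge> 1 / r" "M \<ge> \<bar>fst A\<bar>" "M > 0" using r by (auto simp: M_def less_max_iff_disj)
  have N': "- N \<bullet> - N = 1" using N by simp
  obtain d b where d: "d \<in> hspace" "b > 0" "cosh_dist d c > 1" "glin (- hyp d) c = - (b *\<^sub>R - N)"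
    "\<And>x. x \<in> hspace \<Longrightarrow> cosh_dist d x < cosh_dist d c \<Longrightarrow> (x - c) \<bullet> - N > M * ((x - c) \<bullet> (x - c))"
    using tangent_ball[OF ch N', of M] by metis
  have inside: "x \<in> S \<and> lin A x < 0" if x: "x \<in> hspace" "cosh_dist d x < cosh_dist d c" for x
  proof -
    define y where "y = x - c"
    have xy: "x = c + y" by (simp add: y_def)
    have 1: "M * (y \<bullet> y) < - (y \<bullet> N)" using d(5)[OF x] by (simp add: y_def)
    have "- (y \<bullet> N) \<le> norm y * norm N" using Cauchy_Schwarz_ineq2[of y N] by linarith
    then have "M * (norm y * norm y) < norm y" using 1 N by (simp add: norm_eq_1[symmetric] norm_eq_sqrt_inner[of y])
    then have "M * norm y * norm y < 1 * norm y" by simp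
    then have "M * norm y < 1" by (rule mult_right_less_imp_less) simp
    then have "norm y < 1 / M" using M(3) by (simp add: field_simps)
    also have "\<dots> \<le> r" using M r by (simp add: field_simps)
    finally have "x \<in> S" using r by (auto simp: xy dist_norm)
    have "ell A x = ell A c + 2 * (y \<bullet> N) - fst A * (y \<bullet> y)"
      by (simp add: xy ell_def N_def nrm_def inner_add inner_diff inner_commute algebra_simps)
    also have "\<dots> < 0"
    proof -
      have "- (fst A * (y \<bullet> y)) \<le> \<bar>fst A\<bar> * (y \<bullet> y)" by (simp add: abs_if)
      also have "\<dots> \<le> M * (y \<bullet> y)" using M by (intro mult_right_mono) auto
      finally have "- (fst A * (y \<bullet> y)) \<le> M * (y \<bullet> y)" .
      moreover have "y \<bullet> y \<ge> 0" by simp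
      then have "M * (y \<bullet> y) \<ge> 0" using M by simp
      ultimately show ?thesis using 1 ec by linarith
    qed
    finally show ?thesis using \<open>x \<in> S\<close> x by (simp add: lin_sign)
  qed
  have "glin (- hyp d) c \<bullet> - N < 0" using d N by simp
  then obtain \<beta> where be: "\<beta> > 0" "\<forall>\<^sub>F s in at_right 0. c + s *\<^sub>R - N \<in> hspace \<and> cosh_dist d (c + s *\<^sub>R - N) < cosh_dist d c \<and> w (c + s *\<^sub>R - N) \<ge> \<beta> * s"
    using hopf_slope[OF J S n d(1) L _ _ _ ch refl d(3)] inside pos lw by blast
  have wc: "w c = 0" using odd[of c] c Rc by simp
  have D: "((\<lambda>s. w (c + s *\<^sub>R - N)) has_real_derivative G (c + 0 *\<^sub>R - N) \<bullet> - N) (at 0)"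
    by (rule jets_line[OF J]) (use c in simp)
  have "G (c + 0 *\<^sub>R - N) \<bullet> - N \<ge> \<beta>"
    by (rule deriv_ge[OF D]) (use be wc in \<open>auto elim: eventually_mono\<close>)
  then have GN: "G c \<bullet> N < - \<beta> / 2" using be by simp
  define P where "P = {p \<in> S \<times> S. G (fst p) \<bullet> nrm A (snd p) < - \<beta> / 2}"
  have oS: "open S" using jets_open[OF J] .
  have "continuous_on (S \<times> S) (\<lambda>p. G (fst p) \<bullet> nrm A (snd p))"
    unfolding nrm_def
    by (intro continuous_intros continuous_on_compose2[OF jets_continuous(2)[OF J]]) auto
  then have "open ((S \<times> S) \<inter> (\<lambda>p. G (fst p) \<bullet> nrm A (snd p)) -` {..< - \<beta> / 2})"
    by (intro continuous_open_preimage) (auto intro: open_Times oS)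
  moreover have "(S \<times> S) \<inter> (\<lambda>p. G (fst p) \<bullet> nrm A (snd p)) -` {..< - \<beta> / 2} = P" by (auto simp: P_def)
  ultimately have "open P" by simp
  moreover have "(c, c) \<in> P" using c GN by (simp add: P_def N_def)
  ultimately obtain X Y where XY: "open X" "open Y" "c \<in> X" "c \<in> Y" "X \<times> Y \<subseteq> P"
    by (metis open_prod_elim mem_Sigma_iff)
  obtain e where e: "e > 0" "ball c e \<subseteq> X \<inter> Y"
    using XY openE[of "X \<inter> Y" c] by blast
  have eS: "ball c e \<subseteq> S" using e XY unfolding P_def by blast
  define K where "K = sg c + 1"
  have cR: "continuous_on hspace (\<lambda>x. (hrefl A x, sg (hrefl A x)))"
    using continuous_on_hrefl[OF A] hrefl_hspace[OF A]
    by (intro continuous_on_Pair continuous_on_compose2[OF continuous_on_sg]) auto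
  define B where "B = ball c e \<inter> (hspace \<inter> (\<lambda>x. (hrefl A x, sg (hrefl A x))) -` (ball c e \<times> {..<K}))"
  have "open B" unfolding B_def
    by (intro open_Int open_ball continuous_open_preimage[OF cR]) (auto intro: open_hspace open_Times)
  moreover have "c \<in> B" using e ch Rc by (simp add: B_def K_def)
  moreover have "w x \<ge> (\<beta> / (4 * K)) * (- lin A x)" if x: "x \<in> B" and neg: "lin A x < 0" for x
  proof -
    have xB: "x \<in> ball c e" "hrefl A x \<in> ball c e" "x \<in> hspace" "sg (hrefl A x) < K" using x by (auto simp: B_def)
    have xS: "x \<in> S" "hrefl A x \<in> S" using xB eS by auto
    define m where "m = nrm A x"
    define l where "l = ell A x / (m \<bullet> m)"
    have mm: "m \<bullet> m > 0" using nrm_pos[OF A xB(3)] by (simp add: m_def)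
    have l: "l < 0" using neg mm xB(3) by (simp add: l_def lin_sign divide_neg_pos)
    have Rx: "hrefl A x = x - l *\<^sub>R m" by (simp add: hrefl_def l_def m_def)
    have seg: "x + t *\<^sub>R (- (l *\<^sub>R m)) \<in> ball c e" if t: "0 \<le> t" "t \<le> 1" for t
    proof -
      have "(1 - t) *\<^sub>R x + t *\<^sub>R hrefl A x \<in> ball c e"
        using t xB convexD[OF convex_ball, of x c e "hrefl A x" "1 - t" t] by auto
      then show ?thesis unfolding Rx by (simp add: algebra_simps)
    qed
    have "\<exists>z>0. z < 1 \<and> w (x + 1 *\<^sub>R (- (l *\<^sub>R m))) - w (x + 0 *\<^sub>R (- (l *\<^sub>R m))) = (1 - 0) * (G (x + z *\<^sub>R (- (l *\<^sub>R m))) \<bullet> (- (l *\<^sub>R m)))"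
    proof (rule MVT2)
      fix t :: real assume "0 \<le> t" "t \<le> 1"
      then have "x + t *\<^sub>R (- (l *\<^sub>R m)) \<in> S" using seg eS by blast
      then show "((\<lambda>t. w (x + t *\<^sub>R (- (l *\<^sub>R m)))) has_real_derivative G (x + t *\<^sub>R (- (l *\<^sub>R m))) \<bullet> (- (l *\<^sub>R m))) (at t)"
        by (rule jets_line[OF J])
    qed simp
    then obtain z where z: "0 < z" "z < 1" "w (hrefl A x) - w x = - l * (G (x + z *\<^sub>R (- (l *\<^sub>R m))) \<bullet> m)"
      unfolding Rx by auto
    define xi where "xi = x + z *\<^sub>R (- (l *\<^sub>R m))"
    have "xi \<in> ball c e" unfolding xi_def by (rule seg) (use z in auto)
    then have "xi \<in> X" using e(2) by blast
    moreover have "x \<in> Y" using xB(1) e(2) by blast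
    ultimately have "(xi, x) \<in> P" using XY(5) by blast
    then have "G xi \<bullet> m < - \<beta> / 2" by (simp add: P_def m_def)
    then have "- l * (G xi \<bullet> m) \<le> - l * (- \<beta> / 2)" using l by (intro mult_left_mono) auto
    then have "w (hrefl A x) - w x \<le> l * \<beta> / 2" using z(3) by (simp add: xi_def)
    then have w1: "w x \<ge> - l * \<beta> / 4" using odd[OF xS] by simp
    have ll: "lin A x = l * sg (hrefl A x)"
      using mm by (simp add: sg_hrefl[OF A xB(3)] lin_ell[OF xB(3)] l_def m_def)
    have K: "K > 0" using sg_pos[OF ch] by (simp add: K_def)
    have "- lin A x \<le> - l * K" unfolding ll using xB(4) l by simp
    then have "(\<beta> / (4 * K)) * (- lin A x) \<le> (\<beta> / (4 * K)) * (- l * K)"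
      using K be by (intro mult_left_mono) auto
    also have "\<dots> = - l * \<beta> / 4" using K by simp
    finally show ?thesis using w1 by simp
  qed
  moreover have "\<beta> / (4 * K) > 0" using be sg_pos[OF ch] by (simp add: K_def)
  ultimately show ?thesis by blast
qed

text \<open>
  The substitute for Serrin's corner lemma. The centre \<open>c\<close> of the ball lies on the hyperplane, and the
  barrier is the product of the Hopf barrier with \<open>- lin A\<close>. Orthogonality makes the hyperbolic
  scalar product of the gradients of \<open>- lin A\<close> and \<open>cosh_dist c\<close> equal to the product of the functions,
  so that the cross term only changes the dimension from \<open>n\<close> to \<open>n + 2\<close>. Near \<open>c\<close>, where the
  barrier is not a subsolution, the lower bound comes from \<open>hopf_at_hyperplane\<close>.
\<close>
lemma corner_barrier:
  fixes w :: "'a::euclidean_space \<Rightarrow> real"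
  assumes J: "jets S w G H" and S: "S \<subseteq> hspace" and n: "2 \<le> DIM('a)" and L: "L \<ge> 0"
    and c: "c \<in> hspace" and A: "lor A A = 1" and orth: "lor A (hyp c) = 0" and k0: "1 < k0"
    and sub: "{x \<in> hspace. cosh_dist c x < k0 \<and> lin A x < 0} \<subseteq> S"
    and w0: "\<And>x. x \<in> S \<Longrightarrow> w x \<ge> 0"
    and lw: "\<And>x. x \<in> S \<Longrightarrow> lapl x (G x) (H x) \<le> L * w x"
    and near: "open B" "c \<in> B" "m > 0" "\<And>x. x \<in> B \<Longrightarrow> lin A x < 0 \<Longrightarrow> w x \<ge> m * (- lin A x)"
  shows "\<exists>m>0. \<exists>k1<k0. \<exists>a>0. \<forall>x\<in>hspace. k1 < cosh_dist c x \<longrightarrow> cosh_dist c x < k0 \<longrightarrow> lin A x < 0 \<longrightarrow>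
     w x \<ge> m * (- lin A x * (exp (- a * cosh_dist c x) - exp (- a * k0)))"
proof -
  obtain r where r: "r > 0" "ball c r \<subseteq> B" using near openE by blast
  \<comment> \<open>The geodesic ball about \<open>c\<close> given by \<open>k2\<close> lies in \<open>ball c r\<close>.\<close>
  define k2 where "k2 = min ((1 + k0) / 2) (1 + r\<^sup>2)"
  have k2: "1 < k2" "k2 < k0" "k2 \<le> 1 + r\<^sup>2" using k0 r by (auto simp: k2_def min_less_iff_disj)
  define k1 where "k1 = (1 + k2) / 2"
  have k1: "1 < k1" "k1 < k2" using k2 by (auto simp: k1_def)
  have kB: "x \<in> B" if x: "x \<in> hspace" "cosh_dist c x \<le> k2" for x
  proof -
    have "2 * ((x - c) \<bullet> (x - c)) * 1 \<le> 2 * ((x - c) \<bullet> (x - c)) * (sg x * sg c)"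
      using sg_ge1[OF x(1)] sg_ge1[OF c] mult_mono[of 1 "sg x" 1 "sg c"] by (intro mult_left_mono) auto
    also have "\<dots> \<le> r\<^sup>2" using x(2) k2(3) cosh_dist_eq[OF c x(1)] by (simp add: mult_ac)
    finally have "2 * (norm (x - c))\<^sup>2 \<le> r\<^sup>2" by (simp add: power2_norm_eq_inner)
    then have "(norm (x - c))\<^sup>2 < r\<^sup>2" using r by (smt (verit) zero_less_power)
    then have "norm (x - c) < r" using r by (simp add: power2_less_imp_less)
    then show ?thesis using r by (auto simp: dist_norm norm_minus_commute)
  qed
  obtain a where a: "a \<ge> 1" "\<And>k. k1 \<le> k \<Longrightarrow> k \<le> k0 \<Longrightarrow> L \<le> a\<^sup>2 * (k\<^sup>2 - 1) - a * (real DIM('a) + 2) * k"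
    using barrier_constant[OF k1(1) L, of "real DIM('a) + 2" k0] by auto
  define e where "e x = exp (- a * cosh_dist c x)" for x
  define \<psi> where "\<psi> x = e x - exp (- a * k0)" for x
  define V where "V = lin (- A)"
  have Vl: "V x = - lin A x" for x by (simp add: V_def lin_def lor_simps)
  obtain Hp where Hp: "jets hspace \<psi> (\<lambda>x. (- a * e x) *\<^sub>R glin (- hyp c) x) Hp"
     "\<forall>x\<in>hspace. lapl x ((- a * e x) *\<^sub>R glin (- hyp c) x) (Hp x)
       = e x * (a\<^sup>2 * ((cosh_dist c x)\<^sup>2 - 1) - a * real DIM('a) * cosh_dist c x)"
    using jets_exp_cosh_dist[OF c, of a k0] unfolding \<psi>_def[abs_def] e_def[abs_def] by blast
  obtain HV where HV: "jets hspace V (glin (- A)) HV"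
     "\<forall>x\<in>hspace. lapl x (glin (- A) x) (HV x) = real DIM('a) * V x"
    unfolding V_def using jets_lin by blast
  define z where "z x = V x * \<psi> x" for x
  define Gz where "Gz x = V x *\<^sub>R ((- a * e x) *\<^sub>R glin (- hyp c) x) + \<psi> x *\<^sub>R glin (- A) x" for x
  define Hz where "Hz x h = V x *\<^sub>R Hp x h + (glin (- A) x \<bullet> h) *\<^sub>R ((- a * e x) *\<^sub>R glin (- hyp c) x) + (\<psi> x *\<^sub>R HV x h + (((- a * e x) *\<^sub>R glin (- hyp c) x) \<bullet> h) *\<^sub>R glin (- A) x)" for x h
  have Jz: "jets hspace z Gz Hz"
    unfolding z_def[abs_def] Gz_def[abs_def] Hz_def[abs_def] by (rule jets_mult[OF HV(1) Hp(1)])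
  have lz: "lapl x (Gz x) (Hz x) = V x * (e x * (a\<^sup>2 * ((cosh_dist c x)\<^sup>2 - 1) - a * (real DIM('a) + 2) * cosh_dist c x)) + \<psi> x * (real DIM('a) * V x)"
    if x: "x \<in> hspace" for x
  proof -
    have g: "(glin (- A) x \<bullet> ((- a * e x) *\<^sub>R glin (- hyp c) x)) / (4 * (sg x)\<^sup>2) = - a * e x * (V x * cosh_dist c x)"
    proof -
      have "(glin (- A) x \<bullet> ((- a * e x) *\<^sub>R glin (- hyp c) x)) / (4 * (sg x)\<^sup>2)
        = - a * e x * ((glin (- A) x \<bullet> glin (- hyp c) x) / (4 * (sg x)\<^sup>2))" by simp
      also have "\<dots> = - a * e x * (V x * cosh_dist c x)"
        unfolding glin_glin[OF x] by (simp add: lor_simps orth cosh_dist_lin V_def)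
      finally show ?thesis .
    qed
    have "lapl x (Gz x) (Hz x) = V x * (e x * (a\<^sup>2 * ((cosh_dist c x)\<^sup>2 - 1) - a * real DIM('a) * cosh_dist c x)) + \<psi> x * (real DIM('a) * V x)
        + 2 * (- a * e x * (V x * cosh_dist c x))"
      unfolding Gz_def Hz_def lapl_mult g using Hp(2) HV(2) x by simp
    then show ?thesis by (simp add: algebra_simps)
  qed
  define Q where "Q = {x \<in> hspace. k1 < cosh_dist c x} \<inter> {x \<in> hspace. cosh_dist c x < k0} \<inter> {x \<in> hspace. lin A x < 0}"
  have oQ: "open Q" unfolding Q_def by (intro open_Int open_cosh_dist open_lin)
  have Qs: "Q \<subseteq> S" "Q \<subseteq> hspace" using sub by (auto simp: Q_def)
  have cK: "compact {x \<in> hspace. cosh_dist c x \<le> k0}" by (rule compact_cosh_dist[OF c])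
  have psi1: "0 \<le> \<psi> x" "\<psi> x \<le> 1" if "x \<in> Q" for x
  proof -
    have x: "x \<in> hspace" "cosh_dist c x < k0" using that by (auto simp: Q_def)
    have "e x \<le> 1" unfolding e_def using a(1) cosh_dist_ge1[OF c x(1)] by simp
    then show "\<psi> x \<le> 1" unfolding \<psi>_def by (smt (verit) exp_ge_zero)
    show "0 \<le> \<psi> x" unfolding \<psi>_def e_def using x a by simp
  qed
  have main: "w x \<ge> m * z x" if xQ: "x \<in> Q" for x
  proof (rule barrier_compare[OF jets_subset[OF J oQ Qs(1)] jets_subset[OF Jz oQ Qs(2)] Qs(2) n L near(3) _ _ _ _ xQ])
    fix y assume y: "y \<in> Q"
    then have y': "y \<in> hspace" "k1 < cosh_dist c y" "cosh_dist c y < k0" "V y > 0" by (auto simp: Q_def Vl)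
    show "lapl y (G y) (H y) \<le> L * w y" using lw y Qs by auto
    show "0 \<le> w y" using w0 y Qs by auto
    have "L * \<psi> y \<le> L * e y" using L by (intro mult_left_mono) (auto simp: \<psi>_def)
    also have "\<dots> \<le> (a\<^sup>2 * ((cosh_dist c y)\<^sup>2 - 1) - a * (real DIM('a) + 2) * cosh_dist c y) * e y"
      using a(2)[of "cosh_dist c y"] y' by (intro mult_right_mono) (auto simp: e_def)
    finally have "V y * (L * \<psi> y) \<le> V y * ((a\<^sup>2 * ((cosh_dist c y)\<^sup>2 - 1) - a * (real DIM('a) + 2) * cosh_dist c y) * e y)"
      using y' by (intro mult_left_mono) auto
    moreover have "\<psi> y * (real DIM('a) * V y) \<ge> 0" using psi1[OF y] y' by simp
    ultimately show "L * z y \<le> lapl y (Gz y) (Hz y)"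
      unfolding lz[OF y'(1)] z_def by (simp add: mult_ac)
  next
    fix \<delta> :: real assume d: "\<delta> > 0"
    define F where "F x = (cosh_dist c x, z x, V x)" for x
    define K where "K = {x \<in> hspace. cosh_dist c x \<le> k0} \<inter> ({x \<in> hspace. cosh_dist c x \<le> k0} \<inter> F -` ({k2..} \<times> {\<delta>..} \<times> {0..}))"
    have "closed ({x \<in> hspace. cosh_dist c x \<le> k0} \<inter> F -` ({k2..} \<times> {\<delta>..} \<times> {0..}))"
    proof (rule continuous_closed_preimage)
      show "continuous_on {x \<in> hspace. cosh_dist c x \<le> k0} F" unfolding F_def[abs_def]
        by (intro continuous_on_Pair continuous_on_subset[OF continuous_on_cosh_dist] continuous_on_subset[OF jets_continuous(1)[OF Jz]]
            continuous_on_subset[OF jets_continuous(1)[OF HV(1)]]) auto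
    qed (use compact_cosh_dist[OF c] compact_imp_closed in \<open>auto intro!: closed_Times\<close>)
    then have "compact K" unfolding K_def using cK by (rule compact_Int_closed[rotated])
    moreover have "K \<subseteq> Q"
    proof
      fix x assume "x \<in> K"
      then have x: "x \<in> hspace" "cosh_dist c x \<le> k0" "cosh_dist c x \<ge> k2" "z x \<ge> \<delta>" "V x \<ge> 0" by (auto simp: K_def F_def)
      then have "cosh_dist c x \<noteq> k0" "V x \<noteq> 0" using d by (auto simp: z_def \<psi>_def e_def)
      then show "x \<in> Q" using x k1 by (auto simp: Q_def Vl)
    qed
    moreover have "w x \<ge> m * z x \<or> z x < \<delta>" if x: "x \<in> Q - K" for x
    proof (cases "cosh_dist c x \<le> k2")
      case True
      have xQ: "x \<in> Q" "x \<in> hspace" "V x > 0" using x by (auto simp: Q_def Vl)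
      have "w x \<ge> m * V x" using near(4)[OF kB[OF xQ(2) True]] xQ(3) by (simp add: Vl)
      moreover have "m * z x \<le> m * V x"
        using psi1[OF xQ(1)] xQ(3) near(3) by (simp add: z_def mult_left_le)
      ultimately show ?thesis by simp
    next
      case False
      then show ?thesis using x by (auto simp: Q_def K_def F_def Vl)
    qed
    ultimately show "\<exists>K. compact K \<and> K \<subseteq> Q \<and> (\<forall>x\<in>Q - K. w x \<ge> m * z x \<or> z x < \<delta>)" by blast
  qed
  have "k1 < k0" using k1 k2 by simp
  then show ?thesis
    using near(3) a(1) main
    by (intro exI[of _ m] conjI exI[of _ k1] exI[of _ a]) (auto simp: Q_def z_def \<psi>_def e_def Vl)
qed

section \<open>Connected halves of neighbourhoods\<close>

text \<open>
  In the Klein model, reached by \<open>x \<mapsto> 2 x / (1 + |x|\<^sup>2)\<close>, hyperplanes are flat; half of a small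
  Euclidean ball of that model is convex.
\<close>
lemma connected_half_neighbourhood:
  fixes q :: "'a::euclidean_space"
  assumes q: "q \<in> hspace" and W: "open W" "q \<in> W"
  shows "\<exists>B. open B \<and> q \<in> B \<and> B \<subseteq> W \<inter> hspace \<and> connected (B \<inter> {x \<in> hspace. lin A x < 0})"
proof -
  define kl where "kl x = (2 / (1 + x \<bullet> x)) *\<^sub>R x" for x :: 'a
  define ik where "ik y = (1 / (1 + sqrt (1 - y \<bullet> y))) *\<^sub>R y" for y :: 'a
  have pos: "1 + x \<bullet> x > 0" for x :: 'a by (simp add: add_pos_nonneg)
  have nz: "1 + x \<bullet> x \<noteq> 0" for x :: 'a using pos[of x] by simp
  have klkl: "1 - kl x \<bullet> kl x = ((1 - x \<bullet> x) / (1 + x \<bullet> x))\<^sup>2" for x :: 'a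
  proof -
    define a where "a = x \<bullet> x"
    have a: "(1 + a) * (1 + a) \<noteq> 0" using nz[of x] by (simp add: a_def)
    have "kl x \<bullet> kl x = 4 * a / ((1 + a) * (1 + a))" by (simp add: kl_def a_def)
    then have "1 - kl x \<bullet> kl x = ((1 + a) * (1 + a) - 4 * a) / ((1 + a) * (1 + a))"
      using a by (simp add: diff_divide_distrib)
    also have "(1 + a) * (1 + a) - 4 * a = (1 - a) * (1 - a)" by (simp add: algebra_simps)
    finally show ?thesis by (simp add: a_def power2_eq_square)
  qed
  have klh: "kl x \<in> hspace" if "x \<in> hspace" for x
  proof -
    have "0 < 1 - kl x \<bullet> kl x" unfolding klkl using hspace_pos[OF that] pos[of x] by simp
    then show ?thesis by (simp add: hspace_iff)
  qed
  have ikl: "ik (kl x) = x" if "x \<in> hspace" for x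
  proof -
    have "sqrt (1 - kl x \<bullet> kl x) = (1 - x \<bullet> x) / (1 + x \<bullet> x)"
      unfolding klkl using hspace_pos[OF that] pos[of x] by simp
    then have "1 + sqrt (1 - kl x \<bullet> kl x) = 2 / (1 + x \<bullet> x)" using nz[of x] by (simp add: field_simps)
    then have 1: "ik (kl x) = (1 / (2 / (1 + x \<bullet> x))) *\<^sub>R kl x" by (simp only: ik_def)
    define a where "a = 1 + x \<bullet> x"
    have "a \<noteq> 0" using nz[of x] by (simp add: a_def)
    then show ?thesis unfolding 1 unfolding kl_def a_def[symmetric] by simp
  qed
  have iks: "ik y \<bullet> ik y = (1 - sqrt (1 - y \<bullet> y)) / (1 + sqrt (1 - y \<bullet> y))" if "y \<in> hspace" for y
  proof -
    define t where "t = sqrt (1 - y \<bullet> y)"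
    have t: "t > 0" "t * t = 1 - y \<bullet> y" using hspace_pos[OF that] by (simp_all add: t_def)
    have "ik y \<bullet> ik y = (y \<bullet> y) / ((1 + t) * (1 + t))" by (simp add: ik_def t_def)
    also have "y \<bullet> y = (1 - t) * (1 + t)" using t by (simp add: algebra_simps)
    finally show ?thesis using t by (simp add: t_def)
  qed
  have ikh: "ik y \<in> hspace" if "y \<in> hspace" for y
  proof -
    define t where "t = sqrt (1 - y \<bullet> y)"
    have "t > 0" using hspace_pos[OF that] by (simp add: t_def)
    then show ?thesis unfolding hspace_iff iks[OF that] t_def[symmetric] by simp
  qed
  have klik: "kl (ik y) = y" if "y \<in> hspace" for y
  proof -
    define t where "t = sqrt (1 - y \<bullet> y)"
    have t: "t > 0" using hspace_pos[OF that] by (simp add: t_def)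
    have "1 + ik y \<bullet> ik y = 2 / (1 + t)" unfolding iks[OF that] t_def[symmetric] using t by (simp add: field_simps)
    then show ?thesis unfolding kl_def using t by (simp add: ik_def t_def[symmetric])
  qed
  have cik: "continuous_on hspace ik"
  proof -
    have "1 + sqrt (1 - y \<bullet> y) \<noteq> 0" if "y \<in> hspace" for y :: 'a
    proof -
      define t where "t = sqrt (1 - y \<bullet> y)"
      have "t > 0" using hspace_pos[OF that] by (simp add: t_def)
      then show ?thesis unfolding t_def[symmetric] by simp
    qed
    then show ?thesis unfolding ik_def by (intro continuous_intros) auto
  qed
  have ckl: "continuous_on hspace kl" unfolding kl_def using nz by (intro continuous_intros) auto
  have "open (hspace \<inter> ik -` W)" by (rule continuous_open_preimage[OF cik open_hspace W(1)])
  moreover have "kl q \<in> hspace \<inter> ik -` W" using q W klh ikl by auto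
  ultimately obtain e where e: "e > 0" "ball (kl q) e \<subseteq> hspace \<inter> ik -` W" using openE by blast
  define B where "B = hspace \<inter> kl -` ball (kl q) e"
  have "open B" unfolding B_def by (rule continuous_open_preimage[OF ckl open_hspace]) simp
  moreover have "q \<in> B" using q e by (simp add: B_def)
  moreover have "B \<subseteq> W \<inter> hspace"
  proof
    fix x assume "x \<in> B"
    then have x: "x \<in> hspace" "kl x \<in> ball (kl q) e" by (auto simp: B_def)
    then have "ik (kl x) \<in> W" using e by blast
    then show "x \<in> W \<inter> hspace" using ikl[OF x(1)] x by simp
  qed
  moreover have "connected (B \<inter> {x \<in> hspace. lin A x < 0})"
  proof -
    have lk: "lin A x < 0 \<longleftrightarrow> kl x \<bullet> snd A < fst A" if "x \<in> hspace" for x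
    proof -
      have "ell A x = (1 + x \<bullet> x) * (kl x \<bullet> snd A - fst A)"
        using nz[of x] by (simp add: ell_def kl_def algebra_simps) (simp add: field_simps)
      then show ?thesis using pos[of x] by (simp add: lin_sign[OF that] mult_less_0_iff)
    qed
    define T where "T = ball (kl q) e \<inter> {y. snd A \<bullet> y < fst A}"
    have "connected T" unfolding T_def
      by (intro convex_connected convex_Int convex_ball convex_halfspace_lt)
    moreover have "continuous_on T ik"
      by (rule continuous_on_subset[OF cik]) (use e in \<open>auto simp: T_def\<close>)
    moreover have "B \<inter> {x \<in> hspace. lin A x < 0} = ik ` T"
    proof (intro equalityI subsetI)
      fix x assume "x \<in> B \<inter> {x \<in> hspace. lin A x < 0}"
      then have "x \<in> hspace" "kl x \<in> T" using lk by (auto simp: B_def T_def inner_commute)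
      then show "x \<in> ik ` T" using ikl by (metis imageI)
    next
      fix x assume "x \<in> ik ` T"
      then obtain y where y: "y \<in> T" "x = ik y" by auto
      have yh: "y \<in> hspace" using y e by (auto simp: T_def)
      show "x \<in> B \<inter> {x \<in> hspace. lin A x < 0}"
        using y klik[OF yh] ikh[OF yh] lk[OF ikh[OF yh]] by (auto simp: B_def T_def inner_commute)
    qed
    ultimately show ?thesis by (simp add: connected_continuous_image)
  qed
  ultimately show ?thesis by blast
qed

section \<open>One-sided calculus at a boundary point\<close>

lemma ball_condition_small:
  fixes v \<nu> :: "'a::real_inner"
  assumes "\<nu> \<bullet> \<nu> = 1" "M > 0" "v \<bullet> \<nu> > M * (v \<bullet> v)"
  shows "norm v < 1 / M"
proof -
  have "v \<bullet> \<nu> \<le> norm v * norm \<nu>" using Cauchy_Schwarz_ineq2[of v \<nu>] by linarith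
  then have "M * (norm v * norm v) < norm v"
    using assms by (simp add: norm_eq_1[symmetric] norm_eq_sqrt_inner[of v])
  then have "M * norm v * norm v < 1 * norm v" by simp
  then have "M * norm v < 1" by (rule mult_right_less_imp_less) simp
  then show ?thesis using assms(2) by (simp add: field_simps)
qed

text \<open>
  Differentiability of the gradient at \<open>p\<close> already gives a quadratic Taylor estimate. For a
  defining function of the boundary this is the interior and exterior ball condition.
\<close>
lemma quadratic_remainder:
  fixes p :: "'a::euclidean_space"
  assumes J: "jets V \<phi> g h" and p: "p \<in> V"
  shows "\<exists>\<delta>>0. \<exists>M>0. ball p \<delta> \<subseteq> V \<and> (\<forall>x\<in>ball p \<delta>. \<bar>\<phi> x - \<phi> p - g p \<bullet> (x - p)\<bar> \<le> M * ((x - p) \<bullet> (x - p)))"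
proof -
  have hd: "(g has_derivative h p) (at p)" using jetsD(2)[OF J p] .
  then have bl: "bounded_linear (h p)" by (rule has_derivative_bounded_linear)
  obtain K where K: "K > 0" "\<And>v. norm (h p v) \<le> norm v * K"
    using bounded_linear.pos_bounded[OF bl] by blast
  obtain d1 where d1: "d1 > 0" "\<And>y. norm (y - p) < d1 \<Longrightarrow> norm (g y - g p - h p (y - p)) \<le> 1 * norm (y - p)"
    using hd unfolding has_derivative_at_alt by (metis zero_less_one)
  obtain r where r: "r > 0" "ball p r \<subseteq> V" using jets_open[OF J] p openE by blast
  define \<delta> where "\<delta> = min d1 r"
  define M where "M = K + 1"
  have M: "M > 0" using K by (simp add: M_def)
  have gb: "norm (g y - g p) \<le> M * norm (y - p)" if "norm (y - p) < \<delta>" for y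
  proof -
    have "norm (g y - g p) \<le> norm (g y - g p - h p (y - p)) + norm (h p (y - p))"
      using norm_triangle_ineq[of "g y - g p - h p (y - p)" "h p (y - p)"] by simp
    also have "\<dots> \<le> 1 * norm (y - p) + norm (y - p) * K"
      using d1(2)[of y] K(2) that by (intro add_mono) (auto simp: \<delta>_def)
    finally show ?thesis by (simp add: M_def algebra_simps)
  qed
  have sub: "ball p \<delta> \<subseteq> V" using r by (auto simp: \<delta>_def)
  have "\<bar>\<phi> x - \<phi> p - g p \<bullet> (x - p)\<bar> \<le> M * ((x - p) \<bullet> (x - p))" if x: "x \<in> ball p \<delta>" for x
  proof -
    define v where "v = x - p"
    have nv: "norm v < \<delta>" using x by (simp add: v_def dist_norm norm_minus_commute)
    have inV: "p + t *\<^sub>R v \<in> V" if "0 \<le> t" "t \<le> 1" for t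
    proof -
      have "norm (t *\<^sub>R v) \<le> norm v" using that by (simp add: mult_left_le_one_le)
      then have "p + t *\<^sub>R v \<in> ball p \<delta>" using nv by (simp add: dist_norm)
      then show ?thesis using sub by blast
    qed
    have "\<exists>z>0. z < 1 \<and> \<phi> (p + 1 *\<^sub>R v) - \<phi> (p + 0 *\<^sub>R v) = (1 - 0) * (g (p + z *\<^sub>R v) \<bullet> v)"
    proof (rule MVT2)
      fix t :: real assume "0 \<le> t" "t \<le> 1"
      then show "((\<lambda>t. \<phi> (p + t *\<^sub>R v)) has_real_derivative g (p + t *\<^sub>R v) \<bullet> v) (at t)"
        by (intro jets_line[OF J] inV)
    qed simp
    then obtain z where z: "0 < z" "z < 1" "\<phi> x - \<phi> p = g (p + z *\<^sub>R v) \<bullet> v" by (auto simp: v_def)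
    have nz: "norm (z *\<^sub>R v) \<le> norm v" using z by (simp add: mult_left_le_one_le)
    have "\<bar>(g (p + z *\<^sub>R v) - g p) \<bullet> v\<bar> \<le> norm (g (p + z *\<^sub>R v) - g p) * norm v"
      by (rule Cauchy_Schwarz_ineq2)
    also have "\<dots> \<le> (M * norm v) * norm v"
      using gb[of "p + z *\<^sub>R v"] nz nv M
      by (intro mult_right_mono) (auto intro: order_trans[OF _ mult_left_mono])
    also have "\<dots> = M * (v \<bullet> v)" by (simp add: norm_eq_sqrt_inner)
    finally have "\<bar>(g (p + z *\<^sub>R v) - g p) \<bullet> v\<bar> \<le> M * (v \<bullet> v)" .
    then show ?thesis using z(3) by (simp add: v_def[symmetric] inner_diff_left)
  qed
  then show ?thesis using sub M r d1 by (intro exI[of _ \<delta>] conjI exI[of _ M]) (auto simp: \<delta>_def)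
qed

lemma mvt_real:
  fixes f :: "real \<Rightarrow> real"
  assumes "a < b" "continuous_on {a..b} f" "\<And>x. a < x \<Longrightarrow> x < b \<Longrightarrow> (f has_derivative (*) (f' x)) (at x)"
  shows "\<exists>\<xi>\<in>{a<..<b}. f b - f a = f' \<xi> * (b - a)"
proof -
  obtain \<xi> where "a < \<xi>" "\<xi> < b" "f b - f a = f' \<xi> * (b - a)"
    using mvt[OF assms(1,2), of "\<lambda>x. (*) (f' x)"] assms(3) by blast
  then show ?thesis by auto
qed

lemma deriv_limit_ge:
  fixes h :: "real \<Rightarrow> real"
  assumes e: "e > 0" and c: "continuous_on {0..<e} h"
    and d: "\<And>s. 0 < s \<Longrightarrow> s < e \<Longrightarrow> (h has_real_derivative h' s) (at s)"
    and l: "(h' \<longlongrightarrow> l) (at_right 0)" and h0: "h 0 = 0"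
    and ge: "\<forall>\<^sub>F s in at_right 0. h s \<ge> b * s"
  shows "l \<ge> b"
proof (rule ccontr)
  assume "\<not> l \<ge> b"
  then have "\<forall>\<^sub>F s in at_right 0. h' s < b" by (intro order_tendstoD(2)[OF l]) auto
  with ge have "\<forall>\<^sub>F s in at_right 0. h s \<ge> b * s \<and> h' s < b" by eventually_elim simp
  then obtain r where r: "r > 0" "\<And>s. 0 < s \<Longrightarrow> s < r \<Longrightarrow> h s \<ge> b * s \<and> h' s < b"
    unfolding eventually_at_right_field by auto
  define s where "s = min r e / 2"
  have s: "0 < s" "s < r" "s < e" using r e by (auto simp: s_def)
  have "\<exists>\<xi>\<in>{0<..<s}. h s - h 0 = h' \<xi> * (s - 0)"
  proof (rule mvt_real[OF s(1)])
    show "continuous_on {0..s} h" by (rule continuous_on_subset[OF c]) (use s in auto)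
    fix x assume "0 < x" "x < s"
    then show "(h has_derivative (*) (h' x)) (at x)"
      using d[of x] s by (simp add: has_field_derivative_def)
  qed
  then obtain \<xi> where xi: "0 < \<xi>" "\<xi> < s" "h s = h' \<xi> * s" using h0 by auto
  have "h' \<xi> < b" using r(2)[of \<xi>] xi s by auto
  then have "h s < b * s" using xi(3) s(1) by simp
  then show False using r(2)[OF s(1,2)] by simp
qed

text \<open>
  A one-sided second-order Taylor argument: with vanishing value and first derivative at \<open>0\<close>,
  \<open>h'' < b\<close> near \<open>0\<close> would give \<open>h' s < b s\<close> and so \<open>h s < b s\<^sup>2\<close>.
\<close>
lemma second_deriv_limit_pos:
  fixes h :: "real \<Rightarrow> real"
  assumes e: "e > 0" and c: "continuous_on {0..<e} h" and c': "continuous_on {0..<e} h'"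
    and d: "\<And>s. 0 < s \<Longrightarrow> s < e \<Longrightarrow> (h has_real_derivative h' s) (at s)"
    and d': "\<And>s. 0 < s \<Longrightarrow> s < e \<Longrightarrow> (h' has_real_derivative h'' s) (at s)"
    and l: "(h'' \<longlongrightarrow> l) (at_right 0)" and h0: "h 0 = 0" "h' 0 = 0" and b: "b > 0"
    and ge: "\<forall>\<^sub>F s in at_right 0. h s \<ge> b * (s * s)"
  shows "l \<ge> b"
proof (rule ccontr)
  assume "\<not> l \<ge> b"
  then have "\<forall>\<^sub>F s in at_right 0. h'' s < b" by (intro order_tendstoD(2)[OF l]) auto
  with ge have "\<forall>\<^sub>F s in at_right 0. h s \<ge> b * (s * s) \<and> h'' s < b" by eventually_elim simp
  then obtain r where r: "r > 0" "\<And>s. 0 < s \<Longrightarrow> s < r \<Longrightarrow> h s \<ge> b * (s * s) \<and> h'' s < b"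
    unfolding eventually_at_right_field by auto
  define s where "s = min r e / 2"
  have s: "0 < s" "s < r" "s < e" using r e by (auto simp: s_def)
  have "\<exists>\<xi>\<in>{0<..<s}. h s - h 0 = h' \<xi> * (s - 0)"
  proof (rule mvt_real[OF s(1)])
    show "continuous_on {0..s} h" by (rule continuous_on_subset[OF c]) (use s in auto)
    fix x assume "0 < x" "x < s"
    then show "(h has_derivative (*) (h' x)) (at x)"
      using d[of x] s by (simp add: has_field_derivative_def)
  qed
  then obtain \<xi> where xi: "0 < \<xi>" "\<xi> < s" "h s = h' \<xi> * s" using h0 by auto
  have "\<exists>\<zeta>\<in>{0<..<\<xi>}. h' \<xi> - h' 0 = h'' \<zeta> * (\<xi> - 0)"
  proof (rule mvt_real[OF xi(1)])
    show "continuous_on {0..\<xi>} h'" by (rule continuous_on_subset[OF c']) (use s xi in auto)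
    fix x assume "0 < x" "x < \<xi>"
    then show "(h' has_derivative (*) (h'' x)) (at x)"
      using d'[of x] s xi by (simp add: has_field_derivative_def)
  qed
  then obtain \<zeta> where ze: "0 < \<zeta>" "\<zeta> < \<xi>" "h' \<xi> = h'' \<zeta> * \<xi>" using h0 by auto
  have "h'' \<zeta> < b" using r(2)[of \<zeta>] xi s ze by auto
  then have "h' \<xi> < b * \<xi>" using ze(3) xi(1) by simp
  also have "\<dots> < b * s" using b xi by simp
  finally have "h s < b * s * s" using xi(3) s(1) by simp
  then show False using r(2)[OF s(1,2)] by (simp add: mult.assoc)
qed

lemma ray_in_closure:
  fixes x :: "'a::euclidean_space"
  assumes "\<forall>\<^sub>F s in at_right 0. x + s *\<^sub>R k \<in> S"
  shows "x \<in> closure S"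
proof (rule Lim_in_closed_set[OF closed_closure _ trivial_limit_at_right_real])
  show "\<forall>\<^sub>F s in at_right 0. x + s *\<^sub>R k \<in> closure S"
    using assms by eventually_elim (use closure_subset in blast)
  show "((\<lambda>s. x + s *\<^sub>R k) \<longlongrightarrow> x) (at_right 0)" by (auto intro!: tendsto_eq_intros)
qed

lemma negative_along_ray:
  assumes J: "jets V \<phi> g h" and x: "x \<in> V" and z: "\<phi> x = 0" and k: "g x \<bullet> k < 0"
  shows "\<forall>\<^sub>F s in at_right 0. x + s *\<^sub>R k \<in> V \<and> \<phi> (x + s *\<^sub>R k) < 0"
proof -
  have t: "((\<lambda>s. x + s *\<^sub>R k) \<longlongrightarrow> x) (at_right 0)" by (auto intro!: tendsto_eq_intros)
  have d1: "((\<lambda>s. \<phi> (x + s *\<^sub>R k)) has_real_derivative g (x + 0 *\<^sub>R k) \<bullet> k) (at 0)"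
    by (rule jets_line[OF J]) (use x in simp)
  have d2: "g (x + 0 *\<^sub>R k) \<bullet> k < 0" using k by simp
  obtain c where c: "c > 0" "\<forall>\<^sub>F s in at_right 0. \<phi> (x + s *\<^sub>R k) \<le> \<phi> (x + 0 *\<^sub>R k) - c * s"
    using slope_neg[OF d1 d2] by blast
  show ?thesis
    using c(2) topological_tendstoD[OF t jets_open[OF J] x] eventually_at_right_less[of "0::real"]
  proof eventually_elim
    case (elim s)
    have "c * s > 0" using c elim by simp
    then show ?case using elim z by simp
  qed
qed

lemma positive_along_ray:
  assumes J: "jets V \<phi> g h" and x: "x \<in> V" and z: "\<phi> x = 0" and k: "g x \<bullet> k > 0"
  shows "\<forall>\<^sub>F s in at_right 0. x + s *\<^sub>R k \<in> V \<and> \<phi> (x + s *\<^sub>R k) > 0"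
  using negative_along_ray[OF jets_scale[OF J, of "-1"] x, of k] z k by simp

section \<open>Boundary behaviour of a solution in an exterior domain\<close>

text \<open>
  The geometric situation after all regularity hypotheses have been converted: \<open>\<Gamma>\<close> is the common
  boundary of the bounded domain \<open>U\<close> and the exterior domain \<open>\<Omega>\<close>, while \<open>G\<close> and \<open>H\<close> are the
  continuous extensions to \<open>\<Gamma>\<close> of the gradient and the Hessian of \<open>u\<close>. Defining functions are negative in
  \<open>\<Omega>\<close>, so their gradient points into \<open>U\<close>. The Neumann condition appears in Euclidean form: the
  hyperbolic unit normal is \<open>1 / (2 * sg p)\<close> times the Euclidean one.
\<close>
locale exterior =
  fixes U \<Omega> \<Gamma> :: "'a::euclidean_space set" and u :: "'a \<Rightarrow> real" and G :: "'a \<Rightarrow> 'a"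
    and H :: "'a \<Rightarrow> 'a \<Rightarrow> 'a" and f :: "real \<Rightarrow> real" and \<alpha> C L :: real
  assumes dim: "2 \<le> DIM('a)"
    and cover: "U \<union> \<Gamma> \<union> \<Omega> = hspace"
    and disj: "U \<inter> \<Gamma> = {}" "U \<inter> \<Omega> = {}" "\<Gamma> \<inter> \<Omega> = {}"
    and oU: "open U" and oOm: "open \<Omega>" and cpt: "compact (U \<union> \<Gamma>)"
    and U_ne: "U \<noteq> {}" and conU: "connected U" and conOm: "connected \<Omega>"
    and defining: "\<And>p. p \<in> \<Gamma> \<Longrightarrow> \<exists>V \<phi> g h. jets V \<phi> g h \<and> p \<in> V \<and> V \<subseteq> hspace \<and>
        (\<forall>x\<in>V. x \<in> \<Omega> \<longleftrightarrow> \<phi> x < 0) \<and> (\<forall>x\<in>V. x \<in> \<Gamma> \<longleftrightarrow> \<phi> x = 0) \<and> g p \<noteq> 0 \<and>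
        G p \<bullet> g p = \<alpha> * (2 * sg p) * norm (g p)"
    and ju: "jets \<Omega> u G H"
    and cu: "continuous_on (\<Omega> \<union> \<Gamma>) u" and cG: "continuous_on (\<Omega> \<union> \<Gamma>) G"
    and cH: "\<And>h. continuous_on (\<Omega> \<union> \<Gamma>) (\<lambda>x. H x h)"
    and linH: "\<And>x. linear (H x)"
    and symH: "\<And>x h k. x \<in> \<Omega> \<union> \<Gamma> \<Longrightarrow> H x h \<bullet> k = H x k \<bullet> h"
    and u0: "\<And>x. x \<in> \<Gamma> \<Longrightarrow> u x = 0" and upos: "\<And>x. x \<in> \<Omega> \<Longrightarrow> u x > 0"
    and eq: "\<And>x. x \<in> \<Omega> \<Longrightarrow> lapl x (G x) (H x) = - f (u x)"
    and at_inf: "\<And>\<epsilon>. \<epsilon> > 0 \<Longrightarrow> \<exists>r<1. \<forall>x\<in>\<Omega>. norm x > r \<longrightarrow> \<bar>u x - C\<bar> < \<epsilon>"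
    and anti: "antimono f" and L0: "L \<ge> 0" and lip: "\<And>s t. \<bar>f s - f t\<bar> \<le> L * \<bar>s - t\<bar>"
    and al: "\<alpha> \<le> 0"
begin

lemma sub_h: "U \<subseteq> hspace" "\<Omega> \<subseteq> hspace" "\<Gamma> \<subseteq> hspace"
  using cover by auto

lemma cl_Om: "\<Omega> \<union> \<Gamma> = hspace - U" using cover disj by auto

lemma line_cont:
  assumes c: "continuous_on (\<Omega> \<union> \<Gamma>) F" and p: "p \<in> \<Gamma>" and e: "\<And>s. 0 < s \<Longrightarrow> s < e \<Longrightarrow> p + s *\<^sub>R k \<in> \<Omega>"
  shows "continuous_on {0..<e} (\<lambda>s. F (p + s *\<^sub>R k))"
proof (rule continuous_on_compose2[OF c])
  show "continuous_on {0..<e} (\<lambda>s. p + s *\<^sub>R k)" by (intro continuous_intros)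
  show "(\<lambda>s. p + s *\<^sub>R k) ` {0..<e} \<subseteq> \<Omega> \<union> \<Gamma>"
  proof clarify
    fix s assume s: "s \<in> {0..<e}" "p + s *\<^sub>R k \<notin> \<Gamma>"
    show "p + s *\<^sub>R k \<in> \<Omega>"
      using s p e[of s] by (cases "s = 0") auto
  qed
qed

lemma line_tendsto:
  assumes c: "continuous_on (\<Omega> \<union> \<Gamma>) F" and p: "p \<in> \<Gamma>" and e: "e > 0" "\<And>s. 0 < s \<Longrightarrow> s < e \<Longrightarrow> p + s *\<^sub>R k \<in> \<Omega>"
  shows "((\<lambda>s. F (p + s *\<^sub>R k)) \<longlongrightarrow> F p) (at_right 0)"
proof -
  have "((\<lambda>s. F (p + s *\<^sub>R k)) \<longlongrightarrow> F (p + 0 *\<^sub>R k)) (at 0 within {0..<e})"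
    using line_cont[where e=e and k=k, OF c p e(2)] e(1) unfolding continuous_on_def
    by (meson atLeastLessThan_iff order_refl)
  moreover have "at_right 0 \<le> at 0 within {0..<e}"
  proof -
    have "at 0 within {0<..<e} = at_right 0" using e(1) by (intro at_within_nhd[of 0 "{..<e}"]) auto
    then show ?thesis by (metis at_le greaterThanLessThan_subseteq_atLeastLessThan_iff order_refl)
  qed
  ultimately show ?thesis by (auto intro: tendsto_mono)
qed

text \<open>
  A function vanishing on \<open>\<Gamma>\<close> has zero tangential derivatives, although it is defined on one side
  of \<open>\<Gamma>\<close> only. Tilting \<open>\<tau>\<close> slightly inwards, to \<open>\<tau> + \<eta> \<nu>\<close>, gives a segment inside \<open>\<Omega>\<close> along which the
  derivative can be computed; its end point can be joined to a zero of \<open>F\<close> by a segment of length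
  proportional to \<open>\<eta>\<close>, since the point with \<open>\<tau> - \<eta> \<nu>\<close> instead lies in \<open>U\<close>. Then \<open>\<eta>\<close> tends to \<open>0\<close>.
\<close>
lemma tangential_derivative_zero:
  assumes p: "p \<in> \<Gamma>" and cF: "continuous_on (\<Omega> \<union> \<Gamma>) F"
    and dF: "\<And>x. x \<in> \<Omega> \<Longrightarrow> (F has_derivative DF x) (at x)"
    and cD: "\<And>h. continuous_on (\<Omega> \<union> \<Gamma>) (\<lambda>x. DF x h)"
    and F0: "\<And>x. x \<in> \<Gamma> \<Longrightarrow> F x = 0" and lD: "linear (DF p)"
    and J: "jets V \<phi> g h" "p \<in> V" "V \<subseteq> hspace"
    and V: "\<And>x. x \<in> V \<Longrightarrow> x \<in> \<Omega> \<longleftrightarrow> \<phi> x < 0" "\<And>x. x \<in> V \<Longrightarrow> x \<in> \<Gamma> \<longleftrightarrow> \<phi> x = 0" and g: "g p \<noteq> 0"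
    and tau: "g p \<bullet> \<tau> = 0"
  shows "DF p \<tau> = (0::real)"
proof -
  define \<nu> where "\<nu> = - g p"
  define M where "M = \<bar>DF p \<nu>\<bar> + 1"
  have gnu: "g p \<bullet> \<nu> < 0" using g by (simp add: \<nu>_def)
  have phip: "\<phi> p = 0" using V(2)[OF J(2)] p by simp
  have lineD: "((\<lambda>s. F (x + s *\<^sub>R k)) has_derivative (*) (DF (x + s *\<^sub>R k) k)) (at s)" if "x + s *\<^sub>R k \<in> \<Omega>" for x s k
  proof -
    have 1: "((\<lambda>s. x + s *\<^sub>R k) has_derivative (\<lambda>h. h *\<^sub>R k)) (at s)" by (auto intro!: derivative_eq_intros)
    have l: "linear (DF (x + s *\<^sub>R k))" using dF[OF that] by (rule has_derivative_linear)
    show ?thesis using has_derivative_compose[OF 1 dF[OF that]]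
      by (simp add: linear_scale[OF l] mult_commute_abs)
  qed
  have evOm: "\<forall>\<^sub>F s in at_right 0. p + s *\<^sub>R k \<in> \<Omega>" if k: "g p \<bullet> k < 0" for k
    using negative_along_ray[OF J(1,2) phip k] by eventually_elim (use V(1) in blast)
  have evU: "\<forall>\<^sub>F s in at_right 0. p + s *\<^sub>R k \<notin> \<Omega>" if k: "g p \<bullet> k > 0" for k
    using positive_along_ray[OF J(1,2) phip k] by eventually_elim (use V(1) in force)
  have pc: "p \<in> \<Omega> \<union> \<Gamma>" using p by simp
  have "\<exists>d>0. \<forall>x\<in>\<Omega> \<union> \<Gamma>. dist x p < d \<longrightarrow> dist (DF x \<nu>) (DF p \<nu>) < 1"
    using cD[of \<nu>] pc unfolding continuous_on_iff by (metis zero_less_one)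
  then obtain d0 where d0: "d0 > 0" "\<And>x. x \<in> \<Omega> \<union> \<Gamma> \<Longrightarrow> dist x p < d0 \<Longrightarrow> \<bar>DF x \<nu>\<bar> \<le> M"
    unfolding M_def dist_real_def by (smt (verit, best))
  have key: "\<bar>DF p \<tau>\<bar> \<le> \<eta> * (2 * M + \<bar>DF p \<nu>\<bar>)" if eta: "\<eta> > 0" for \<eta>
  proof -
    define k where "k = \<tau> + \<eta> *\<^sub>R \<nu>"
    define k' where "k' = \<tau> - \<eta> *\<^sub>R \<nu>"
    have gk: "g p \<bullet> k < 0" "g p \<bullet> k' > 0" using tau gnu eta by (simp_all add: k_def k'_def inner_add_right inner_diff_right mult_pos_neg)
    have tk: "((\<lambda>s. p + s *\<^sub>R k) \<longlongrightarrow> p) (at_right 0)" "((\<lambda>s. p + s *\<^sub>R k') \<longlongrightarrow> p) (at_right 0)" by (auto intro!: tendsto_eq_intros)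
    obtain d1 where d1: "d1 > 0" "ball p d1 \<subseteq> V" using jets_open[OF J(1)] J(2) openE by blast
    define d where "d = min d0 d1"
    have dp: "d > 0" using d0 d1 by (simp add: d_def)
    have evd: "\<forall>\<^sub>F s in at_right 0. p + s *\<^sub>R k \<in> ball p d" "\<forall>\<^sub>F s in at_right 0. p + s *\<^sub>R k' \<in> ball p d"
      using topological_tendstoD[OF tk(1), of "ball p d"] topological_tendstoD[OF tk(2), of "ball p d"] dp by auto
    have bound: "\<forall>\<^sub>F s in at_right 0. \<bar>F (p + s *\<^sub>R k)\<bar> \<le> (2 * \<eta> * M) * s"
      using evOm[OF gk(1)] evU[OF gk(2)] evd eventually_at_right_less[of "0::real"]
    proof eventually_elim
      case (elim s)
      define a where "a = p + s *\<^sub>R k"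
      define v where "v = - ((2 * s * \<eta>) *\<^sub>R \<nu>)"
      have a1: "a + 1 *\<^sub>R v = p + s *\<^sub>R k'"
      proof -
        have "(2 * s * \<eta>) *\<^sub>R \<nu> = (s * \<eta> + s * \<eta>) *\<^sub>R \<nu>" by simp
        then have "v = - ((s * \<eta>) *\<^sub>R \<nu> + (s * \<eta>) *\<^sub>R \<nu>)" unfolding v_def scaleR_add_left by simp
        then show ?thesis by (simp add: a_def k_def k'_def scaleR_add_right scaleR_diff_right)
      qed
      have inb: "a + t *\<^sub>R v \<in> ball p d" if "0 \<le> t" "t \<le> 1" for t
      proof -
        have "(1 - t) *\<^sub>R a + t *\<^sub>R (a + 1 *\<^sub>R v) \<in> ball p d"
          using that elim convexD[OF convex_ball, of a p d "a + 1 *\<^sub>R v" "1 - t" t] unfolding a1 by (auto simp: a_def)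
        then show ?thesis by (simp add: algebra_simps)
      qed
      \<comment> \<open>The least element of \<open>T\<close> is the parameter at which the segment first leaves \<open>\<Omega>\<close>.\<close>
      define T where "T = {0..1} \<inter> (\<lambda>t. a + t *\<^sub>R v) -` (- \<Omega>)"
      have "closed T" unfolding T_def
      proof (rule continuous_closed_preimage[OF _ closed_atLeastAtMost])
        show "continuous_on {0..1} (\<lambda>t. a + t *\<^sub>R v)" by (intro continuous_intros)
        show "closed (- \<Omega>)" using oOm by (rule closed_Compl)
      qed
      moreover have "bounded T" by (rule bounded_subset[of "{0..1}"]) (auto simp: T_def)
      ultimately have cT: "compact T" by (simp add: compact_eq_bounded_closed)
      have "1 \<in> T" using elim by (simp add: T_def a1 del: scaleR_one)
      then obtain t where t: "t \<in> T" "\<And>t'. t' \<in> T \<Longrightarrow> t \<le> t'"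
        using compact_attains_inf[OF cT] by auto
      have t01: "0 \<le> t" "t \<le> 1" "a + t *\<^sub>R v \<notin> \<Omega>" using t(1) by (auto simp: T_def)
      have t0: "t > 0"
      proof -
        have "t \<noteq> 0" using t01(3) elim by (auto simp: a_def)
        then show ?thesis using t01 by simp
      qed
      have before: "a + t' *\<^sub>R v \<in> \<Omega>" if "0 \<le> t'" "t' < t" for t'
        using t(2)[of t'] that t01 by (auto simp: T_def)
      have notU: "a + t *\<^sub>R v \<notin> U"
      proof
        assume inU: "a + t *\<^sub>R v \<in> U"
        have "((\<lambda>t'. a + t' *\<^sub>R v) \<longlongrightarrow> a + t *\<^sub>R v) (at_left t)" by (intro tendsto_intros)
        then have "\<forall>\<^sub>F t' in at_left t. a + t' *\<^sub>R v \<in> U" by (rule topological_tendstoD[OF _ oU inU])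
        moreover have "\<forall>\<^sub>F t' in at_left t. a + t' *\<^sub>R v \<in> \<Omega>"
          unfolding eventually_at_left_field using before t0 by (intro exI[of _ 0]) auto
        ultimately have "\<forall>\<^sub>F t' in at_left t. False" by eventually_elim (use disj in auto)
        then show False by simp
      qed
      have "a + t *\<^sub>R v \<in> hspace" using inb[OF t01(1,2)] d1 J(3) by (auto simp: d_def)
      then have inG: "a + t *\<^sub>R v \<in> \<Gamma>" using notU t01(3) cover by auto
      have cl: "a + t' *\<^sub>R v \<in> \<Omega> \<union> \<Gamma>" if "0 \<le> t'" "t' \<le> t" for t'
        using before[OF that(1)] inG that by (cases "t' = t") auto
      have "\<exists>\<xi>\<in>{0<..<t}. F (a + t *\<^sub>R v) - F (a + 0 *\<^sub>R v) = DF (a + \<xi> *\<^sub>R v) v * (t - 0)"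
      proof (rule mvt_real[OF t0])
        show "continuous_on {0..t} (\<lambda>t. F (a + t *\<^sub>R v))"
        proof (rule continuous_on_compose2[OF cF])
          show "continuous_on {0..t} (\<lambda>t. a + t *\<^sub>R v)" by (intro continuous_intros)
          show "(\<lambda>t. a + t *\<^sub>R v) ` {0..t} \<subseteq> \<Omega> \<union> \<Gamma>"
          proof (rule image_subsetI)
            fix x assume "x \<in> {0..t}"
            then show "a + x *\<^sub>R v \<in> \<Omega> \<union> \<Gamma>" using cl[of x] by simp
          qed
        qed
        fix x assume "0 < x" "x < t"
        then show "((\<lambda>t. F (a + t *\<^sub>R v)) has_derivative (*) (DF (a + x *\<^sub>R v) v)) (at x)"
          by (intro lineD before) auto
      qed
      then obtain \<xi> where xi: "0 < \<xi>" "\<xi> < t" "- F a = DF (a + \<xi> *\<^sub>R v) v * t" using F0[OF inG] by auto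
      have xO: "a + \<xi> *\<^sub>R v \<in> \<Omega>" using before xi by auto
      have lin: "linear (DF (a + \<xi> *\<^sub>R v))" using dF[OF xO] by (rule has_derivative_linear)
      have "dist (a + \<xi> *\<^sub>R v) p < d0" using inb[of \<xi>] xi t01 by (simp add: d_def dist_commute)
      then have M: "\<bar>DF (a + \<xi> *\<^sub>R v) \<nu>\<bar> \<le> M" using d0(2) xO by blast
      have "DF (a + \<xi> *\<^sub>R v) v = - (2 * s * \<eta> * DF (a + \<xi> *\<^sub>R v) \<nu>)"
      proof -
        define X where "X = a + \<xi> *\<^sub>R v"
        have v2: "v = (- (2 * s * \<eta>)) *\<^sub>R \<nu>" by (simp add: v_def)
        have "DF X v = (- (2 * s * \<eta>)) *\<^sub>R DF X \<nu>"
          unfolding v2 by (rule linear_scale) (use lin in \<open>simp add: X_def\<close>)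
        then show ?thesis by (simp add: X_def)
      qed
      then have "\<bar>F a\<bar> = (2 * s * \<eta>) * (\<bar>DF (a + \<xi> *\<^sub>R v) \<nu>\<bar> * t)"
        using xi elim eta t0 by (metis (no_types, lifting) abs_minus_cancel abs_mult abs_of_pos mult.assoc mult_pos_pos zero_less_numeral)
      also have "\<dots> \<le> (2 * s * \<eta>) * (M * 1)"
        using M t01 t0 elim eta by (intro mult_left_mono mult_mono) auto
      finally show ?case by (simp add: a_def mult_ac)
    qed
    obtain e where e: "e > 0" "\<And>s. 0 < s \<Longrightarrow> s < e \<Longrightarrow> p + s *\<^sub>R k \<in> \<Omega>"
      using evOm[OF gk(1)] unfolding eventually_at_right_field by auto
    have c: "continuous_on {0..<e} (\<lambda>s. F (p + s *\<^sub>R k))" by (rule line_cont[where e=e and k=k, OF cF p e(2)])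
    have l: "((\<lambda>s. DF (p + s *\<^sub>R k) k) \<longlongrightarrow> DF p k) (at_right 0)" by (rule line_tendsto[where e=e and k=k, OF cD p e])
    have F0': "F (p + 0 *\<^sub>R k) = 0" using F0[OF p] by simp
    have dl: "((\<lambda>s. F (p + s *\<^sub>R k)) has_real_derivative DF (p + s *\<^sub>R k) k) (at s)" if "0 < s" "s < e" for s
      unfolding has_field_derivative_def by (rule lineD) (rule e(2)[OF that])
    have lo: "DF p k \<ge> - (2 * \<eta> * M)"
      by (rule deriv_limit_ge[OF e(1) c dl l F0']) (use bound in \<open>auto elim!: eventually_mono simp: abs_le_iff\<close>)
    have "- DF p k \<ge> - (2 * \<eta> * M)"
    proof (rule deriv_limit_ge[OF e(1) continuous_on_minus[OF c] DERIV_minus[OF dl] tendsto_minus[OF l]])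
      show "\<forall>\<^sub>F s in at_right 0. - (2 * \<eta> * M) * s \<le> - F (p + s *\<^sub>R k)"
        using bound by eventually_elim (simp add: abs_le_iff)
    qed (use F0' in auto)
    with lo have "\<bar>DF p k\<bar> \<le> 2 * \<eta> * M" by (simp add: abs_le_iff)
    moreover have "DF p \<tau> = DF p k - \<eta> * DF p \<nu>"
      by (simp add: k_def linear_add[OF lD] linear_scale[OF lD])
    ultimately have "\<bar>DF p \<tau>\<bar> \<le> 2 * \<eta> * M + \<bar>\<eta> * DF p \<nu>\<bar>" by linarith
    then show ?thesis using eta by (simp add: abs_mult algebra_simps)
  qed
  define Q where "Q = 2 * M + \<bar>DF p \<nu>\<bar>"
  have Q: "Q > 0" by (simp add: Q_def M_def add_pos_nonneg)
  have "\<bar>DF p \<tau>\<bar> \<le> 0 + e" if "e > 0" for e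
    using key[of "e / Q"] that Q by (simp add: Q_def[symmetric])
  then have "\<bar>DF p \<tau>\<bar> \<le> 0" by (rule field_le_epsilon)
  then show ?thesis by simp
qed


text \<open>
  Since \<open>u\<close> vanishes on \<open>\<Gamma>\<close>, its gradient there is normal.
\<close>
lemma gradient_boundary:
  assumes p: "p \<in> \<Gamma>"
    and J: "jets V \<phi> g h" "p \<in> V" "V \<subseteq> hspace"
    and V: "\<And>x. x \<in> V \<Longrightarrow> x \<in> \<Omega> \<longleftrightarrow> \<phi> x < 0" "\<And>x. x \<in> V \<Longrightarrow> x \<in> \<Gamma> \<longleftrightarrow> \<phi> x = 0"
    and g: "g p \<noteq> 0" "G p \<bullet> g p = \<alpha> * (2 * sg p) * norm (g p)"
  shows "G p = (\<alpha> * (2 * sg p) / norm (g p)) *\<^sub>R g p"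
proof -
  define c where "c = \<alpha> * (2 * sg p) / norm (g p)"
  define \<tau> where "\<tau> = G p - c *\<^sub>R g p"
  have ng: "norm (g p) > 0" using g by simp
  have "g p \<bullet> \<tau> = G p \<bullet> g p - c * (norm (g p))\<^sup>2"
    by (simp add: \<tau>_def inner_diff_right inner_commute power2_norm_eq_inner)
  also have "\<dots> = 0" using ng g(2) by (simp add: c_def power2_eq_square)
  finally have t0: "g p \<bullet> \<tau> = 0" .
  have "(\<lambda>x h. G x \<bullet> h) p \<tau> = 0"
  proof (rule tangential_derivative_zero[OF p cu _ _ u0 _ J V g(1) t0, where DF="\<lambda>x h. G x \<bullet> h"])
    show "(u has_derivative (\<lambda>h. G x \<bullet> h)) (at x)" if "x \<in> \<Omega>" for x using jetsD(1)[OF ju that] .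
    show "continuous_on (\<Omega> \<union> \<Gamma>) (\<lambda>x. G x \<bullet> h)" for h by (intro continuous_intros cG)
    show "linear (\<lambda>h. G p \<bullet> h)" by (simp add: bounded_linear.linear bounded_linear_inner_right)
  qed
  then have "\<tau> \<bullet> \<tau> = 0" using t0 by (simp add: \<tau>_def inner_diff_left)
  then show ?thesis by (simp add: \<tau>_def c_def)
qed

lemma norm_gradient_boundary:
  assumes p: "p \<in> \<Gamma>"
  shows "G p \<bullet> G p = (\<alpha> * (2 * sg p))\<^sup>2"
proof -
  obtain V \<phi> g h where *: "jets V \<phi> g h" "p \<in> V" "V \<subseteq> hspace" "\<forall>x\<in>V. x \<in> \<Omega> \<longleftrightarrow> \<phi> x < 0" "\<forall>x\<in>V. x \<in> \<Gamma> \<longleftrightarrow> \<phi> x = 0"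
    "g p \<noteq> 0" "G p \<bullet> g p = \<alpha> * (2 * sg p) * norm (g p)"
    using defining[OF p] by blast
  have "G p = (\<alpha> * (2 * sg p) / norm (g p)) *\<^sub>R g p"
    by (rule gradient_boundary[OF p *(1-3) _ _ *(6,7)]) (use * in auto)
  then have "norm (G p) = \<bar>\<alpha> * (2 * sg p) / norm (g p)\<bar> * norm (g p)" by (metis norm_scaleR)
  then have "norm (G p) = \<bar>\<alpha> * (2 * sg p)\<bar>" using *(6) by (simp add: abs_divide)
  then show ?thesis by (metis power2_abs power2_norm_eq_inner)
qed

text \<open>
  The function \<open>|\<nabla>u|\<^sup>2 - \<alpha>\<^sup>2\<close> (hyperbolic norm, rescaled) vanishes on \<open>\<Gamma>\<close>; its tangential
  derivative determines the mixed second derivatives of \<open>u\<close>. If \<open>\<alpha> = 0\<close> this gives no information,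
  but then each partial derivative of \<open>u\<close> vanishes on \<open>\<Gamma>\<close> and can be used directly.
\<close>
lemma hessian_boundary:
  assumes p: "p \<in> \<Gamma>"
    and J: "jets V \<phi> g h" "p \<in> V" "V \<subseteq> hspace"
    and V: "\<And>x. x \<in> V \<Longrightarrow> x \<in> \<Omega> \<longleftrightarrow> \<phi> x < 0" "\<And>x. x \<in> V \<Longrightarrow> x \<in> \<Gamma> \<longleftrightarrow> \<phi> x = 0"
    and g: "g p \<noteq> 0" "G p \<bullet> g p = \<alpha> * (2 * sg p) * norm (g p)"
    and tau: "g p \<bullet> \<tau> = 0"
  shows "H p \<tau> \<bullet> (- (1 / norm (g p)) *\<^sub>R g p) = 2 * (- \<alpha> * (2 * sg p)) * sg p * (p \<bullet> \<tau>)"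
proof (cases "\<alpha> = 0")
  case True
  have G0: "G x = 0" if "x \<in> \<Gamma>" for x using norm_gradient_boundary[OF that] True by simp
  have "(\<lambda>x h. H x h \<bullet> g p) p \<tau> = 0"
  proof (rule tangential_derivative_zero[OF p _ _ _ _ _ J V g(1) tau, where F="\<lambda>x. G x \<bullet> g p" and DF="\<lambda>x h. H x h \<bullet> g p"])
    show "continuous_on (\<Omega> \<union> \<Gamma>) (\<lambda>x. G x \<bullet> g p)" by (intro continuous_intros cG)
    show "((\<lambda>x. G x \<bullet> g p) has_derivative (\<lambda>h. H x h \<bullet> g p)) (at x)" if "x \<in> \<Omega>" for x
      using has_derivative_inner_left[OF jetsD(2)[OF ju that]] .
    show "continuous_on (\<Omega> \<union> \<Gamma>) (\<lambda>x. H x h \<bullet> g p)" for h by (intro continuous_intros cH)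
    show "linear (\<lambda>h. H p h \<bullet> g p)" using linH[of p]
      by (intro linearI) (simp_all add: linear_add linear_scale inner_add_left)
  qed (use G0 in auto)
  then show ?thesis using True by simp
next
  case False
  have ph: "p \<in> hspace" using p sub_h by auto
  define F where "F x = G x \<bullet> G x - (\<alpha> * (2 * sg x))\<^sup>2" for x
  define DF where "DF x h = 2 * (G x \<bullet> H x h) - 8 * \<alpha>\<^sup>2 * sg x * (2 * (sg x)\<^sup>2 * (x \<bullet> h))" for x h
  have csg: "continuous_on (\<Omega> \<union> \<Gamma>) sg" by (rule continuous_on_subset[OF continuous_on_sg]) (use sub_h in auto)
  have "DF p \<tau> = 0"
  proof (rule tangential_derivative_zero[OF p _ _ _ _ _ J V g(1) tau, where F=F and DF=DF])
    show "continuous_on (\<Omega> \<union> \<Gamma>) F" unfolding F_def by (intro continuous_intros cG csg)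
    show "(F has_derivative DF x) (at x)" if x: "x \<in> \<Omega>" for x
    proof -
      have xh: "x \<in> hspace" using x sub_h by auto
      have "((\<lambda>x. G x \<bullet> G x - (\<alpha> * (2 * sg x)) * (\<alpha> * (2 * sg x))) has_derivative
        (\<lambda>h. (G x \<bullet> H x h + H x h \<bullet> G x) - ((\<alpha> * (2 * sg x)) * (\<alpha> * (2 * ((2 * (sg x)\<^sup>2) *\<^sub>R x \<bullet> h)))
          + (\<alpha> * (2 * ((2 * (sg x)\<^sup>2) *\<^sub>R x \<bullet> h))) * (\<alpha> * (2 * sg x))))) (at x)"
        by (intro has_derivative_diff has_derivative_inner has_derivative_mult has_derivative_mult_right
            jetsD(2)[OF ju x] sg_deriv[OF xh])
      then show ?thesis unfolding F_def[abs_def] power2_eq_square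
        by (rule has_derivative_eq_rhs) (simp add: DF_def fun_eq_iff inner_commute power2_eq_square)
    qed
    show "continuous_on (\<Omega> \<union> \<Gamma>) (\<lambda>x. DF x h)" for h
      unfolding DF_def by (intro continuous_intros cG cH csg)
    show "F x = 0" if "x \<in> \<Gamma>" for x using norm_gradient_boundary[OF that] by (simp add: F_def)
    show "linear (DF p)" unfolding DF_def using linH[of p]
      by (intro linearI) (simp_all add: linear_add linear_scale inner_add_right algebra_simps)
  qed
  then have 1: "G p \<bullet> H p \<tau> = 8 * \<alpha>\<^sup>2 * sg p * (sg p)\<^sup>2 * (p \<bullet> \<tau>)" by (simp add: DF_def)
  define \<nu> where "\<nu> = - (1 / norm (g p)) *\<^sub>R g p"
  have "G p = (- \<alpha> * (2 * sg p)) *\<^sub>R \<nu>"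
    using gradient_boundary[OF p J V g] by (simp add: \<nu>_def)
  then have "(- \<alpha> * (2 * sg p)) * (\<nu> \<bullet> H p \<tau>) = G p \<bullet> H p \<tau>" by (metis inner_scaleR_left)
  also have "\<dots> = (- \<alpha> * (2 * sg p)) * (2 * (- \<alpha> * (2 * sg p)) * sg p * (p \<bullet> \<tau>))"
    unfolding 1 power2_eq_square by (simp only: mult_ac mult_minus_left mult_minus_right minus_minus)
  finally have "(- \<alpha> * (2 * sg p)) * (\<nu> \<bullet> H p \<tau>) = (- \<alpha> * (2 * sg p)) * (2 * (- \<alpha> * (2 * sg p)) * sg p * (p \<bullet> \<tau>))" .
  moreover have "- \<alpha> * (2 * sg p) \<noteq> 0" using False sg_pos[OF ph] by simp
  ultimately have "\<nu> \<bullet> H p \<tau> = 2 * (- \<alpha> * (2 * sg p)) * sg p * (p \<bullet> \<tau>)" using mult_left_cancel by blast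
  then show ?thesis unfolding \<nu>_def[symmetric] by (simp add: inner_commute)
qed

text \<open>
  Everything needed about a boundary point \<open>p\<close> with inner unit normal \<open>\<nu>\<close> of \<open>\<Omega>\<close>: gradient and mixed
  second derivatives of \<open>u\<close>, the ball conditions on both sides, and the fact that a short step
  against a direction \<open>m\<close> close to some \<open>N\<close> with \<open>N \<bullet> \<nu> > 0\<close> does not leave \<open>U\<close>. The
  last property is applied to the steps from points to their mirror images.
\<close>
lemma boundary_data:
  assumes p: "p \<in> \<Gamma>"
  obtains \<nu> M \<delta> where "\<nu> \<bullet> \<nu> = 1" "M > 0" "\<delta> > 0" "ball p \<delta> \<subseteq> hspace"
    "G p = (- \<alpha> * (2 * sg p)) *\<^sub>R \<nu>"
    "\<And>\<tau>. \<tau> \<bullet> \<nu> = 0 \<Longrightarrow> H p \<tau> \<bullet> \<nu> = 2 * (- \<alpha> * (2 * sg p)) * sg p * (p \<bullet> \<tau>)"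
    "\<And>x. x \<in> ball p \<delta> \<Longrightarrow> (x - p) \<bullet> \<nu> > M * ((x - p) \<bullet> (x - p)) \<Longrightarrow> x \<in> \<Omega>"
    "\<And>x. x \<in> ball p \<delta> \<Longrightarrow> - ((x - p) \<bullet> \<nu>) > M * ((x - p) \<bullet> (x - p)) \<Longrightarrow> x \<in> U"
    "\<And>N. N \<bullet> \<nu> > 0 \<Longrightarrow> \<exists>r>0. \<forall>x m c. x \<in> ball p r \<longrightarrow> x - c *\<^sub>R m \<in> ball p r \<longrightarrow> m \<in> ball N r \<longrightarrow> c \<ge> 0 \<longrightarrow> x \<in> U \<longrightarrow> x - c *\<^sub>R m \<in> U"
proof -
  obtain V \<phi> g h where J: "jets V \<phi> g h" "p \<in> V" "V \<subseteq> hspace" and V0: "\<forall>x\<in>V. x \<in> \<Omega> \<longleftrightarrow> \<phi> x < 0" "\<forall>x\<in>V. x \<in> \<Gamma> \<longleftrightarrow> \<phi> x = 0"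
    and g: "g p \<noteq> 0" "G p \<bullet> g p = \<alpha> * (2 * sg p) * norm (g p)"
    using defining[OF p] by blast
  have V: "\<And>x. x \<in> V \<Longrightarrow> x \<in> \<Omega> \<longleftrightarrow> \<phi> x < 0" "\<And>x. x \<in> V \<Longrightarrow> x \<in> \<Gamma> \<longleftrightarrow> \<phi> x = 0" using V0 by auto
  have VU: "x \<in> U \<longleftrightarrow> \<phi> x > 0" if "x \<in> V" for x
    using V[OF that] cover disj J(3) that by (auto simp: not_less)
  define n where "n = norm (g p)"
  have n: "n > 0" using g by (simp add: n_def)
  define \<nu> where "\<nu> = - (1 / n) *\<^sub>R g p"
  have gnu: "g p = - n *\<^sub>R \<nu>" using n by (simp add: \<nu>_def)
  have nu1: "\<nu> \<bullet> \<nu> = 1" using n by (simp add: \<nu>_def n_def norm_eq_sqrt_inner)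
  have phip: "\<phi> p = 0" using V(2)[OF J(2)] p by simp
  obtain \<delta> M where dM: "\<delta> > 0" "M > 0" "ball p \<delta> \<subseteq> V"
    "\<And>x. x \<in> ball p \<delta> \<Longrightarrow> \<bar>\<phi> x - \<phi> p - g p \<bullet> (x - p)\<bar> \<le> M * ((x - p) \<bullet> (x - p))"
    using quadratic_remainder[OF J(1,2)] by blast
  have gx: "g p \<bullet> (x - p) = - (n * ((x - p) \<bullet> \<nu>))" for x unfolding gnu by (simp add: inner_commute)
  show ?thesis
  proof (rule that[of \<nu> "M / n" \<delta>])
    show "\<nu> \<bullet> \<nu> = 1" "M / n > 0" "\<delta> > 0" "ball p \<delta> \<subseteq> hspace" using nu1 dM n J by auto
    show "G p = (- \<alpha> * (2 * sg p)) *\<^sub>R \<nu>"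
      using gradient_boundary[OF p J V g] by (simp add: \<nu>_def n_def)
    show "H p \<tau> \<bullet> \<nu> = 2 * (- \<alpha> * (2 * sg p)) * sg p * (p \<bullet> \<tau>)" if "\<tau> \<bullet> \<nu> = 0" for \<tau>
    proof -
      have "g p \<bullet> \<tau> = 0" unfolding gnu using that by (simp add: inner_commute)
      from hessian_boundary[OF p J V g this] show ?thesis unfolding \<nu>_def n_def .
    qed
    show "x \<in> \<Omega>" if x: "x \<in> ball p \<delta>" "(x - p) \<bullet> \<nu> > M / n * ((x - p) \<bullet> (x - p))" for x
    proof -
      have "M * ((x - p) \<bullet> (x - p)) < n * ((x - p) \<bullet> \<nu>)" using x(2) n by (simp add: field_simps)
      then have "\<phi> x < 0" using dM(4)[OF x(1)] unfolding gx phip by (simp add: abs_le_iff)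
      then show ?thesis using V(1) dM(3) x(1) by blast
    qed
    show "x \<in> U" if x: "x \<in> ball p \<delta>" "- ((x - p) \<bullet> \<nu>) > M / n * ((x - p) \<bullet> (x - p))" for x
    proof -
      have "M * ((x - p) \<bullet> (x - p)) < - (n * ((x - p) \<bullet> \<nu>))" using x(2) n by (simp add: field_simps)
      then have "\<phi> x > 0" using dM(4)[OF x(1)] unfolding gx phip by (simp add: abs_le_iff)
      then show ?thesis using VU dM(3) x(1) by blast
    qed
    show "\<exists>r>0. \<forall>x m c. x \<in> ball p r \<longrightarrow> x - c *\<^sub>R m \<in> ball p r \<longrightarrow> m \<in> ball N r \<longrightarrow> c \<ge> 0 \<longrightarrow> x \<in> U \<longrightarrow> x - c *\<^sub>R m \<in> U"
      if N: "N \<bullet> \<nu> > 0" for N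
    proof -
      have oV: "open V" using jets_open[OF J(1)] .
      define P where "P = (V \<times> UNIV) \<inter> (\<lambda>q. g (fst q) \<bullet> snd q) -` {..<0}"
      have "continuous_on (V \<times> UNIV) (\<lambda>q. g (fst q) \<bullet> snd q)"
        by (intro continuous_intros continuous_on_compose2[OF jets_continuous(2)[OF J(1)]]) auto
      then have "open P" unfolding P_def by (intro continuous_open_preimage) (auto intro: open_Times oV)
      moreover have "(p, N) \<in> P" using J(2) N n by (simp add: P_def gnu inner_commute)
      ultimately obtain X Y where XY: "open X" "open Y" "p \<in> X" "N \<in> Y" "X \<times> Y \<subseteq> P"
        by (metis open_prod_elim mem_Sigma_iff)
      obtain r1 where r1: "r1 > 0" "ball p r1 \<subseteq> X" using XY openE by blast
      obtain r2 where r2: "r2 > 0" "ball N r2 \<subseteq> Y" using XY openE by blast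
      define r where "r = min r1 r2"
      show ?thesis
      proof (intro exI[of _ r] conjI allI impI)
        show "r > 0" using r1 r2 by (simp add: r_def)
        fix x m c assume x: "x \<in> ball p r" "x - c *\<^sub>R m \<in> ball p r" "m \<in> ball N r" "(c::real) \<ge> 0" "x \<in> U"
        define v where "v = - (c *\<^sub>R m)"
        have xv: "x - c *\<^sub>R m = x + 1 *\<^sub>R v" by (simp add: v_def)
        have seg: "(x + t *\<^sub>R v, m) \<in> P" if "0 \<le> t" "t \<le> 1" for t
        proof -
          have "(1 - t) *\<^sub>R x + t *\<^sub>R (x + 1 *\<^sub>R v) \<in> ball p r"
            using that x(1,2) convexD[OF convex_ball, of x p r "x + 1 *\<^sub>R v" "1 - t" t] unfolding xv by auto
          moreover have "(1 - t) *\<^sub>R x + t *\<^sub>R (x + 1 *\<^sub>R v) = x + t *\<^sub>R v" by (simp add: algebra_simps)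
          ultimately have "x + t *\<^sub>R v \<in> ball p r" by simp
          then have "x + t *\<^sub>R v \<in> X" using r1(2) by (auto simp: r_def)
          moreover have "m \<in> Y" using x(3) r2(2) by (auto simp: r_def)
          ultimately show ?thesis using XY(5) by blast
        qed
        have "\<exists>z>0. z < 1 \<and> \<phi> (x + 1 *\<^sub>R v) - \<phi> (x + 0 *\<^sub>R v) = (1 - 0) * (g (x + z *\<^sub>R v) \<bullet> v)"
        proof (rule MVT2)
          fix t :: real assume "0 \<le> t" "t \<le> 1"
          then have "x + t *\<^sub>R v \<in> V" using seg[of t] by (simp add: P_def)
          then show "((\<lambda>t. \<phi> (x + t *\<^sub>R v)) has_real_derivative g (x + t *\<^sub>R v) \<bullet> v) (at t)"
            by (rule jets_line[OF J(1)])
        qed simp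
        then obtain z where z: "0 < z" "z < 1" "\<phi> (x + 1 *\<^sub>R v) - \<phi> x = g (x + z *\<^sub>R v) \<bullet> v" by auto
        have "g (x + z *\<^sub>R v) \<bullet> m < 0" using seg[of z] z by (simp add: P_def)
        then have "- (c * (g (x + z *\<^sub>R v) \<bullet> m)) \<ge> 0" using x(4) by (simp add: mult_nonneg_nonpos)
        then have ge: "\<phi> (x + 1 *\<^sub>R v) \<ge> \<phi> x" using z(3) by (simp add: v_def)
        have xV: "x \<in> V" "x + 1 *\<^sub>R v \<in> V" using seg[of 0] seg[of 1] by (simp_all add: P_def)
        then show "x - c *\<^sub>R m \<in> U" unfolding xv using VU x(5) ge by fastforce
      qed
    qed
  qed
qed

end

lemma eventually_line_ball: "\<delta> > 0 \<Longrightarrow> \<forall>\<^sub>F s in at_right 0. p + s *\<^sub>R k \<in> ball p \<delta>"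
  for p k :: "'a::euclidean_space"
proof -
  assume d: "\<delta> > 0"
  have "((\<lambda>s. p + s *\<^sub>R k) \<longlongrightarrow> p) (at_right 0)" by (auto intro!: tendsto_eq_intros)
  then show ?thesis by (rule topological_tendstoD) (use d in auto)
qed

lemma eventually_quadratic:
  assumes "(a::real) > 0" shows "\<forall>\<^sub>F s in at_right 0. s * a > M * (s * s * c)"
proof -
  have "((\<lambda>s. a - M * (s * c)) \<longlongrightarrow> a) (at_right 0)" by (auto intro!: tendsto_eq_intros)
  then have "\<forall>\<^sub>F s in at_right 0. a - M * (s * c) > 0" using assms by (rule order_tendstoD(1))
  then show ?thesis using eventually_at_right_less[of "0::real"]
  proof eventually_elim
    case (elim s)
    then have "s * (a - M * (s * c)) > 0" by simp
    then show ?case by (simp add: algebra_simps)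
  qed
qed

context exterior
begin

lemma boundary_cones:
  assumes p: "p \<in> \<Gamma>" and \<delta>: "\<delta> > 0"
    and Ob: "\<And>x. x \<in> ball p \<delta> \<Longrightarrow> (x - p) \<bullet> \<nu> > M * ((x - p) \<bullet> (x - p)) \<Longrightarrow> x \<in> \<Omega>"
    and Ib: "\<And>x. x \<in> ball p \<delta> \<Longrightarrow> - ((x - p) \<bullet> \<nu>) > M * ((x - p) \<bullet> (x - p)) \<Longrightarrow> x \<in> U"
  shows "k \<bullet> \<nu> > 0 \<Longrightarrow> \<forall>\<^sub>F s in at_right 0. p + s *\<^sub>R k \<in> \<Omega>"
    "k \<bullet> \<nu> < 0 \<Longrightarrow> \<forall>\<^sub>F s in at_right 0. p + s *\<^sub>R k \<in> U"
proof -
  assume k: "k \<bullet> \<nu> > 0"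
  show "\<forall>\<^sub>F s in at_right 0. p + s *\<^sub>R k \<in> \<Omega>"
    using eventually_quadratic[OF k, of M "k \<bullet> k"] eventually_line_ball[OF \<delta>, of p k]
    by eventually_elim (rule Ob, auto simp: mult.assoc)
next
  assume "k \<bullet> \<nu> < 0"
  then have k: "- (k \<bullet> \<nu>) > 0" by simp
  show "\<forall>\<^sub>F s in at_right 0. p + s *\<^sub>R k \<in> U"
    using eventually_quadratic[OF k, of M "k \<bullet> k"] eventually_line_ball[OF \<delta>, of p k]
    by eventually_elim (rule Ib, auto simp: mult.assoc)
qed

lemma boundary_closure: assumes p: "p \<in> \<Gamma>" shows "p \<in> closure U" "p \<in> closure \<Omega>"
proof -
  obtain \<nu> M \<delta> where b: "\<nu> \<bullet> \<nu> = 1" "\<delta> > 0"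
    "\<And>x. x \<in> ball p \<delta> \<Longrightarrow> (x - p) \<bullet> \<nu> > M * ((x - p) \<bullet> (x - p)) \<Longrightarrow> x \<in> \<Omega>"
    "\<And>x. x \<in> ball p \<delta> \<Longrightarrow> - ((x - p) \<bullet> \<nu>) > M * ((x - p) \<bullet> (x - p)) \<Longrightarrow> x \<in> U"
    using boundary_data[OF p] by metis
  have 1: "\<forall>\<^sub>F s in at_right 0. p + s *\<^sub>R \<nu> \<in> \<Omega>" "\<forall>\<^sub>F s in at_right 0. p + s *\<^sub>R (- \<nu>) \<in> U"
    using boundary_cones(1)[OF p b(2-4), where k=\<nu>] boundary_cones(2)[OF p b(2-4), where k="- \<nu>"] b(1) by auto
  show "p \<in> closure \<Omega>" by (rule ray_in_closure[OF 1(1)])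
  show "p \<in> closure U" by (rule ray_in_closure[OF 1(2)])
qed

end

section \<open>Comparison of a solution with its reflection\<close>

text \<open>
  The hypothesis \<open>cap\<close> says that the hyperplane \<open>lin A = 0\<close> is an admissible position.
\<close>
locale reflected = exterior U \<Omega> \<Gamma> u G H f \<alpha> C L
  for U \<Omega> \<Gamma> :: "'a::euclidean_space set" and u G H f \<alpha> C L +
  fixes A :: "real \<times> 'a"
  assumes A1: "lor A A = 1"
    and cap: "\<And>x. x \<in> U \<Longrightarrow> lin A x > 0 \<Longrightarrow> hrefl A x \<in> U \<union> \<Gamma>"
begin

abbreviation R where "R \<equiv> hrefl A"

definition W where "W = {x \<in> \<Omega>. R x \<in> \<Omega>}"
definition D where "D = {x \<in> \<Omega>. lin A x < 0}"
definition w where "w x = u (R x) - u x"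
text \<open>
  Gradient and Hessian of \<open>w\<close>, by \<open>jw\<close>. They are defined on all of \<open>E\<close>, in particular at the
  boundary points, through the extensions \<open>G\<close> and \<open>H\<close>.
\<close>
definition Gw where "Gw x = drefl A x (G (R x)) - G x"
definition Hw where "Hw x h = (drefl A x (H (R x) (drefl A x h)) + d2refl A x (G (R x)) h) - H x h"

lemma Rh: "x \<in> hspace \<Longrightarrow> R x \<in> hspace" by (rule hrefl_hspace[OF A1])
lemma RR: "x \<in> hspace \<Longrightarrow> R (R x) = x" by (rule hrefl_hrefl[OF A1])
lemma lR: "x \<in> hspace \<Longrightarrow> lin A (R x) = - lin A x" by (rule lin_hrefl[OF A1])
lemma cR: "continuous_on hspace R" by (rule continuous_on_hrefl[OF A1])
lemma Omh: "x \<in> \<Omega> \<Longrightarrow> x \<in> hspace" and Gah: "x \<in> \<Gamma> \<Longrightarrow> x \<in> hspace" and Uh: "x \<in> U \<Longrightarrow> x \<in> hspace"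
  using sub_h by auto

lemma open_pre: assumes "open B" shows "open (hspace \<inter> R -` B)"
  by (rule continuous_open_preimage[OF cR open_hspace assms])

lemma open_W: "open W"
proof -
  have "W = \<Omega> \<inter> (hspace \<inter> R -` \<Omega>)" using Omh by (auto simp: W_def)
  then show ?thesis using open_pre[OF oOm] oOm by auto
qed

lemma open_D: "open D"
proof -
  have "D = \<Omega> \<inter> {x \<in> hspace. lin A x < 0}" using Omh by (auto simp: D_def)
  then show ?thesis using oOm open_lin(1)[of A] by auto
qed

text \<open>
  The points in front of the hyperplane whose mirror image lies in \<open>\<Omega>\<close> form an open set that
  misses \<open>U\<close>, so it also misses \<open>closure U\<close>.
\<close>
lemma RD: assumes "x \<in> D" shows "R x \<in> \<Omega>"
proof -
  have x: "x \<in> \<Omega>" "lin A x < 0" "x \<in> hspace" using assms Omh by (auto simp: D_def)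
  define T where "T = {x \<in> hspace. lin A x > 0} \<inter> (hspace \<inter> R -` \<Omega>)"
  have oT: "open T" unfolding T_def by (intro open_Int open_lin open_pre oOm)
  have "T \<inter> U = {}" using cap disj by (fastforce simp: T_def)
  then have "T \<inter> closure U = {}" using oT by (simp add: open_Int_closure_eq_empty)
  moreover have "U \<union> \<Gamma> \<subseteq> closure U" using boundary_closure(1) closure_subset by auto
  moreover have "R x \<in> T" using x Rh lR RR by (auto simp: T_def)
  ultimately have "R x \<notin> U \<union> \<Gamma>" by auto
  then show ?thesis using Rh[OF x(3)] cover by auto
qed

lemma D_W: "D \<subseteq> W" using RD by (auto simp: W_def D_def)

lemma R_cl: assumes x: "x \<in> \<Omega> \<union> \<Gamma>" "lin A x \<le> 0" shows "R x \<in> \<Omega> \<union> \<Gamma>"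
proof (cases "x \<in> \<Omega> \<and> lin A x < 0")
  case True
  then show ?thesis using RD by (auto simp: D_def)
next
  case False
  have xh: "x \<in> hspace" using x Omh Gah by auto
  show ?thesis
  proof (cases "lin A x = 0")
    case True
    then show ?thesis using hrefl_fix[OF True xh] x by simp
  next
    case lt: False
    then have x': "x \<in> \<Gamma>" "lin A x < 0" using False x by auto
    show ?thesis
    proof (rule ccontr)
      assume "R x \<notin> \<Omega> \<union> \<Gamma>"
      then have "R x \<in> U" using Rh[OF xh] cover by auto
      then have xP: "x \<in> {x \<in> hspace. lin A x < 0} \<inter> (hspace \<inter> R -` U)" using xh x' by auto
      have oP: "open ({x \<in> hspace. lin A x < 0} \<inter> (hspace \<inter> R -` U))" by (intro open_Int open_lin open_pre oU)
      have "({x \<in> hspace. lin A x < 0} \<inter> (hspace \<inter> R -` U)) \<inter> closure \<Omega> \<noteq> {}"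
        using xP boundary_closure(2)[OF x'(1)] by blast
      then have "({x \<in> hspace. lin A x < 0} \<inter> (hspace \<inter> R -` U)) \<inter> \<Omega> \<noteq> {}"
        using open_Int_closure_eq_empty[OF oP] by auto
      then obtain y where y: "y \<in> \<Omega>" "lin A y < 0" "R y \<in> U" by auto
      then have "R y \<in> \<Omega>" using RD by (simp add: D_def)
      then show False using y disj by auto
    qed
  qed
qed

lemma jw: "jets W w Gw Hw"
proof -
  have 1: "jets W (\<lambda>x. u (R x)) (\<lambda>x. drefl A x (G (R x))) (\<lambda>x h. drefl A x (H (R x) (drefl A x h)) + d2refl A x (G (R x)) h)"
    by (rule jets_hrefl[OF ju A1 open_W]) (use Omh in \<open>auto simp: W_def\<close>)
  have 2: "jets W u G H" by (rule jets_subset[OF ju open_W]) (auto simp: W_def)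
  show ?thesis using jets_diff[OF 1 2] unfolding w_def[abs_def] Gw_def[abs_def] Hw_def[abs_def] .
qed

lemma lapl_w: assumes "x \<in> W" shows "lapl x (Gw x) (Hw x) = f (u x) - f (u (R x))"
proof -
  have x: "x \<in> \<Omega>" "R x \<in> \<Omega>" "x \<in> hspace" using assms Omh by (auto simp: W_def)
  have "lapl x (Gw x) (Hw x) = lapl (R x) (G (R x)) (H (R x)) - lapl x (G x) (H x)"
    unfolding Gw_def Hw_def[abs_def] lapl_simps lapl_hrefl[OF linH A1 x(3)] ..
  then show ?thesis using eq x by simp
qed

lemma w_R: "x \<in> hspace \<Longrightarrow> w (R x) = - w x" by (simp add: w_def RR)

lemma norm_R_to_boundary:
  assumes r: "r < 1"
  shows "\<exists>r'<1. \<forall>x\<in>hspace. norm x > r' \<longrightarrow> norm (R x) > r"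
proof -
  define K where "K = R ` cball 0 (max r 0)"
  have sub: "cball 0 (max r 0) \<subseteq> (hspace :: 'a set)" using r by (auto simp: hspace_def)
  have "compact K" unfolding K_def
    by (intro compact_continuous_image continuous_on_subset[OF cR sub] compact_cball)
  moreover have ne: "K \<noteq> {}" by (auto simp: K_def)
  ultimately obtain m where m: "m \<in> K" "\<And>y. y \<in> K \<Longrightarrow> norm y \<le> norm m"
    using continuous_attains_sup[of K norm] by (metis continuous_on_norm_id)
  have "m \<in> hspace" using m(1) sub Rh by (auto simp: K_def)
  then have m1: "norm m < 1" by (simp add: hspace_def)
  show ?thesis
  proof (intro exI[of _ "norm m"] conjI ballI impI m1)
    fix x :: 'a assume x: "x \<in> hspace" "norm x > norm m"
    show "norm (R x) > r"
    proof (rule ccontr)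
      assume "\<not> norm (R x) > r"
      then have "R x \<in> cball 0 (max r 0)" by simp
      then have "R (R x) \<in> K" unfolding K_def by (rule imageI)
      then show False using m(2)[of x] x RR by auto
    qed
  qed
qed

text \<open>
  The closure of \<open>D\<close> within hyperbolic space is contained in \<open>E\<close>.
\<close>
definition E where "E = {x \<in> \<Omega> \<union> \<Gamma>. lin A x \<le> 0}"

lemma E_sub: "E \<subseteq> \<Omega> \<union> \<Gamma>" "E \<subseteq> hspace" using Omh Gah by (auto simp: E_def)

lemma cont_E_R: assumes "continuous_on (\<Omega> \<union> \<Gamma>) F" shows "continuous_on E (\<lambda>x. F (R x))"
  by (rule continuous_on_compose2[OF assms continuous_on_subset[OF cR E_sub(2)]])
     (use R_cl in \<open>auto simp: E_def\<close>)

lemma cont_E_w: "continuous_on E w"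
  unfolding w_def by (intro continuous_on_diff cont_E_R cu continuous_on_subset[OF cu E_sub(1)])

text \<open>
  Where \<open>w < 0\<close>, \<open>f\<close> being non-increasing gives \<open>\<Delta>w = f(u) - f(u \<circ> R) \<le> 0\<close>. The set where
  \<open>w \<le> - \<delta>\<close> is compact in \<open>D\<close>: \<open>w\<close> vanishes on the hyperplane, is \<open>\<ge> 0\<close> on \<open>\<Gamma>\<close>, and tends to \<open>C - C = 0\<close>
  at infinity.
\<close>
lemma w_nonneg: assumes x: "x \<in> D" shows "w x \<ge> 0"
proof (rule max_principle[OF jets_subset[OF jw open_D D_W] _ dim _ _ x])
  show "D \<subseteq> hspace" using Omh by (auto simp: D_def)
  fix y assume y: "y \<in> D" "w y < 0"
  then have "u (R y) \<le> u y" by (simp add: w_def)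
  then have "f (u y) \<le> f (u (R y))" using anti by (simp add: antimono_def)
  then show "lapl y (Gw y) (Hw y) \<le> 0" using lapl_w[of y] y D_W by auto
next
  fix \<delta> :: real assume d: "\<delta> > 0"
  then obtain r1 where r1: "r1 < 1" "\<forall>x\<in>\<Omega>. norm x > r1 \<longrightarrow> \<bar>u x - C\<bar> < \<delta> / 2" using at_inf[of "\<delta>/2"] by auto
  obtain r2 where r2: "r2 < 1" "\<forall>x\<in>hspace. norm x > r2 \<longrightarrow> norm (R x) > r1" using norm_R_to_boundary[OF r1(1)] by auto
  define r where "r = max r1 r2"
  have r: "r < 1" using r1 r2 by (simp add: r_def)
  define Q where "Q = cball 0 r \<inter> {x \<in> hspace. lin A x \<le> 0} - U"
  have QE: "Q \<subseteq> E" using cl_Om by (auto simp: Q_def E_def)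
  have rh: "cball 0 r \<subseteq> (hspace :: 'a set)" using r by (auto simp: hspace_def)
  have "closed (cball 0 r \<inter> lin A -` {..0})"
    by (intro continuous_closed_preimage continuous_on_subset[OF continuous_on_lin rh]) auto
  then have "compact (cball 0 r \<inter> (cball 0 r \<inter> lin A -` {..0}) - U)"
    by (intro compact_diff compact_Int_closed compact_cball oU)
  moreover have "cball 0 r \<inter> (cball 0 r \<inter> lin A -` {..0}) - U = Q" using rh by (auto simp: Q_def)
  ultimately have cQ: "compact Q" by simp
  define K where "K = Q \<inter> (Q \<inter> w -` {..- \<delta>})"
  have "closed (Q \<inter> w -` {..- \<delta>})"
    by (rule continuous_closed_preimage[OF continuous_on_subset[OF cont_E_w QE] compact_imp_closed[OF cQ]]) simp
  then have cK: "compact K" unfolding K_def using cQ by (intro compact_Int_closed)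
  have KD: "K \<subseteq> D"
  proof
    fix x assume "x \<in> K"
    then have x: "x \<in> E" "w x \<le> - \<delta>" using QE by (auto simp: K_def)
    have xh: "x \<in> hspace" using x E_sub by auto
    have "lin A x \<noteq> 0"
    proof
      assume "lin A x = 0"
      then have "w x = 0" using hrefl_fix[OF _ xh] by (simp add: w_def)
      then show False using x d by simp
    qed
    moreover have "x \<notin> \<Gamma>"
    proof
      assume xG: "x \<in> \<Gamma>"
      have "R x \<in> \<Omega> \<union> \<Gamma>" using R_cl x(1) by (auto simp: E_def)
      then have "u (R x) \<ge> 0" using u0 upos by (auto intro: less_imp_le)
      then show False using x d u0[OF xG] by (simp add: w_def)
    qed
    ultimately show "x \<in> D" using x by (auto simp: E_def D_def)
  qed
  have off: "w y > - \<delta>" if y: "y \<in> D - K" for y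
  proof (cases "norm y \<le> r")
    case True
    then have "y \<in> Q" using y Omh disj by (auto simp: Q_def D_def)
    then show ?thesis using y by (auto simp: K_def)
  next
    case False
    have yO: "y \<in> \<Omega>" "R y \<in> \<Omega>" "y \<in> hspace" using y RD Omh by (auto simp: D_def)
    have "\<bar>u y - C\<bar> < \<delta> / 2" using r1(2) yO False by (simp add: r_def)
    moreover have "\<bar>u (R y) - C\<bar> < \<delta> / 2" using r1(2) r2(2) yO False by (simp add: r_def)
    ultimately show ?thesis unfolding w_def abs_less_iff by linarith
  qed
  show "\<exists>K. compact K \<and> K \<subseteq> D \<and> (\<forall>x\<in>D - K. w x > - \<delta>)" using cK KD off by blast
qed

lemma lapl_w_le: assumes "x \<in> D" shows "lapl x (Gw x) (Hw x) \<le> L * w x"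
proof -
  have "lapl x (Gw x) (Hw x) = f (u x) - f (u (R x))" using lapl_w assms D_W by auto
  also have "\<dots> \<le> L * \<bar>u x - u (R x)\<bar>" using lip[of "u x" "u (R x)"] by (simp add: abs_le_iff)
  also have "\<bar>u x - u (R x)\<bar> = w x" using w_nonneg[OF assms] by (simp add: w_def)
  finally show ?thesis .
qed

lemma D_sub_h: "D \<subseteq> hspace" using Omh by (auto simp: D_def)

lemma open_zero: "open {x \<in> D. w x = 0}"
  by (rule strong_max_principle[OF jets_subset[OF jw open_D D_W] D_sub_h dim L0 w_nonneg lapl_w_le])

text \<open>
  The Euclidean ball \<open>(x - y) \<bullet> \<nu> > M |x - y|\<^sup>2\<close> has diameter \<open>1 / M\<close>, so increasing \<open>M\<close> moves it
  into the region where the interior ball condition is valid.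
\<close>
lemma inner_tangent_ball:
  assumes y: "y \<in> \<Gamma>" and \<nu>: "\<nu> \<bullet> \<nu> = 1" and \<delta>: "\<delta> > 0"
    and Ob: "\<And>x. x \<in> ball y \<delta> \<Longrightarrow> (x - y) \<bullet> \<nu> > M * ((x - y) \<bullet> (x - y)) \<Longrightarrow> x \<in> \<Omega>"
  obtains c b where "c \<in> hspace" "b > 0" "cosh_dist c y > 1" "glin (- hyp c) y = - (b *\<^sub>R \<nu>)"
    "\<And>x. x \<in> hspace \<Longrightarrow> cosh_dist c x < cosh_dist c y \<Longrightarrow> x \<in> ball y \<delta> \<inter> \<Omega>"
    "\<And>B. lin B y = 0 \<Longrightarrow> nrm B y \<bullet> \<nu> = 0 \<Longrightarrow> lor B (hyp c) = 0"
proof -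
  define M' where "M' = max M (1 / \<delta>)"
  have d': "1 / \<delta> > 0" "1 / \<delta> \<le> M'" using \<delta> by (simp_all add: M'_def)
  then have M0: "M' > 0" by linarith
  have "1 / M' \<le> \<delta>" using d'(2) M0 \<delta> by (simp add: pos_divide_le_eq mult.commute)
  then have M': "M' > 0" "M' \<ge> M" "1 / M' \<le> \<delta>" using M0 by (simp_all add: M'_def)
  obtain c b where c: "c \<in> hspace" "b > 0" "cosh_dist c y > 1" "glin (- hyp c) y = - (b *\<^sub>R \<nu>)"
    "\<And>x. x \<in> hspace \<Longrightarrow> cosh_dist c x < cosh_dist c y \<Longrightarrow> (x - y) \<bullet> \<nu> > M' * ((x - y) \<bullet> (x - y))"
    "\<And>B. lin B y = 0 \<Longrightarrow> nrm B y \<bullet> \<nu> = 0 \<Longrightarrow> lor B (hyp c) = 0"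
    using tangent_ball[OF Gah[OF y] \<nu>, of M'] by metis
  show ?thesis
  proof (rule that[OF c(1-4) _ c(6)])
    fix x assume x: "x \<in> hspace" "cosh_dist c x < cosh_dist c y"
    note 1 = c(5)[OF x]
    have "norm (x - y) < 1 / M'" by (rule ball_condition_small[OF \<nu> M'(1) 1])
    then have xb: "x \<in> ball y \<delta>" using M'(3) by (simp add: dist_norm norm_minus_commute)
    have "M * ((x - y) \<bullet> (x - y)) \<le> M' * ((x - y) \<bullet> (x - y))" using M'(2) by (intro mult_right_mono) auto
    then have "(x - y) \<bullet> \<nu> > M * ((x - y) \<bullet> (x - y))" using 1 by linarith
    then show "x \<in> ball y \<delta> \<inter> \<Omega>" using Ob[OF xb] xb by blast
  qed
qed

lemma line_E:
  assumes p: "p \<in> E" "p \<in> \<Gamma>" and F: "continuous_on E F" and e: "\<And>s. 0 < s \<Longrightarrow> s < e \<Longrightarrow> p + s *\<^sub>R k \<in> D"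
  shows "continuous_on {0..<e} (\<lambda>s. F (p + s *\<^sub>R k))"
proof (rule continuous_on_compose2[OF F])
  show "continuous_on {0..<e} (\<lambda>s. p + s *\<^sub>R k)" by (intro continuous_intros)
  show "(\<lambda>s. p + s *\<^sub>R k) ` {0..<e} \<subseteq> E"
  proof (rule image_subsetI)
    fix s assume "s \<in> {0..<e}"
    then have "s = 0 \<or> p + s *\<^sub>R k \<in> D" using e[of s] by force
    then show "p + s *\<^sub>R k \<in> E" using p by (auto simp: D_def E_def)
  qed
qed

lemma line_E_tendsto:
  assumes p: "p \<in> E" "p \<in> \<Gamma>" and F: "continuous_on E F" and e: "e > 0" "\<And>s. 0 < s \<Longrightarrow> s < e \<Longrightarrow> p + s *\<^sub>R k \<in> D"
  shows "((\<lambda>s. F (p + s *\<^sub>R k)) \<longlongrightarrow> F p) (at_right 0)"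
proof -
  have "((\<lambda>s. F (p + s *\<^sub>R k)) \<longlongrightarrow> F (p + 0 *\<^sub>R k)) (at 0 within {0..<e})"
    using line_E[where e=e and k=k, OF p F e(2)] e(1) unfolding continuous_on_def
    by (meson atLeastLessThan_iff order_refl)
  moreover have "at_right 0 \<le> at 0 within {0..<e}"
  proof -
    have "at 0 within {0<..<e} = at_right 0" using e(1) by (intro at_within_nhd[of 0 "{..<e}"]) auto
    then show ?thesis by (metis at_le greaterThanLessThan_subseteq_atLeastLessThan_iff order_refl)
  qed
  ultimately show ?thesis by (auto intro: tendsto_mono)
qed

lemma nrm_ne: "x \<in> hspace \<Longrightarrow> nrm A x \<bullet> nrm A x \<noteq> 0"
  using nrm_pos[OF A1] by force

lemma cont_nrm: "continuous_on S (nrm A)" unfolding nrm_def by (intro continuous_intros)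

lemma cont_inv: "continuous_on E (\<lambda>x. 1 / (nrm A x \<bullet> nrm A x))"
  by (intro continuous_intros cont_nrm) (use nrm_ne E_sub in auto)

lemma cont_drefl: assumes "continuous_on E g" shows "continuous_on E (\<lambda>x. drefl A x (g x))"
  unfolding drefl_def by (intro continuous_intros cont_inv cont_nrm assms)

lemma cont_Gw: "continuous_on E Gw"
  unfolding Gw_def[abs_def]
  by (intro continuous_on_diff cont_drefl cont_E_R cG continuous_on_subset[OF cG E_sub(1)])

lemma cont_H2:
  assumes g: "continuous_on E g"
  shows "continuous_on E (\<lambda>x. H (R x) (g x))"
proof -
  have "H (R x) (g x) = (\<Sum>b\<in>Basis. (g x \<bullet> b) *\<^sub>R H (R x) b)" for x
  proof -
    have "H (R x) (g x) = H (R x) (\<Sum>b\<in>Basis. (g x \<bullet> b) *\<^sub>R b)" by (simp add: euclidean_representation)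
    also have "\<dots> = (\<Sum>b\<in>Basis. (g x \<bullet> b) *\<^sub>R H (R x) b)" by (simp add: linear_sum[OF linH] linear_scale[OF linH])
    finally show ?thesis .
  qed
  then show ?thesis using g by (simp add: continuous_intros cont_E_R[OF cH])
qed

lemma cont_Hw: "continuous_on E (\<lambda>x. Hw x h)"
proof -
  have "continuous_on E (\<lambda>x. d2refl A x (G (R x)) h)"
    unfolding d2refl_def Let_def by (intro continuous_intros cont_inv cont_nrm cont_E_R cG)
  then show ?thesis unfolding Hw_def
    by (intro continuous_on_diff continuous_on_add cont_drefl cont_H2 continuous_on_const continuous_on_subset[OF cH E_sub(1)])
qed

lemma line_w:
  assumes "p + s *\<^sub>R k \<in> D"
  shows "((\<lambda>s. w (p + s *\<^sub>R k)) has_real_derivative Gw (p + s *\<^sub>R k) \<bullet> k) (at s)"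
    "((\<lambda>s. Gw (p + s *\<^sub>R k) \<bullet> k) has_real_derivative Hw (p + s *\<^sub>R k) k \<bullet> k) (at s)"
proof -
  have W: "p + s *\<^sub>R k \<in> W" using assms D_W by auto
  show "((\<lambda>s. w (p + s *\<^sub>R k)) has_real_derivative Gw (p + s *\<^sub>R k) \<bullet> k) (at s)"
    by (rule jets_line[OF jw W])
  have 1: "((\<lambda>s. p + s *\<^sub>R k) has_derivative (\<lambda>h. h *\<^sub>R k)) (at s)" by (auto intro!: derivative_eq_intros)
  note d = jetsD(2)[OF jw W]
  have l: "linear (Hw (p + s *\<^sub>R k))" using d by (rule has_derivative_linear)
  show "((\<lambda>s. Gw (p + s *\<^sub>R k) \<bullet> k) has_real_derivative Hw (p + s *\<^sub>R k) k \<bullet> k) (at s)"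
    using has_derivative_inner_left[OF has_derivative_compose[OF 1 d], of k]
    by (simp add: has_field_derivative_def linear_scale[OF l] mult_commute_abs)
qed

text \<open>
  If \<open>w > 0\<close> in \<open>D\<close>, the Hopf lemma makes the inner normal derivative of \<open>w\<close> at \<open>y\<close> positive. But that
  of \<open>u\<close> equals \<open>- \<alpha>\<close> in the hyperbolic metric, and that of \<open>u \<circ> R\<close> is at most the
  norm of the gradient of \<open>u\<close> at the boundary point \<open>R y\<close>, which is \<open>- \<alpha>\<close> as well.
\<close>
lemma touching_interior:
  assumes y: "y \<in> \<Gamma>" "lin A y < 0" "R y \<in> \<Gamma>"
  shows "\<exists>x\<in>D. w x = 0"
proof (rule ccontr)
  assume no: "\<not> (\<exists>x\<in>D. w x = 0)"
  have pos: "w x > 0" if "x \<in> D" for x using w_nonneg[OF that] no that by force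
  have yh: "y \<in> hspace" using Gah y by auto
  obtain \<nu> M \<delta> where b: "\<nu> \<bullet> \<nu> = 1" "\<delta> > 0" "G y = (- \<alpha> * (2 * sg y)) *\<^sub>R \<nu>"
    "\<And>x. x \<in> ball y \<delta> \<Longrightarrow> (x - y) \<bullet> \<nu> > M * ((x - y) \<bullet> (x - y)) \<Longrightarrow> x \<in> \<Omega>"
    using boundary_data[OF y(1)] by metis
  have "y \<in> {x \<in> hspace. lin A x < 0}" using yh y by simp
  then obtain d1 where d1: "d1 > 0" "ball y d1 \<subseteq> {x \<in> hspace. lin A x < 0}" using open_lin(1) openE by blast
  define d where "d = min d1 \<delta>"
  have d: "d > 0" using d1 b by (simp add: d_def)
  obtain c t where c: "c \<in> hspace" "t > 0" "cosh_dist c y > 1" "glin (- hyp c) y = - (t *\<^sub>R \<nu>)"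
    "\<And>x. x \<in> hspace \<Longrightarrow> cosh_dist c x < cosh_dist c y \<Longrightarrow> x \<in> ball y d \<inter> \<Omega>"
  proof (rule inner_tangent_ball[OF y(1) b(1) d, of M])
    show "x \<in> \<Omega>" if "x \<in> ball y d" "(x - y) \<bullet> \<nu> > M * ((x - y) \<bullet> (x - y))" for x
      using b(4)[of x] that by (auto simp: d_def)
  qed metis
  have inD: "x \<in> D" if "x \<in> hspace" "cosh_dist c x < cosh_dist c y" for x
    using c(5)[OF that] d1(2) by (auto simp: d_def D_def)
  have dir: "glin (- hyp c) y \<bullet> \<nu> < 0" using c b(1) by simp
  obtain \<beta> where be: "\<beta> > 0" "\<forall>\<^sub>F s in at_right 0. y + s *\<^sub>R \<nu> \<in> hspace \<and> cosh_dist c (y + s *\<^sub>R \<nu>) < cosh_dist c y \<and> w (y + s *\<^sub>R \<nu>) \<ge> \<beta> * s"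
    using hopf_slope[OF jets_subset[OF jw open_D D_W] D_sub_h dim c(1) L0 _ _ _ yh refl c(3) dir] inD pos lapl_w_le by blast
  then obtain e where e: "e > 0" "\<And>s. 0 < s \<Longrightarrow> s < e \<Longrightarrow> y + s *\<^sub>R \<nu> \<in> D"
    using inD unfolding eventually_at_right_field by blast
  have yE: "y \<in> E" using y by (auto simp: E_def)
  have "Gw y \<bullet> \<nu> \<ge> \<beta>"
  proof (rule deriv_limit_ge[OF e(1)])
    show "continuous_on {0..<e} (\<lambda>s. w (y + s *\<^sub>R \<nu>))" by (rule line_E[where e=e and k=\<nu>, OF yE y(1) cont_E_w e(2)])
    show "((\<lambda>s. w (y + s *\<^sub>R \<nu>)) has_real_derivative Gw (y + s *\<^sub>R \<nu>) \<bullet> \<nu>) (at s)" if "0 < s" "s < e" for s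
      by (rule line_w(1)[OF e(2)[OF that]])
    show "((\<lambda>s. Gw (y + s *\<^sub>R \<nu>) \<bullet> \<nu>) \<longlongrightarrow> Gw y \<bullet> \<nu>) (at_right 0)"
      by (intro tendsto_intros line_E_tendsto[where e=e and k=\<nu>, OF yE y(1) cont_Gw e])
    show "w (y + 0 *\<^sub>R \<nu>) = 0" using u0 y by (simp add: w_def)
    show "\<forall>\<^sub>F s in at_right 0. \<beta> * s \<le> w (y + s *\<^sub>R \<nu>)" using be(2) by eventually_elim simp
  qed
  moreover have "Gw y \<bullet> \<nu> \<le> 0"
  proof -
    define mm where "mm = nrm A y \<bullet> nrm A y"
    have mm: "mm > 0" using nrm_pos[OF A1 yh] by (simp add: mm_def)
    have "(norm (G (R y)))\<^sup>2 = (- \<alpha> * (2 * sg (R y)))\<^sup>2"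
      using norm_gradient_boundary[OF y(3)] by (simp add: power2_norm_eq_inner)
    then have "norm (G (R y)) = - \<alpha> * (2 * sg (R y))"
      by (rule power2_eq_imp_eq) (use al sg_pos[OF Rh[OF yh]] in \<open>auto simp: mult_nonpos_nonneg\<close>)
    also have "\<dots> = - \<alpha> * (2 * sg y) * mm" using sg_hrefl[OF A1 yh] by (simp add: mm_def)
    finally have n: "norm (G (R y)) = - \<alpha> * (2 * sg y) * mm" .
    have "drefl A y (G (R y)) \<bullet> \<nu> \<le> norm (drefl A y (G (R y))) * norm \<nu>"
      using Cauchy_Schwarz_ineq2[of "drefl A y (G (R y))" \<nu>] by linarith
    also have "\<dots> = - \<alpha> * (2 * sg y)"
      using b(1) mm unfolding drefl_norm[OF A1 yh] n mm_def[symmetric] by (simp add: norm_eq_1[symmetric])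
    finally have "drefl A y (G (R y)) \<bullet> \<nu> \<le> - \<alpha> * (2 * sg y)" .
    moreover have "G y \<bullet> \<nu> = - \<alpha> * (2 * sg y)" unfolding b(3) using b(1) by simp
    ultimately show ?thesis by (simp add: Gw_def inner_diff_left)
  qed
  ultimately show False using be(1) by simp
qed

end

context reflected
begin

text \<open>
  At an orthogonal contact point all terms of order at most two of \<open>w\<close> along the direction \<open>\<nu> - N\<close>
  into the corner cancel: the mixed derivatives of \<open>u\<close> contribute \<open>4 * H p N \<bullet> \<nu>\<close>, which is known from
  the Neumann condition, and the curvature of the hyperplane in the ball, seen in \<open>d2refl\<close>, contributes
  exactly the opposite.
\<close>
lemma second_order_cancel:
  assumes p: "p \<in> \<Gamma>" "lin A p = 0" and nu: "\<nu> \<bullet> \<nu> = 1" "nrm A p \<bullet> \<nu> = 0"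
    and G: "G p = (- \<alpha> * (2 * sg p)) *\<^sub>R \<nu>"
    and H: "\<And>\<tau>. \<tau> \<bullet> \<nu> = 0 \<Longrightarrow> H p \<tau> \<bullet> \<nu> = 2 * (- \<alpha> * (2 * sg p)) * sg p * (p \<bullet> \<tau>)"
  shows "Gw p = 0" "Hw p (\<nu> - nrm A p) \<bullet> (\<nu> - nrm A p) = 0"
proof -
  define N where "N = nrm A p"
  define b where "b = - \<alpha> * (2 * sg p)"
  define a where "a = fst A"
  have ph: "p \<in> hspace" using Gah p by auto
  have ell0: "ell A p = 0" using p ph by (simp add: lin_sign)
  have NN: "N \<bullet> N = 1" unfolding N_def nrm_ell[OF A1] ell0 by simp
  have Nnu: "N \<bullet> \<nu> = 0" "\<nu> \<bullet> N = 0" using nu(2) by (simp_all add: N_def inner_commute)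
  have Rp: "R p = p" by (rule hrefl_fix[OF p(2) ph])
  have dr: "drefl A p h = h - (2 * (N \<bullet> h)) *\<^sub>R N" for h
    by (simp add: drefl_def N_def[symmetric] NN)
  have Gb: "G p = b *\<^sub>R \<nu>" using G by (simp add: b_def)
  have NG: "N \<bullet> G p = 0" unfolding Gb using Nnu by simp
  show "Gw p = 0" by (simp add: Gw_def Rp dr NG)
  have pN: "sg p * (p \<bullet> N) = a / 2"
  proof -
    have "2 * (p \<bullet> N) = a * (1 - p \<bullet> p)"
      using ell0 by (simp add: ell_def N_def nrm_def a_def inner_diff_right algebra_simps)
    then have "sg p * (2 * (p \<bullet> N)) = a * (sg p * (1 - p \<bullet> p))" by simp
    then show ?thesis using sg_mult[OF ph] by simp
  qed
  have HN: "H p N \<bullet> \<nu> = b * a"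
  proof -
    have "H p N \<bullet> \<nu> = 2 * b * (sg p * (p \<bullet> N))" using H[OF Nnu(1)] by (simp add: b_def)
    then show ?thesis unfolding pN by simp
  qed
  have Hnu: "H p \<nu> \<bullet> N = b * a" using symH[of p \<nu> N] p HN by simp
  define k where "k = \<nu> - N"
  have drk: "drefl A p k = \<nu> + N"
    unfolding dr k_def using NN Nnu by (simp add: inner_diff_right scaleR_2)
  have Hk: "H p k = H p \<nu> - H p N" "H p (\<nu> + N) = H p \<nu> + H p N"
    by (simp_all add: k_def linear_diff[OF linH] linear_add[OF linH])
  have d2: "d2refl A p (G p) k \<bullet> k = - (4 * a * b)"
  proof -
    have e: "d2refl A p (G p) k = (2 * a) *\<^sub>R ((N \<bullet> k) *\<^sub>R G p + (G p \<bullet> k) *\<^sub>R N)"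
      unfolding d2refl_def Let_def N_def[symmetric] NN NG a_def by simp
    have v: "N \<bullet> k = -1" "G p \<bullet> k = b" unfolding Gb k_def using NN Nnu nu by (simp_all add: inner_diff_right)
    show ?thesis unfolding e inner_scaleR_left inner_add_left v by simp
  qed
  have "drefl A p (H p (drefl A p k)) \<bullet> k = H p (\<nu> + N) \<bullet> (\<nu> + N)"
    unfolding drefl_sym drk ..
  also have "\<dots> - H p k \<bullet> k = 4 * (b * a)"
    unfolding Hk unfolding k_def using HN Hnu by (simp add: inner_add_left inner_add_right inner_diff_left inner_diff_right)
  finally have "drefl A p (H p (drefl A p k)) \<bullet> k - H p k \<bullet> k = 4 * (b * a)" .
  then have "Hw p k \<bullet> k = 0" using d2 by (simp add: Hw_def Rp inner_add_left inner_diff_left mult_ac)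
  then show "Hw p (\<nu> - nrm A p) \<bullet> (\<nu> - nrm A p) = 0" by (simp add: k_def N_def)
qed

text \<open>
  If \<open>w > 0\<close> in \<open>D\<close>, the corner barrier makes \<open>w\<close> grow at least quadratically along the
  ray \<open>p + s (\<nu> - N)\<close>, each of its two factors being at least linear in \<open>s\<close>, against \<open>second_order_cancel\<close>.
\<close>
lemma touching_orthogonal:
  assumes p: "p \<in> \<Gamma>" "lin A p = 0" and nu: "\<nu> \<bullet> \<nu> = 1" "nrm A p \<bullet> \<nu> = 0"
    and G: "G p = (- \<alpha> * (2 * sg p)) *\<^sub>R \<nu>"
    and H: "\<And>\<tau>. \<tau> \<bullet> \<nu> = 0 \<Longrightarrow> H p \<tau> \<bullet> \<nu> = 2 * (- \<alpha> * (2 * sg p)) * sg p * (p \<bullet> \<tau>)"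
    and \<delta>: "\<delta> > 0" and Ob: "\<And>x. x \<in> ball p \<delta> \<Longrightarrow> (x - p) \<bullet> \<nu> > M * ((x - p) \<bullet> (x - p)) \<Longrightarrow> x \<in> \<Omega>"
  shows "\<exists>x\<in>D. w x = 0"
proof (rule ccontr)
  assume no: "\<not> (\<exists>x\<in>D. w x = 0)"
  have pos: "w x > 0" if "x \<in> D" for x using w_nonneg[OF that] no that by force
  have ph: "p \<in> hspace" using Gah p by auto
  define N where "N = nrm A p"
  define k where "k = \<nu> - N"
  have ell0: "ell A p = 0" using p ph by (simp add: lin_sign)
  have NN: "N \<bullet> N = 1" unfolding N_def nrm_ell[OF A1] ell0 by simp
  have Nnu: "N \<bullet> \<nu> = 0" "\<nu> \<bullet> N = 0" using nu(2) by (simp_all add: N_def inner_commute)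
  obtain c t where c: "c \<in> hspace" "t > 0" "cosh_dist c p > 1" "glin (- hyp c) p = - (t *\<^sub>R \<nu>)"
    "\<And>x. x \<in> hspace \<Longrightarrow> cosh_dist c x < cosh_dist c p \<Longrightarrow> x \<in> ball p \<delta> \<inter> \<Omega>"
    "\<And>B. lin B p = 0 \<Longrightarrow> nrm B p \<bullet> \<nu> = 0 \<Longrightarrow> lor B (hyp c) = 0"
  proof (rule inner_tangent_ball[OF p(1) nu(1) \<delta>, of M])
    show "x \<in> \<Omega>" if "x \<in> ball p \<delta>" "(x - p) \<bullet> \<nu> > M * ((x - p) \<bullet> (x - p))" for x
      by (rule Ob[OF that])
  qed metis
  have orth: "lor A (hyp c) = 0" by (rule c(6)[OF p(2) nu(2)])
  have kcc: "cosh_dist c c = 1" by (simp add: cosh_dist_def lor_hyp_self[OF c(1)])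
  have cO: "c \<in> \<Omega>" using c(5)[OF c(1)] kcc c(3) by auto
  have lc: "lin A c = 0" using orth by (simp add: lin_def)
  have cW: "c \<in> W" using cO hrefl_fix[OF lc c(1)] by (simp add: W_def)
  have Wh: "W \<subseteq> hspace" using Omh by (auto simp: W_def)
  have WD: "x \<in> D" if "x \<in> W" "lin A x < 0" for x using that by (auto simp: W_def D_def)
  obtain m B where mB: "m > 0" "open B" "c \<in> B" "\<And>x. x \<in> B \<Longrightarrow> lin A x < 0 \<Longrightarrow> w x \<ge> m * (- lin A x)"
  proof -
    have "\<exists>m>0. \<exists>B. open B \<and> c \<in> B \<and> (\<forall>x\<in>B. lin A x < 0 \<longrightarrow> w x \<ge> m * (- lin A x))"
    proof (rule hopf_at_hyperplane[OF jw Wh dim L0 A1 cW lc])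
      show "w (R x) = - w x" if "x \<in> W" for x using w_R that Wh by auto
      show "0 < w x" if "x \<in> W" "lin A x < 0" for x using pos WD that by auto
      show "lapl x (Gw x) (Hw x) \<le> L * w x" if "x \<in> W" "lin A x < 0" for x using lapl_w_le WD that by auto
    qed
    then show ?thesis using that by blast
  qed
  have subD: "{x \<in> hspace. cosh_dist c x < cosh_dist c p \<and> lin A x < 0} \<subseteq> D" using c(5) by (auto simp: D_def)
  obtain m1 k1 a where m1: "m1 > 0" "k1 < cosh_dist c p" "a > 0"
    "\<And>x. x \<in> hspace \<Longrightarrow> k1 < cosh_dist c x \<Longrightarrow> cosh_dist c x < cosh_dist c p \<Longrightarrow> lin A x < 0 \<Longrightarrow>
       w x \<ge> m1 * (- lin A x * (exp (- a * cosh_dist c x) - exp (- a * cosh_dist c p)))"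
    using corner_barrier[OF jets_subset[OF jw open_D D_W] D_sub_h dim L0 c(1) A1 orth c(3) subD w_nonneg lapl_w_le mB(2,3,1,4)]
    by metis
  have dir: "glin (- hyp c) p \<bullet> k < 0" using c(2,4) nu Nnu by (simp add: k_def inner_diff_right)
  obtain b where b: "b > 0" "\<forall>\<^sub>F s in at_right 0. p + s *\<^sub>R k \<in> hspace \<and> k1 < cosh_dist c (p + s *\<^sub>R k) \<and> cosh_dist c (p + s *\<^sub>R k) \<le> cosh_dist c p - b * s"
    using cosh_dist_decay[OF c(1) ph refl m1(2) dir] by blast
  have ellk: "ell A (p + s *\<^sub>R k) = - (2 * s) - fst A * (s * s * 2)" for s
  proof -
    have "ell A (p + s *\<^sub>R k) = ell A p + 2 * s * (k \<bullet> N) - fst A * (s * s * (k \<bullet> k))"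
      by (simp add: ell_def N_def nrm_def inner_add inner_diff inner_commute algebra_simps)
    moreover have "k \<bullet> N = -1" "k \<bullet> k = 2" using NN Nnu nu by (simp_all add: k_def inner_diff)
    ultimately show ?thesis by (simp add: ell0)
  qed
  have ev1: "\<forall>\<^sub>F s in at_right 0. s * 1 > (- 2 * fst A) * (s * s * (1::real))" by (rule eventually_quadratic) simp
  define q where "q = m1 * (a * exp (- a * cosh_dist c p) * b)"
  have q: "q > 0" using m1 b by (simp add: q_def)
  have ev: "\<forall>\<^sub>F s in at_right 0. p + s *\<^sub>R k \<in> D \<and> w (p + s *\<^sub>R k) \<ge> q * (s * s)"
    using b(2) ev1 eventually_at_right_less[of "0::real"]
  proof eventually_elim
    case (elim s)
    let ?x = "p + s *\<^sub>R k"
    have bs: "b * s > 0" using b(1) elim by simp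
    then have lt: "cosh_dist c ?x < cosh_dist c p" using elim by linarith
    have l1: "- ell A ?x \<ge> s" unfolding ellk using elim by simp
    then have "ell A ?x < 0" using elim by linarith
    then have neg: "lin A ?x < 0" using elim by (simp add: lin_sign)
    have xD: "?x \<in> D" using subD elim lt neg by auto
    have l2: "- lin A ?x \<ge> s"
    proof -
      have "s \<le> 1 * (- ell A ?x)" using l1 by simp
      also have "\<dots> \<le> sg ?x * (- ell A ?x)" using l1 elim sg_ge1[of ?x] by (intro mult_right_mono) auto
      also have "\<dots> = - lin A ?x" using elim lin_ell[of ?x A] by simp
      finally show ?thesis .
    qed
    have "a * exp (- a * cosh_dist c p) * (b * s) \<le> a * exp (- a * cosh_dist c p) * (cosh_dist c p - cosh_dist c ?x)"
      using m1 elim by (intro mult_left_mono) auto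
    also have "\<dots> \<le> exp (- a * cosh_dist c ?x) - exp (- a * cosh_dist c p)"
      using lt m1 by (intro exp_diff_ge) auto
    finally have e1: "a * exp (- a * cosh_dist c p) * (b * s) \<le> exp (- a * cosh_dist c ?x) - exp (- a * cosh_dist c p)" .
    have "q * (s * s) = m1 * (s * (a * exp (- a * cosh_dist c p) * (b * s)))" by (simp add: q_def)
    also have "\<dots> \<le> m1 * (- lin A ?x * (exp (- a * cosh_dist c ?x) - exp (- a * cosh_dist c p)))"
      using m1 l2 e1 elim bs by (intro mult_left_mono mult_mono) auto
    also have "\<dots> \<le> w ?x" using m1(4) elim lt neg by blast
    finally show ?case using xD by blast
  qed
  then obtain e where e: "e > 0" "\<And>s. 0 < s \<Longrightarrow> s < e \<Longrightarrow> p + s *\<^sub>R k \<in> D"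
    unfolding eventually_at_right_field by blast
  have pE: "p \<in> E" using p by (auto simp: E_def)
  note soc = second_order_cancel[OF p nu G H, folded N_def, folded k_def]
  have "Hw p k \<bullet> k \<ge> q"
  proof (rule second_deriv_limit_pos[OF e(1), where h="\<lambda>s. w (p + s *\<^sub>R k)" and h'="\<lambda>s. Gw (p + s *\<^sub>R k) \<bullet> k" and h''="\<lambda>s. Hw (p + s *\<^sub>R k) k \<bullet> k"])
    show "continuous_on {0..<e} (\<lambda>s. w (p + s *\<^sub>R k))" by (rule line_E[where e=e and k=k, OF pE p(1) cont_E_w e(2)])
    show "continuous_on {0..<e} (\<lambda>s. Gw (p + s *\<^sub>R k) \<bullet> k)"
      by (intro continuous_intros line_E[where e=e and k=k, OF pE p(1) cont_Gw e(2)])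
    show "((\<lambda>s. w (p + s *\<^sub>R k)) has_real_derivative Gw (p + s *\<^sub>R k) \<bullet> k) (at s)"
      "((\<lambda>s. Gw (p + s *\<^sub>R k) \<bullet> k) has_real_derivative Hw (p + s *\<^sub>R k) k \<bullet> k) (at s)" if "0 < s" "s < e" for s
      by (rule line_w[OF e(2)[OF that]])+
    show "((\<lambda>s. Hw (p + s *\<^sub>R k) k \<bullet> k) \<longlongrightarrow> Hw p k \<bullet> k) (at_right 0)"
      by (intro tendsto_intros line_E_tendsto[where e=e and k=k, OF pE p(1) cont_Hw e])
    show "w (p + 0 *\<^sub>R k) = 0" using hrefl_fix[OF p(2) ph] by (simp add: w_def)
    show "Gw (p + 0 *\<^sub>R k) \<bullet> k = 0" using soc(1) by simp
    show "\<forall>\<^sub>F s in at_right 0. q * (s * s) \<le> w (p + s *\<^sub>R k)" using ev by eventually_elim simp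
  qed (rule q)
  then show False using soc(2) q by simp
qed

lemma plane_thin:
  assumes B: "open B" "y \<in> B" "B \<subseteq> hspace" "lin A y = 0"
  shows "\<exists>z\<in>B. lin A z < 0"
proof -
  define N where "N = nrm A y"
  have yh: "y \<in> hspace" using B by auto
  have ell0: "ell A y = 0" using B yh by (simp add: lin_sign)
  have NN: "N \<bullet> N = 1" unfolding N_def nrm_ell[OF A1] ell0 by simp
  have e: "ell A (y + s *\<^sub>R - N) = - (2 * s) - fst A * (s * s)" for s
  proof -
    have "ell A (y + s *\<^sub>R - N) = ell A y - 2 * s * (N \<bullet> N) - fst A * (s * s * (N \<bullet> N))"
      by (simp add: ell_def N_def nrm_def inner_add inner_diff inner_commute algebra_simps)
    then show ?thesis by (simp add: ell0 NN)
  qed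
  have "((\<lambda>s. y + s *\<^sub>R - N) \<longlongrightarrow> y) (at_right 0)" by (auto intro!: tendsto_eq_intros)
  then have "\<forall>\<^sub>F s in at_right 0. y + s *\<^sub>R - N \<in> B" using B by (intro topological_tendstoD) auto
  moreover have "\<forall>\<^sub>F s in at_right 0. s * 2 > (- fst A) * (s * s * (1::real))" by (rule eventually_quadratic) simp
  ultimately have "\<forall>\<^sub>F s in at_right 0. y + s *\<^sub>R - N \<in> B \<and> lin A (y + s *\<^sub>R - N) < 0"
  proof eventually_elim
    case (elim s)
    then have "ell A (y + s *\<^sub>R - N) < 0" unfolding e by simp
    then show ?case using elim B(3) lin_sign(1)[of "y + s *\<^sub>R - N" A] by blast
  qed
  then have "\<exists>s. y + s *\<^sub>R - N \<in> B \<and> lin A (y + s *\<^sub>R - N) < 0"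
    by (rule eventually_happens'[OF trivial_limit_at_right_real])
  then show ?thesis by blast
qed

text \<open>
  The set \<open>Y\<close> of points of \<open>\<Omega>\<close> near which \<open>u = u \<circ> R\<close> is open and closed in \<open>\<Omega>\<close>. A limit of points of \<open>Y\<close>
  satisfies \<open>u (R y) = u y > 0\<close>, so \<open>R y\<close> is not on \<open>\<Gamma>\<close>. Off the hyperplane the strong maximum principle
  then applies at \<open>y\<close> or at \<open>R y\<close>. On the hyperplane, half of a neighbourhood is
  connected and meets the zero set of \<open>w\<close>, so \<open>w\<close> vanishes on this half, and on the other by symmetry.
\<close>
lemma symmetric_of_zero:
  assumes z: "\<exists>x\<in>D. w x = 0" and x: "x \<in> \<Omega>"
  shows "R x \<in> \<Omega> \<and> u (R x) = u x"
proof -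
  define Z where "Z = {x \<in> D. w x = 0}"
  have oZ: "open Z" unfolding Z_def by (rule open_zero)
  define Y where "Y = {x \<in> \<Omega>. \<exists>B. open B \<and> x \<in> B \<and> B \<subseteq> \<Omega> \<and> (\<forall>y\<in>B. R y \<in> \<Omega> \<and> u (R y) = u y)}"
  have oY: "open Y"
  proof (rule openI)
    fix y assume "y \<in> Y"
    then obtain B where B: "open B" "y \<in> B" "B \<subseteq> \<Omega>" "\<forall>y\<in>B. R y \<in> \<Omega> \<and> u (R y) = u y" by (auto simp: Y_def)
    then have "B \<subseteq> Y" by (auto simp: Y_def)
    moreover obtain e where "e > 0" "ball y e \<subseteq> B" using B openE by blast
    ultimately show "\<exists>e>0. ball y e \<subseteq> Y" by blast
  qed
  have ZY: "Z \<subseteq> Y"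
  proof
    fix y assume y: "y \<in> Z"
    have "\<forall>y\<in>Z. R y \<in> \<Omega> \<and> u (R y) = u y" using RD by (auto simp: Z_def w_def)
    moreover have "Z \<subseteq> \<Omega>" by (auto simp: Z_def D_def)
    ultimately show "y \<in> Y" using y oZ unfolding Y_def by blast
  qed
  have YD: "y \<in> Z" if "y \<in> Y" "lin A y < 0" for y
    using that by (auto simp: Y_def Z_def D_def w_def)
  have Yuu: "R y \<in> \<Omega>" "u (R y) = u y" "y \<in> \<Omega>" if "y \<in> Y" for y using that by (auto simp: Y_def)
  have YR: "R y \<in> Y" if yY: "y \<in> Y" for y
  proof -
    obtain B where B: "open B" "y \<in> B" "B \<subseteq> \<Omega>" "\<forall>y\<in>B. R y \<in> \<Omega> \<and> u (R y) = u y" using yY by (auto simp: Y_def)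
    have yO: "R y \<in> \<Omega>" "y \<in> hspace" using B Omh by auto
    define B' where "B' = hspace \<inter> R -` B"
    have "open B'" unfolding B'_def by (rule open_pre[OF B(1)])
    moreover have "R y \<in> B'" using Rh[OF yO(2)] RR[OF yO(2)] B by (simp add: B'_def)
    moreover have "B' \<subseteq> \<Omega>"
    proof
      fix v assume "v \<in> B'"
      then have v: "v \<in> hspace" "R v \<in> B" by (auto simp: B'_def)
      then have "R (R v) \<in> \<Omega>" using B by blast
      then show "v \<in> \<Omega>" using RR v by simp
    qed
    moreover have "R v \<in> \<Omega> \<and> u (R v) = u v" if "v \<in> B'" for v
    proof -
      have v: "v \<in> hspace" "R v \<in> B" using that by (auto simp: B'_def)
      then have "u (R (R v)) = u (R v)" "R v \<in> \<Omega>" using B by auto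
      then show ?thesis using RR[OF v(1)] by simp
    qed
    ultimately show ?thesis using yO unfolding Y_def by blast
  qed
  have closed: "y \<in> Y" if y: "y \<in> \<Omega>" "y \<in> closure Y" for y
  proof -
    have yh: "y \<in> hspace" using y Omh by auto
    obtain s where s: "\<And>k. s k \<in> Y" "s \<longlonglongrightarrow> y" using y(2) closure_sequential by metis
    have sR: "(\<lambda>k. R (s k)) \<longlonglongrightarrow> R y"
      by (rule continuous_on_tendsto_compose[OF cR s(2) yh]) (use s(1) Yuu Omh in auto)
    have "R y \<notin> U"
    proof
      assume "R y \<in> U"
      then have "\<forall>\<^sub>F k in sequentially. R (s k) \<in> U" by (rule topological_tendstoD[OF sR oU])
      then have "\<forall>\<^sub>F k in sequentially. False" by eventually_elim (use Yuu s(1) disj in auto)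
      then show False by simp
    qed
    then have Ry: "R y \<in> \<Omega> \<union> \<Gamma>" using Rh[OF yh] cover by auto
    have "(\<lambda>k. u (R (s k))) \<longlonglongrightarrow> u (R y)"
      by (rule continuous_on_tendsto_compose[OF cu sR Ry]) (use s(1) Yuu in auto)
    moreover have "(\<lambda>k. u (s k)) \<longlonglongrightarrow> u y"
      by (rule continuous_on_tendsto_compose[OF cu s(2)]) (use s(1) Yuu y in auto)
    moreover have "(\<lambda>k. u (R (s k))) = (\<lambda>k. u (s k))" using Yuu s(1) by auto
    ultimately have uy: "u (R y) = u y" by (metis LIMSEQ_unique)
    then have RyO: "R y \<in> \<Omega>" using Ry u0 upos[OF y(1)] by fastforce
    consider "lin A y < 0" | "lin A y > 0" | "lin A y = 0" by linarith
    then show ?thesis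
    proof cases
      case 1
      then have "y \<in> Z" using y uy by (simp add: Z_def D_def w_def)
      then show ?thesis using ZY by auto
    next
      case 2
      then have "R y \<in> Z" using RyO uy lR[OF yh] RR[OF yh] by (simp add: Z_def D_def w_def)
      then have "R (R y) \<in> Y" using ZY YR by blast
      then show ?thesis using RR[OF yh] by simp
    next
      case 3
      have yW: "y \<in> W" using y RyO by (simp add: W_def)
      obtain B where B: "open B" "y \<in> B" "B \<subseteq> W \<inter> hspace" "connected (B \<inter> {x \<in> hspace. lin A x < 0})"
        using connected_half_neighbourhood[OF yh open_W yW] by blast
      define B' where "B' = B \<inter> (hspace \<inter> R -` B)"
      have oB': "open B'" unfolding B'_def by (intro open_Int B open_pre)
      have yB': "y \<in> B'" using B(2) yh hrefl_fix[OF 3 yh] by (simp add: B'_def)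
      define Q where "Q = B \<inter> {x \<in> hspace. lin A x < 0}"
      have QD: "Q \<subseteq> D" using B(3) by (auto simp: Q_def W_def D_def)
      have "B' \<inter> closure Y \<noteq> {}" using yB' y by auto
      then have "B' \<inter> Y \<noteq> {}" using open_Int_closure_eq_empty[OF oB'] by auto
      then obtain v where v: "v \<in> B'" "v \<in> Y" by auto
      have "\<exists>z\<in>B' \<inter> Y. lin A z < 0"
      proof -
        have vh: "v \<in> hspace" using v by (simp add: B'_def)
        consider "lin A v < 0" | "lin A v > 0" | "lin A v = 0" by linarith
        then show ?thesis
        proof cases
          case 1 then show ?thesis using v by auto
        next
          case 2
          have "R v \<in> B'" using v(1) Rh[OF vh] RR[OF vh] by (auto simp: B'_def)
          moreover have "R v \<in> Y" by (rule YR[OF v(2)])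
          ultimately show ?thesis using lR[OF vh] 2 by (intro bexI[of _ "R v"]) auto
        next
          case 3
          show ?thesis by (rule plane_thin[OF _ _ _ 3]) (use oB' oY v in \<open>auto simp: B'_def\<close>)
        qed
      qed
      then obtain z where z: "z \<in> B' \<inter> Y" "lin A z < 0" by blast
      have zQ: "z \<in> Q" "z \<in> Z" using z YD by (auto simp: Q_def B'_def)
      have QZ: "Q \<subseteq> Z"
      proof -
        define P where "P = D \<inter> w -` {0<..}"
        have "continuous_on D w" using jets_continuous(1)[OF jw] D_W by (rule continuous_on_subset)
        then have oP: "open P" unfolding P_def by (rule continuous_open_preimage[OF _ open_D]) simp
        have "Q \<subseteq> Z \<union> P"
        proof
          fix v assume "v \<in> Q"
          then have "v \<in> D" using QD by auto
          then show "v \<in> Z \<union> P" using w_nonneg[of v] by (auto simp: Z_def P_def)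
        qed
        moreover have "Z \<inter> P \<inter> Q = {}" by (auto simp: Z_def P_def)
        ultimately have "Z \<inter> Q = {} \<or> P \<inter> Q = {}"
          using connectedD[OF B(4)[folded Q_def] oZ oP] by blast
        then have "P \<inter> Q = {}" using zQ by blast
        then show ?thesis using \<open>Q \<subseteq> Z \<union> P\<close> by blast
      qed
      have sym: "R v \<in> \<Omega> \<and> u (R v) = u v" if "v \<in> B'" for v
      proof -
        have v: "v \<in> B" "R v \<in> B" "v \<in> hspace" using that by (auto simp: B'_def)
        have RvO: "R v \<in> \<Omega>" using B(3) v(1) by (auto simp: W_def)
        consider "lin A v < 0" | "lin A v > 0" | "lin A v = 0" by linarith
        then show ?thesis
        proof cases
          case 1
          then have "v \<in> Z" using QZ v by (auto simp: Q_def)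
          then show ?thesis using RvO by (auto simp: Z_def w_def)
        next
          case 2
          then have "R v \<in> Z" using QZ v Rh[OF v(3)] lR[OF v(3)] by (auto simp: Q_def)
          then show ?thesis using RvO RR[OF v(3)] by (auto simp: Z_def w_def)
        next
          case 3
          then show ?thesis using RvO hrefl_fix[OF 3 v(3)] by simp
        qed
      qed
      have "B' \<subseteq> \<Omega>" using B(3) by (auto simp: B'_def W_def)
      then show ?thesis using oB' yB' sym y unfolding Y_def by blast
    qed
  qed
  have "Y \<inter> (- closure Y) \<inter> \<Omega> = {}" using closure_subset[of Y] by blast
  moreover have "\<Omega> \<subseteq> Y \<union> - closure Y" using closed by blast
  ultimately have "Y \<inter> \<Omega> = {} \<or> (- closure Y) \<inter> \<Omega> = {}"
    using connectedD[OF conOm oY, of "- closure Y"] by auto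
  moreover have "Y \<inter> \<Omega> \<noteq> {}" using z ZY by (auto simp: Z_def D_def)
  ultimately have "\<Omega> \<subseteq> closure Y" by blast
  then have "x \<in> Y" using x closed by blast
  then show ?thesis using Yuu by blast
qed

end

section \<open>The critical hyperplane and the centre\<close>

text \<open>
  The hyperplane orthogonal at distance \<open>t\<close> from \<open>p\<close> to the geodesic through \<open>p\<close> with direction \<open>\<theta>\<close>,
  a unit vector tangent to the hyperboloid at \<open>hyp p\<close>. The side \<open>lin > 0\<close> moves away as \<open>t\<close> grows.
\<close>
definition moving_plane :: "real \<times> 'a::euclidean_space \<Rightarrow> 'a \<Rightarrow> real \<Rightarrow> real \<times> 'a" where
  "moving_plane \<theta> p t = cosh t *\<^sub>R \<theta> + sinh t *\<^sub>R hyp p"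

lemma lor_moving_plane:
  assumes "lor \<theta> \<theta> = 1" "lor \<theta> (hyp p) = 0" "p \<in> hspace"
  shows "lor (moving_plane \<theta> p t) (moving_plane \<theta> p t) = 1"
proof -
  have "lor (moving_plane \<theta> p t) (moving_plane \<theta> p t) = (cosh t)\<^sup>2 - (sinh t)\<^sup>2"
    using assms lor_hyp_self[OF assms(3)]
    by (simp add: moving_plane_def lor_simps lor_commute[of "hyp p" \<theta>] power2_eq_square)
  then show ?thesis by (simp add: cosh_square_eq)
qed

lemma lin_moving_plane: "lin (moving_plane \<theta> p t) x = cosh t * lin \<theta> x - sinh t * cosh_dist p x"
  by (simp add: lin_def moving_plane_def lor_simps cosh_dist_def)

text \<open>
  The Cauchy-Schwarz inequality for the gradients at \<open>p\<close> of \<open>lin \<theta>\<close> and \<open>lin (hyp x)\<close>, whose scalar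
  products are given by \<open>glin_glin\<close>.
\<close>
lemma lin_lt_cosh_dist:
  assumes "lor \<theta> \<theta> = 1" "lor \<theta> (hyp p) = 0" "p \<in> hspace" "x \<in> hspace"
  shows "\<bar>lin \<theta> x\<bar> < cosh_dist p x"
proof -
  define s where "s = 4 * (sg p)\<^sup>2"
  have s: "s > 0" using sg_pos[OF assms(3)] by (simp add: s_def)
  have lp: "lin \<theta> p = 0" using assms(2) by (simp add: lin_def)
  have 1: "glin \<theta> p \<bullet> glin (hyp x) p = s * lin \<theta> x"
    using glin_glin[OF assms(3), of \<theta> "hyp x"] s lp by (simp add: s_def[symmetric] lin_def field_simps)
  have 2: "glin \<theta> p \<bullet> glin \<theta> p = s"
    using glin_glin[OF assms(3), of \<theta> \<theta>] s lp assms(1) by (simp add: s_def[symmetric] field_simps)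
  have 3: "glin (hyp x) p \<bullet> glin (hyp x) p = s * ((cosh_dist p x)\<^sup>2 - 1)"
  proof -
    have "(glin (hyp x) p \<bullet> glin (hyp x) p) / s = (cosh_dist p x)\<^sup>2 - 1"
      unfolding s_def glin_glin[OF assms(3)] using lor_hyp_self[OF assms(4)]
      by (simp add: lin_def cosh_dist_def lor_commute[of "hyp x" "hyp p"] power2_eq_square)
    then show ?thesis using s by (simp add: nonzero_divide_eq_eq mult.commute)
  qed
  have "(glin \<theta> p \<bullet> glin (hyp x) p)\<^sup>2 \<le> (glin \<theta> p \<bullet> glin \<theta> p) * (glin (hyp x) p \<bullet> glin (hyp x) p)"
    by (rule Cauchy_Schwarz_ineq)
  then have "s\<^sup>2 * (lin \<theta> x)\<^sup>2 \<le> s\<^sup>2 * ((cosh_dist p x)\<^sup>2 - 1)"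
    unfolding 1 2 3 by (simp add: power2_eq_square mult_ac)
  then have "(lin \<theta> x)\<^sup>2 \<le> (cosh_dist p x)\<^sup>2 - 1" using s by simp
  then have "\<bar>lin \<theta> x\<bar>\<^sup>2 < (cosh_dist p x)\<^sup>2" by simp
  then show ?thesis by (rule power2_less_imp_less) (use cosh_dist_ge1[OF assms(3,4)] in simp)
qed

lemma moving_plane_far:
  assumes "lor \<theta> \<theta> = 1" "lor \<theta> (hyp p) = 0" "p \<in> hspace" and K: "compact K" "K \<subseteq> hspace"
  shows "\<exists>T. \<forall>t\<ge>T. \<forall>x\<in>K. lin (moving_plane \<theta> p t) x < 0"
proof (cases "K = {}")
  case False
  have c: "continuous_on K (\<lambda>x. cosh_dist p x - lin \<theta> x)" "continuous_on K (\<lambda>x. cosh_dist p x + lin \<theta> x)"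
    by (intro continuous_intros continuous_on_subset[OF continuous_on_cosh_dist K(2)] continuous_on_subset[OF continuous_on_lin K(2)])+
  obtain y where y: "y \<in> K" "\<And>x. x \<in> K \<Longrightarrow> cosh_dist p y - lin \<theta> y \<le> cosh_dist p x - lin \<theta> x"
    using continuous_attains_inf[OF K(1) False c(1)] by blast
  obtain z where z: "z \<in> K" "\<And>x. x \<in> K \<Longrightarrow> cosh_dist p x + lin \<theta> x \<le> cosh_dist p z + lin \<theta> z"
    using continuous_attains_sup[OF K(1) False c(2)] by blast
  define e where "e = cosh_dist p y - lin \<theta> y"
  define B where "B = cosh_dist p z + lin \<theta> z"
  have lt: "\<bar>lin \<theta> x\<bar> < cosh_dist p x" if "x \<in> K" for x using lin_lt_cosh_dist[OF assms(1-3)] that K(2) by auto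
  have e: "e > 0" using lt[OF y(1)] by (simp add: e_def)
  have B: "B > 0" using lt[OF z(1)] by (simp add: B_def)
  \<comment> \<open>In \<open>2 lin = exp (- t) (cosh_dist + lin \<theta>) - exp t (cosh_dist - lin \<theta>)\<close> the second term wins from here on.\<close>
  define T where "T = (ln (B / e) + 1) / 2"
  have "lin (moving_plane \<theta> p t) x < 0" if t: "t \<ge> T" and x: "x \<in> K" for t x
  proof -
    have "ln (B / e) < 2 * t" using t by (simp add: T_def)
    then have "B / e < exp (2 * t)" using e B by (metis divide_pos_pos exp_less_cancel_iff exp_ln)
    then have "B < exp (2 * t) * e" using e by (simp add: field_simps)
    then have "B * exp (- t) < (exp (2 * t) * e) * exp (- t)" by simp
    also have "\<dots> = exp t * e" by (simp add: exp_add[symmetric] mult.commute mult.left_commute)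
    finally have 1: "B * exp (- t) < exp t * e" .
    have "2 * lin (moving_plane \<theta> p t) x = exp (- t) * (cosh_dist p x + lin \<theta> x) - exp t * (cosh_dist p x - lin \<theta> x)"
      by (simp add: lin_moving_plane cosh_def sinh_def algebra_simps add_divide_distrib diff_divide_distrib)
    also have "\<dots> \<le> exp (- t) * B - exp t * e"
      using y(2)[OF x] z(2)[OF x] by (intro diff_mono mult_left_mono) (auto simp: e_def B_def)
    finally show ?thesis using 1 by (simp add: mult.commute)
  qed
  then show ?thesis by blast
qed auto

lemma continuous_moving_plane: "t \<longlonglongrightarrow> t0 \<Longrightarrow> (\<lambda>k. moving_plane \<theta> p (t k)) \<longlonglongrightarrow> moving_plane \<theta> p t0"
  unfolding moving_plane_def by (intro tendsto_intros)

lemma moving_plane_opposite: "lin (moving_plane \<theta> p t) x = - lin (moving_plane (- \<theta>) p (- t)) x"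
  by (simp add: lin_moving_plane) (simp add: lin_def lor_simps)

context exterior
begin

lemma K_sub: "U \<union> \<Gamma> \<subseteq> hspace" using sub_h by auto

text \<open>
  \<open>t0\<close> is the supremum of the parameters for which the reflected cap is not contained in \<open>U\<close>. A limit
  \<open>y\<close> of points of the caps that witness this lies in \<open>closure U\<close> with mirror image outside \<open>U\<close>. In front of the hyperplane this means that both
  lie on \<open>\<Gamma>\<close>, an interior contact. On the hyperplane it means orthogonal contact: the step
  from the witnesses to their mirror images leaves \<open>U\<close>, which excludes \<open>N \<bullet> \<nu> > 0\<close>, and \<open>N \<bullet> \<nu> < 0\<close>
  contradicts the admissibility of the critical position itself.
\<close>
lemma critical_plane:
  assumes p: "p \<in> hspace" and th: "lor \<theta> \<theta> = 1" "lor \<theta> (hyp p) = 0"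
  shows "\<exists>t. \<forall>x\<in>\<Omega>. hrefl (moving_plane \<theta> p t) x \<in> \<Omega> \<and> u (hrefl (moving_plane \<theta> p t) x) = u x"
proof -
  define P where "P t = moving_plane \<theta> p t" for t
  have P1: "lor (P t) (P t) = 1" for t unfolding P_def by (rule lor_moving_plane[OF th p])
  have th': "lor (- \<theta>) (- \<theta>) = 1" "lor (- \<theta>) (hyp p) = 0" using th by (simp_all add: lor_simps)
  obtain T1 where T1: "\<And>t x. t \<ge> T1 \<Longrightarrow> x \<in> U \<union> \<Gamma> \<Longrightarrow> lin (P t) x < 0"
    using moving_plane_far[OF th p cpt K_sub] unfolding P_def by blast
  obtain T2 where T2: "\<And>t x. t \<ge> T2 \<Longrightarrow> x \<in> U \<union> \<Gamma> \<Longrightarrow> lin (moving_plane (- \<theta>) p t) x < 0"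
    using moving_plane_far[OF th' p cpt K_sub] by blast
  have T2': "lin (P t) x > 0" if "t \<le> - T2" "x \<in> U \<union> \<Gamma>" for t x
    using T2[of "- t" x] that unfolding P_def moving_plane_opposite[of \<theta> p t x] by simp
  define bad where "bad = {t. \<exists>x\<in>U. lin (P t) x > 0 \<and> hrefl (P t) x \<notin> U}"
  have bdd: "bdd_above bad"
  proof (rule bdd_aboveI)
    fix t assume "t \<in> bad"
    then obtain x where "x \<in> U" "lin (P t) x > 0" by (auto simp: bad_def)
    then show "t \<le> T1" using T1[of t x] by (cases "t \<ge> T1") auto
  qed
  have ne: "bad \<noteq> {}"
  proof -
    obtain x where x: "x \<in> U" using U_ne by blast
    have xh: "x \<in> hspace" using x sub_h by auto
    have "lin (P (- T2)) x > 0" using T2' x by auto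
    moreover have "hrefl (P (- T2)) x \<notin> U"
    proof
      assume "hrefl (P (- T2)) x \<in> U"
      then have "lin (P (- T2)) (hrefl (P (- T2)) x) > 0" using T2' by auto
      then show False using \<open>lin (P (- T2)) x > 0\<close> lin_hrefl[OF P1 xh] by simp
    qed
    ultimately show ?thesis using x by (auto simp: bad_def)
  qed
  define t0 where "t0 = Sup bad"
  define A where "A = P t0"
  have A1: "lor A A = 1" unfolding A_def by (rule P1)
  have good: "hrefl (P t) x \<in> U" if "t > t0" "x \<in> U" "lin (P t) x > 0" for t x
    using that cSup_upper[OF _ bdd, of t] by (force simp: bad_def t0_def)
  have cap: "hrefl A x \<in> U \<union> \<Gamma>" if x: "x \<in> U" "lin A x > 0" for x
  proof -
    have xh: "x \<in> hspace" using x sub_h by auto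
    define t where "t k = t0 + inverse (real (Suc k))" for k
    have "t \<longlonglongrightarrow> t0 + 0" unfolding t_def by (intro tendsto_intros LIMSEQ_inverse_real_of_nat)
    then have Pt: "(\<lambda>k. P (t k)) \<longlonglongrightarrow> A" unfolding P_def A_def by (intro continuous_moving_plane) simp
    have "(\<lambda>k. lin (P (t k)) x) \<longlonglongrightarrow> lin A x" by (rule lin_tendsto[OF Pt _ xh]) (use xh in auto)
    then have ev: "\<forall>\<^sub>F k in sequentially. lin (P (t k)) x > 0" using x(2) by (rule order_tendstoD(1))
    have lim: "(\<lambda>k. hrefl (P (t k)) x) \<longlonglongrightarrow> hrefl A x"
      by (rule hrefl_cont_joint[OF P1 A1 Pt tendsto_const xh])
    have "\<forall>\<^sub>F k in sequentially. hrefl (P (t k)) x \<in> U \<union> \<Gamma>"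
      using ev by eventually_elim (use good x(1) in \<open>auto simp: t_def\<close>)
    then show ?thesis
      by (rule Lim_in_closed_set[OF compact_imp_closed[OF cpt] _ sequentially_bot lim])
  qed
  interpret rf: reflected U \<Omega> \<Gamma> u G H f \<alpha> C L A
    by unfold_locales (use A1 cap in auto)
  have "\<exists>t x. \<forall>k::nat. t k \<in> bad \<and> t k > t0 - inverse (real (Suc k)) \<and> x k \<in> U \<and> lin (P (t k)) (x k) > 0 \<and> hrefl (P (t k)) (x k) \<notin> U"
  proof -
    have "\<exists>t x. t \<in> bad \<and> t > t0 - inverse (real (Suc k)) \<and> x \<in> U \<and> lin (P t) x > 0 \<and> hrefl (P t) x \<notin> U" for k
    proof -
      have "t0 - inverse (real (Suc k)) < Sup bad" by (simp add: t0_def)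
      then obtain t where "t \<in> bad" "t > t0 - inverse (real (Suc k))" using less_cSup_iff[OF ne bdd] by blast
      then show ?thesis unfolding bad_def by blast
    qed
    then show ?thesis by metis
  qed
  then obtain t x where tx: "\<And>k::nat. t k \<in> bad" "\<And>k. t k > t0 - inverse (real (Suc k))" "\<And>k. x k \<in> U"
    "\<And>k. lin (P (t k)) (x k) > 0" "\<And>k. hrefl (P (t k)) (x k) \<notin> U" by blast
  have tlim: "t \<longlonglongrightarrow> t0"
  proof (rule tendsto_sandwich[of "\<lambda>k. t0 - inverse (real (Suc k))" _ _ "\<lambda>k. t0"])
    have "(\<lambda>k. t0 - inverse (real (Suc k))) \<longlonglongrightarrow> t0 - 0" by (intro tendsto_intros LIMSEQ_inverse_real_of_nat)
    then show "(\<lambda>k. t0 - inverse (real (Suc k))) \<longlonglongrightarrow> t0" by simp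
    show "\<forall>\<^sub>F k in sequentially. t0 - inverse (real (Suc k)) \<le> t k" using tx(2) by (intro always_eventually allI less_imp_le)
    show "\<forall>\<^sub>F k in sequentially. t k \<le> t0" using cSup_upper[OF tx(1) bdd] by (simp add: t0_def)
  qed simp
  have "seq_compact (U \<union> \<Gamma>)" using cpt by (rule compact_imp_seq_compact)
  then obtain y r where yr: "y \<in> U \<union> \<Gamma>" "strict_mono (r :: nat \<Rightarrow> nat)" "(x \<circ> r) \<longlonglongrightarrow> y"
    using seq_compactE[of "U \<union> \<Gamma>" x] tx(3) by blast
  have yh: "y \<in> hspace" using yr K_sub by auto
  define xr where "xr k = x (r k)" for k
  define Ar where "Ar k = P (t (r k))" for k
  have xr: "xr \<longlonglongrightarrow> y" using yr(3) by (simp add: xr_def[abs_def] comp_def)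
  have xrU: "xr k \<in> U" "xr k \<in> hspace" for k using tx(3) sub_h by (auto simp: xr_def)
  have Ar1: "lor (Ar k) (Ar k) = 1" for k unfolding Ar_def by (rule P1)
  have ArA: "Ar \<longlonglongrightarrow> A" unfolding Ar_def[abs_def] P_def A_def
    using LIMSEQ_subseq_LIMSEQ[OF tlim yr(2)] by (intro continuous_moving_plane) (simp add: comp_def)
  have lpos: "lin (Ar k) (xr k) > 0" and Rnot: "hrefl (Ar k) (xr k) \<notin> U" for k
    using tx(4,5) by (auto simp: Ar_def xr_def)
  have "lin A y \<ge> 0"
    by (rule tendsto_lowerbound[OF lin_tendsto[OF ArA xr yh xrU(2)]]) (intro always_eventually allI less_imp_le lpos, simp)
  have Rlim: "(\<lambda>k. hrefl (Ar k) (xr k)) \<longlonglongrightarrow> hrefl A y" by (rule hrefl_cont_joint[OF Ar1 A1 ArA xr yh])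
  have RyU: "hrefl A y \<notin> U"
  proof
    assume "hrefl A y \<in> U"
    then have "\<forall>\<^sub>F k in sequentially. hrefl (Ar k) (xr k) \<in> U" by (rule topological_tendstoD[OF Rlim oU])
    then have "\<forall>\<^sub>F k in sequentially. False" by eventually_elim (use Rnot in auto)
    then show False by simp
  qed
  have "\<exists>x\<in>rf.D. rf.w x = 0"
  proof (cases "lin A y = 0")
    case False
    then have ly: "lin A y > 0" using \<open>lin A y \<ge> 0\<close> by simp
    have lRy: "lin A (hrefl A y) < 0" using rf.lR[OF yh] ly by simp
    have Ryh: "hrefl A y \<in> hspace" by (rule rf.Rh[OF yh])
    have oT1: "open ({x \<in> hspace. lin A x > 0} \<inter> (hspace \<inter> hrefl A -` \<Omega>))"
      by (intro open_Int open_lin rf.open_pre oOm)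
    have "({x \<in> hspace. lin A x > 0} \<inter> (hspace \<inter> hrefl A -` \<Omega>)) \<inter> U = {}" using cap disj by fastforce
    then have "({x \<in> hspace. lin A x > 0} \<inter> (hspace \<inter> hrefl A -` \<Omega>)) \<inter> closure U = {}"
      using oT1 by (simp add: open_Int_closure_eq_empty)
    moreover have "U \<union> \<Gamma> \<subseteq> closure U" using boundary_closure(1) closure_subset by auto
    ultimately have "hrefl A y \<notin> \<Omega>" using yr(1) yh ly by auto
    then have RyG: "hrefl A y \<in> \<Gamma>" using RyU Ryh cover by auto
    have yG: "y \<in> \<Gamma>"
    proof (rule ccontr)
      assume "y \<notin> \<Gamma>"
      then have yU: "y \<in> U" using yr by auto
      have oT: "open ({x \<in> hspace. lin A x < 0} \<inter> (hspace \<inter> hrefl A -` U))"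
        by (intro open_Int open_lin rf.open_pre oU)
      have "hrefl A y \<in> {x \<in> hspace. lin A x < 0} \<inter> (hspace \<inter> hrefl A -` U)"
        using Ryh lRy rf.RR[OF yh] yU by auto
      then have "({x \<in> hspace. lin A x < 0} \<inter> (hspace \<inter> hrefl A -` U)) \<inter> closure \<Omega> \<noteq> {}"
        using boundary_closure(2)[OF RyG] by blast
      then have "({x \<in> hspace. lin A x < 0} \<inter> (hspace \<inter> hrefl A -` U)) \<inter> \<Omega> \<noteq> {}"
        using open_Int_closure_eq_empty[OF oT] by auto
      then obtain z where z: "z \<in> \<Omega>" "lin A z < 0" "hrefl A z \<in> U" by auto
      then have "hrefl A z \<in> \<Omega>" using rf.RD by (simp add: rf.D_def)
      then show False using z disj by auto
    qed
    show ?thesis by (rule rf.touching_interior[OF RyG lRy]) (use rf.RR[OF yh] yG in simp)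
  next
    case True
    have Ry: "hrefl A y = y" by (rule hrefl_fix[OF True yh])
    then have yG: "y \<in> \<Gamma>" using RyU yr(1) by auto
    obtain \<nu> M \<delta> where b: "\<nu> \<bullet> \<nu> = 1" "M > 0" "\<delta> > 0" "ball y \<delta> \<subseteq> hspace" "G y = (- \<alpha> * (2 * sg y)) *\<^sub>R \<nu>"
      "\<And>\<tau>. \<tau> \<bullet> \<nu> = 0 \<Longrightarrow> H y \<tau> \<bullet> \<nu> = 2 * (- \<alpha> * (2 * sg y)) * sg y * (y \<bullet> \<tau>)"
      "\<And>x. x \<in> ball y \<delta> \<Longrightarrow> (x - y) \<bullet> \<nu> > M * ((x - y) \<bullet> (x - y)) \<Longrightarrow> x \<in> \<Omega>"
      "\<And>x. x \<in> ball y \<delta> \<Longrightarrow> - ((x - y) \<bullet> \<nu>) > M * ((x - y) \<bullet> (x - y)) \<Longrightarrow> x \<in> U"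
      "\<And>N. N \<bullet> \<nu> > 0 \<Longrightarrow> \<exists>r>0. \<forall>x m c. x \<in> ball y r \<longrightarrow> x - c *\<^sub>R m \<in> ball y r \<longrightarrow> m \<in> ball N r \<longrightarrow> c \<ge> 0 \<longrightarrow> x \<in> U \<longrightarrow> x - c *\<^sub>R m \<in> U"
      by (rule boundary_data[OF yG]) (rule that)
    define N where "N = nrm A y"
    have ell0: "ell A y = 0" using True yh by (simp add: lin_sign)
    have NN: "N \<bullet> N = 1" unfolding N_def nrm_ell[OF A1] ell0 by simp
    have "\<not> N \<bullet> \<nu> > 0"
    proof
      assume "N \<bullet> \<nu> > 0"
      then obtain e where e: "e > 0" "\<And>x m c. x \<in> ball y e \<Longrightarrow> x - c *\<^sub>R m \<in> ball y e \<Longrightarrow> m \<in> ball N e \<Longrightarrow> c \<ge> 0 \<Longrightarrow> x \<in> U \<Longrightarrow> x - c *\<^sub>R m \<in> U"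
        using b(9) by blast
      have nlim: "(\<lambda>k. nrm (Ar k) (xr k)) \<longlonglongrightarrow> N" unfolding nrm_def N_def by (intro tendsto_intros ArA xr)
      have "\<forall>\<^sub>F k in sequentially. xr k \<in> ball y e" by (rule topological_tendstoD[OF xr]) (use e in auto)
      moreover have "\<forall>\<^sub>F k in sequentially. hrefl (Ar k) (xr k) \<in> ball y e"
        by (rule topological_tendstoD[OF Rlim]) (use e Ry in auto)
      moreover have "\<forall>\<^sub>F k in sequentially. nrm (Ar k) (xr k) \<in> ball N e"
        by (rule topological_tendstoD[OF nlim]) (use e in auto)
      ultimately have "\<forall>\<^sub>F k in sequentially. False"
      proof eventually_elim
        case (elim k)
        define c where "c = ell (Ar k) (xr k) / (nrm (Ar k) (xr k) \<bullet> nrm (Ar k) (xr k))"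
        have h: "hrefl (Ar k) (xr k) = xr k - c *\<^sub>R nrm (Ar k) (xr k)" by (simp add: hrefl_def c_def)
        have "ell (Ar k) (xr k) > 0" using lpos xrU(2) by (simp add: lin_sign[symmetric])
        then have "c \<ge> 0" by (simp add: c_def)
        then have "hrefl (Ar k) (xr k) \<in> U" using e(2)[of "xr k" c "nrm (Ar k) (xr k)"] elim xrU(1) h by simp
        then show False using Rnot by simp
      qed
      then show False by simp
    qed
    moreover have "\<not> N \<bullet> \<nu> < 0"
    proof
      assume neg: "N \<bullet> \<nu> < 0"
      define a where "a = fst A"
      \<comment> \<open>The point \<open>y - s N\<close> of \<open>\<Omega>\<close> is reflected to \<open>y + \<rho>(s) N\<close>, which lies in \<open>U\<close>.\<close>
      define \<rho> where "\<rho> s = s / (1 + a * s)" for s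
      have rl: "(\<rho> \<longlongrightarrow> 0) (at_right 0)" unfolding \<rho>_def by (auto intro!: tendsto_eq_intros)
      have al: "((\<lambda>s. 1 + a * s) \<longlongrightarrow> 1) (at_right 0)" by (auto intro!: tendsto_eq_intros)
      have e1: "\<forall>\<^sub>F s in at_right 0. 1 + a * s > 0" by (rule order_tendstoD(1)[OF al]) simp
      have "((\<lambda>s. - (N \<bullet> \<nu>) - M * \<rho> s) \<longlongrightarrow> - (N \<bullet> \<nu>) - M * 0) (at_right 0)" by (intro tendsto_intros rl)
      then have e2: "\<forall>\<^sub>F s in at_right 0. - (N \<bullet> \<nu>) - M * \<rho> s > 0" by (rule order_tendstoD(1)) (use neg in simp)
      have "((\<lambda>s. y + \<rho> s *\<^sub>R N) \<longlongrightarrow> y + 0 *\<^sub>R N) (at_right 0)" by (intro tendsto_intros rl)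
      then have e3: "\<forall>\<^sub>F s in at_right 0. y + \<rho> s *\<^sub>R N \<in> ball y \<delta>"
        by (rule topological_tendstoD) (use b(3) in auto)
      have e4: "\<forall>\<^sub>F s in at_right 0. y + s *\<^sub>R - N \<in> \<Omega>"
        by (rule boundary_cones(1)[OF yG b(3) b(7) b(8)]) (use neg in auto)
      have e5: "\<forall>\<^sub>F s in at_right 0. s * 2 > (- a) * (s * s * (1::real))" by (rule eventually_quadratic) simp
      have "\<forall>\<^sub>F s in at_right (0::real). False"
        using e1 e2 e3 e4 e5 eventually_at_right_less[of "0::real"]
      proof eventually_elim
        case (elim s)
        define z where "z = y + s *\<^sub>R - N"
        have zO: "z \<in> \<Omega>" "z \<in> hspace" using elim sub_h by (auto simp: z_def)
        have ez: "ell A z = - (2 * s) - a * (s * s)"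
        proof -
          have "ell A z = ell A y - 2 * s * (N \<bullet> N) - fst A * (s * s * (N \<bullet> N))"
            by (simp add: z_def ell_def N_def nrm_def inner_add inner_diff inner_commute algebra_simps)
          then show ?thesis by (simp add: ell0 NN a_def)
        qed
        have "lin A z < 0" using ez elim zO by (simp add: lin_sign)
        then have RzO: "hrefl A z \<in> \<Omega>" using rf.RD zO by (simp add: rf.D_def)
        define q where "q = 1 + a * s"
        have q: "q > 0" using elim by (simp add: q_def)
        have nz: "nrm A z = q *\<^sub>R N" by (simp add: z_def nrm_def N_def q_def a_def algebra_simps)
        have "hrefl A z = z - (ell A z / (q * q)) *\<^sub>R (q *\<^sub>R N)" by (simp add: hrefl_def nz NN)
        also have "\<dots> = y + (- s - ell A z / q) *\<^sub>R N" using q by (simp add: z_def algebra_simps)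
        also have "- s - ell A z / q = \<rho> s"
        proof -
          have "- s - ell A z / q = (- (s * q) - ell A z) / q" using q by (simp add: field_simps)
          also have "- (s * q) - ell A z = s" by (simp add: ez q_def algebra_simps)
          finally show ?thesis by (simp add: \<rho>_def q_def)
        qed
        finally have Rz: "hrefl A z = y + \<rho> s *\<^sub>R N" .
        have rp: "\<rho> s > 0" using q elim by (simp add: \<rho>_def q_def)
        have "\<rho> s * (- (N \<bullet> \<nu>) - M * \<rho> s) > 0" using rp elim by simp
        then have "- ((hrefl A z - y) \<bullet> \<nu>) > M * ((hrefl A z - y) \<bullet> (hrefl A z - y))"
          unfolding Rz using NN by (simp add: algebra_simps)
        then have "hrefl A z \<in> U" using b(8)[of "hrefl A z"] elim Rz by simp
        then show False using RzO disj by auto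
      qed
      then show False by simp
    qed
    ultimately have "nrm A y \<bullet> \<nu> = 0" by (simp add: N_def)
    then show ?thesis by (rule rf.touching_orthogonal[OF yG True b(1) _ b(5) b(6) b(3) b(7)])
  qed
  then have "\<forall>x\<in>\<Omega>. hrefl A x \<in> \<Omega> \<and> u (hrefl A x) = u x" using rf.symmetric_of_zero by blast
  then show ?thesis unfolding A_def P_def by blast
qed

text \<open>
  Existence of a smallest geodesic ball containing \<open>closure U\<close>. The pairs of centre and hyperbolic cosine of
  the radius of the balls containing it form a closed set once the inequality is written without denominators, and
  centres of norm \<open>1\<close> are excluded automatically.
\<close>
lemma circumcenter:
  "\<exists>p k. p \<in> hspace \<and> (\<forall>q\<in>U \<union> \<Gamma>. cosh_dist p q \<le> k) \<and>
    (\<forall>p'\<in>hspace. \<forall>k'. (\<forall>q\<in>U \<union> \<Gamma>. cosh_dist p' q \<le> k') \<longrightarrow> k \<le> k')"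
proof -
  define K where "K = U \<union> \<Gamma>"
  have Kne: "K \<noteq> {}" using U_ne by (auto simp: K_def)
  have Kh: "K \<subseteq> hspace" using K_sub by (simp add: K_def)
  have z: "(0::'a) \<in> hspace" by (simp add: hspace_def)
  have cK: "compact K" using cpt by (simp add: K_def)
  obtain q0 where q0: "q0 \<in> K" "\<And>q. q \<in> K \<Longrightarrow> cosh_dist 0 q \<le> cosh_dist 0 q0"
    using continuous_attains_sup[OF cK Kne continuous_on_subset[OF continuous_on_cosh_dist Kh]] by blast
  define k1 where "k1 = cosh_dist 0 q0"
  define F where "F q = {x::'a \<times> real. 2 * ((fst x - q) \<bullet> (fst x - q)) * sg q \<le> (snd x - 1) * (1 - fst x \<bullet> fst x)}" for q
  define T where "T = (cball 0 1 \<times> {1..k1}) \<inter> (\<Inter>q\<in>K. F q)"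
  have "closed (F q)" for q unfolding F_def by (intro closed_Collect_le continuous_intros)
  then have cT: "compact T" unfolding T_def
    by (intro compact_Int_closed compact_Times compact_cball compact_Icc closed_INT ballI) auto
  have Th: "p \<in> hspace" if "(p, k) \<in> T" for p k
  proof (rule ccontr)
    assume "p \<notin> hspace"
    then have np: "norm p = 1" using that by (simp add: T_def hspace_def)
    then have "p \<bullet> p = 1" by (simp add: norm_eq_1)
    then have "2 * ((p - q0) \<bullet> (p - q0)) * sg q0 \<le> 0" using that q0(1) by (auto simp: T_def F_def)
    then have "(p - q0) \<bullet> (p - q0) \<le> 0" using sg_pos[of q0] q0(1) Kh by (auto simp: mult_le_0_iff)
    then have "p = q0" using inner_ge_zero[of "p - q0"] by (metis antisym inner_eq_zero_iff right_minus_eq)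
    then show False using q0(1) Kh np by (auto simp: hspace_def)
  qed
  have Fiff: "(p, k) \<in> F q \<longleftrightarrow> cosh_dist p q \<le> k" if "p \<in> hspace" "q \<in> K" for p q k
  proof -
    have q: "q \<in> hspace" using that Kh by auto
    have s: "sg p > 0" "1 - p \<bullet> p > 0" using sg_pos[OF that(1)] hspace_pos[OF that(1)] by auto
    have "sg p = 1 / (1 - p \<bullet> p)" by (simp add: sg_def)
    then have "cosh_dist p q = 1 + 2 * ((p - q) \<bullet> (p - q)) * sg q / (1 - p \<bullet> p)"
      unfolding cosh_dist_eq[OF that(1) q] by (simp add: inner_diff inner_commute)
    then have "cosh_dist p q \<le> k \<longleftrightarrow> 2 * ((p - q) \<bullet> (p - q)) * sg q / (1 - p \<bullet> p) \<le> k - 1" by linarith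
    also have "\<dots> \<longleftrightarrow> 2 * ((p - q) \<bullet> (p - q)) * sg q \<le> (k - 1) * (1 - p \<bullet> p)" using s by (simp only: pos_divide_le_eq)
    finally show ?thesis by (simp add: F_def)
  qed
  have "k1 \<ge> 1" unfolding k1_def using cosh_dist_ge1[OF z] q0(1) Kh by auto
  then have T0: "(0, k1) \<in> T" using Fiff[OF z] q0(2) by (auto simp: T_def k1_def)
  have "continuous_on T snd" by (intro continuous_intros)
  then obtain x where x: "x \<in> T" "\<And>y. y \<in> T \<Longrightarrow> snd x \<le> snd y"
    using continuous_attains_inf[OF cT] T0 by blast
  obtain p k where pk: "x = (p, k)" by (cases x)
  have ph: "p \<in> hspace" using Th x pk by auto
  show ?thesis
  proof (intro exI[of _ p] exI[of _ k] conjI ballI allI impI ph)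
    show "cosh_dist p q \<le> k" if "q \<in> U \<union> \<Gamma>" for q
      using Fiff[OF ph, of q k] x(1) that unfolding pk T_def K_def by auto
    fix p' k' assume p': "p' \<in> hspace" "\<forall>q\<in>U \<union> \<Gamma>. cosh_dist p' q \<le> k'"
    show "k \<le> k'"
    proof (cases "k' \<le> k1")
      case True
      have "k' \<ge> 1" using p'(2) cosh_dist_ge1[OF p'(1), of q0] q0(1) Kh by (force simp: K_def)
      then have "(p', k') \<in> T" using True p' Fiff[OF p'(1)] by (auto simp: T_def K_def hspace_def)
      then show ?thesis using x(2) pk by auto
    next
      case False
      then show ?thesis using x(2)[OF T0] pk by simp
    qed
  qed
qed

text \<open>
  If \<open>p\<close> were off the hyperplane, its orthogonal projection to it, which is the midpoint of \<open>p\<close> and its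
  mirror image, would be the centre of a smaller ball: the Lorentz product with the midpoint is the mean of
  the two products divided by \<open>d > 1\<close>.
\<close>
lemma symmetry_through_center:
  assumes p: "p \<in> hspace" and k: "\<And>q. q \<in> U \<union> \<Gamma> \<Longrightarrow> cosh_dist p q \<le> k"
    and min: "\<And>p' k'. p' \<in> hspace \<Longrightarrow> (\<And>q. q \<in> U \<union> \<Gamma> \<Longrightarrow> cosh_dist p' q \<le> k') \<Longrightarrow> k \<le> k'"
    and A1: "lor A A = 1" and sym: "\<And>q. q \<in> U \<union> \<Gamma> \<Longrightarrow> hrefl A q \<in> U \<union> \<Gamma>"
  shows "lin A p = 0"
proof (rule ccontr)
  define l where "l = lin A p"
  assume "lin A p \<noteq> 0"
  then have l: "l \<noteq> 0" by (simp add: l_def)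
  define d where "d = sqrt (1 + l\<^sup>2)"
  have d2: "d\<^sup>2 = 1 + l\<^sup>2" by (simp add: d_def)
  have d1: "d > 1" unfolding d_def using l by simp
  \<comment> \<open>The projection of \<open>hyp p\<close> to the hyperplane, normalised to lie on the hyperboloid.\<close>
  define Y where "Y = (1 / d) *\<^sub>R (hyp p - l *\<^sub>R A)"
  have Ap: "lor A (hyp p) = l" "lor (hyp p) A = l" by (simp_all add: l_def lin_def lor_commute)
  have "lor Y Y = (- 1 - l\<^sup>2) / d\<^sup>2"
    unfolding Y_def using Ap A1 lor_hyp_self[OF p]
    by (simp add: lor_simps power2_eq_square diff_divide_distrib)
  also have "\<dots> = -1" using d2 d1 by (simp add: d2[symmetric] field_simps)
  finally have YY: "lor Y Y = -1" .
  have hr: "hyp (hrefl A p) = hyp p - (2 * l) *\<^sub>R A" using hyp_hrefl[OF A1 p] by (simp add: l_def)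
  have "fst (hyp p) > 0" "fst (hyp (hrefl A p)) > 0" using hyp_fst_pos p hrefl_hspace[OF A1 p] by auto
  then have "fst (hyp p - l *\<^sub>R A) > 0" unfolding hr by simp
  then have fY: "fst Y > 0" using d1 by (simp add: Y_def)
  define p' where "p' = chart Y"
  have p': "p' \<in> hspace" "hyp p' = Y" using hyp_chart[OF YY fY] by (simp_all add: p'_def)
  have "cosh_dist p' q \<le> k / d" if q: "q \<in> U \<union> \<Gamma>" for q
  proof -
    have qh: "q \<in> hspace" using q K_sub by auto
    have "lor (hyp p) (hyp (hrefl A q)) = lor (hyp p) (hyp q) - 2 * lin A q * l"
      unfolding hyp_hrefl[OF A1 qh] by (simp add: lor_simps Ap)
    then have "cosh_dist p q + cosh_dist p (hrefl A q) = 2 * (cosh_dist p q + lin A q * l)" by (simp add: cosh_dist_def)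
    also have "cosh_dist p q + lin A q * l = d * cosh_dist p' q"
      using d1 by (simp add: cosh_dist_def p'(2) Y_def lor_simps lin_def)
    finally have "2 * (d * cosh_dist p' q) \<le> 2 * k" using k[OF q] k[OF sym[OF q]] by linarith
    then show ?thesis using d1 by (simp add: field_simps)
  qed
  then have "k \<le> k / d" by (rule min[OF p'(1)])
  moreover have "k \<ge> 1"
  proof -
    obtain q where q: "q \<in> U" using U_ne by blast
    then show ?thesis using k[of q] cosh_dist_ge1[OF p, of q] sub_h by auto
  qed
  ultimately show False using d1 by (simp add: field_simps)
qed

text \<open>
  Reflections through the circumcentre act transitively on each sphere about it. Hence the connected set of
  radii of \<open>\<Omega>\<close> misses every radius of \<open>U\<close>; being unbounded, it lies above all of them.
\<close>
lemma ball_and_radial: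
  "\<exists>p k. p \<in> hspace \<and> k > 1 \<and> U = {x \<in> hspace. cosh_dist p x < k} \<and>
    (\<forall>x\<in>\<Omega>. \<forall>y\<in>hspace. cosh_dist p x = cosh_dist p y \<longrightarrow> y \<in> \<Omega> \<and> u y = u x)"
proof -
  obtain p k where pk: "p \<in> hspace \<and> (\<forall>q\<in>U \<union> \<Gamma>. cosh_dist p q \<le> k) \<and>
    (\<forall>p'\<in>hspace. \<forall>k'. (\<forall>q\<in>U \<union> \<Gamma>. cosh_dist p' q \<le> k') \<longrightarrow> k \<le> k')"
    using circumcenter by (elim exE)
  have p: "p \<in> hspace" using pk by simp
  have k: "cosh_dist p q \<le> k" if "q \<in> U \<union> \<Gamma>" for q using pk that by simp
  have min: "k \<le> k'" if "p' \<in> hspace" "\<And>q. q \<in> U \<union> \<Gamma> \<Longrightarrow> cosh_dist p' q \<le> k'" for p' k'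
    using bspec[OF conjunct2[OF conjunct2[OF pk]] that(1)] that(2) by simp
  have all: "\<forall>x\<in>\<Omega>. hrefl \<theta> x \<in> \<Omega> \<and> u (hrefl \<theta> x) = u x" if th: "lor \<theta> \<theta> = 1" "lor \<theta> (hyp p) = 0" for \<theta>
  proof -
    obtain t where t: "\<forall>x\<in>\<Omega>. hrefl (moving_plane \<theta> p t) x \<in> \<Omega> \<and> u (hrefl (moving_plane \<theta> p t) x) = u x"
      using critical_plane[OF p th] by blast
    define A where "A = moving_plane \<theta> p t"
    have A1: "lor A A = 1" unfolding A_def by (rule lor_moving_plane[OF th p])
    have inv: "hrefl A q \<in> U \<union> \<Gamma>" if q: "q \<in> U \<union> \<Gamma>" for q
    proof (rule ccontr)
      assume n: "hrefl A q \<notin> U \<union> \<Gamma>"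
      have qh: "q \<in> hspace" using q K_sub by auto
      then have "hrefl A q \<in> \<Omega>" using n hrefl_hspace[OF A1 qh] cover by auto
      then have "hrefl A (hrefl A q) \<in> \<Omega>" using t by (simp add: A_def)
      then have "q \<in> \<Omega>" using hrefl_hrefl[OF A1 qh] by simp
      then show False using q disj by auto
    qed
    have "lin A p = 0" by (rule symmetry_through_center[OF p k min A1 inv])
    moreover have "lin A p = - sinh t" unfolding A_def lin_moving_plane using th(2) lor_hyp_self[OF p] by (simp add: lin_def cosh_dist_def)
    ultimately have "t = 0" by simp
    then have "moving_plane \<theta> p t = \<theta>" by (simp add: moving_plane_def)
    then show ?thesis using t by simp
  qed
  have trans: "\<exists>\<theta>. lor \<theta> \<theta> = 1 \<and> lor \<theta> (hyp p) = 0 \<and> hrefl \<theta> x = y"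
    if xy: "x \<in> hspace" "y \<in> hspace" "cosh_dist p x = cosh_dist p y" "x \<noteq> y" for x y
  proof -
    define c where "c = - 2 - 2 * lor (hyp x) (hyp y)"
    have c: "c > 0" using lor_hyp_lt[OF xy(1,2,4)] by (simp add: c_def)
    define r where "r = sqrt c"
    have r: "r > 0" "r * r = c" using c by (simp_all add: r_def)
    \<comment> \<open>The normal of the hyperplane bisecting \<open>x\<close> and \<open>y\<close>.\<close>
    define \<theta> where "\<theta> = (1 / r) *\<^sub>R (hyp x - hyp y)"
    have "lor (hyp x - hyp y) (hyp x - hyp y) = c"
      using lor_hyp_self[OF xy(1)] lor_hyp_self[OF xy(2)] by (simp add: lor_simps c_def lor_commute[of "hyp y" "hyp x"])
    then have t1: "lor \<theta> \<theta> = 1" using r c by (simp add: \<theta>_def lor_scale)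
    have t2: "lor \<theta> (hyp p) = 0" using xy(3) by (simp add: \<theta>_def lor_simps cosh_dist_def lor_commute[of _ "hyp p"])
    have c2: "lor (hyp x - hyp y) (hyp x) = c / 2"
      using lor_hyp_self[OF xy(1)] lor_hyp_self[OF xy(2)] by (simp add: lor_simps c_def lor_commute[of "hyp y" "hyp x"])
    have "lin \<theta> x = c / (2 * r)" unfolding lin_def \<theta>_def lor_scale c2 by simp
    also have "\<dots> = r / 2" using r by (simp add: r(2)[symmetric])
    finally have "hyp (hrefl \<theta> x) = hyp x - r *\<^sub>R \<theta>" using hyp_hrefl[OF t1 xy(1)] by simp
    also have "\<dots> = hyp y" using r by (simp add: \<theta>_def)
    finally have "hrefl \<theta> x = y" using hyp_inj[OF hrefl_hspace[OF t1 xy(1)] xy(2)] by simp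
    then show ?thesis using t1 t2 by blast
  qed
  have radial: "y \<in> \<Omega> \<and> u y = u x" if x: "x \<in> \<Omega>" "y \<in> hspace" "cosh_dist p x = cosh_dist p y" for x y
  proof (cases "x = y")
    case False
    then obtain \<theta> where "lor \<theta> \<theta> = 1" "lor \<theta> (hyp p) = 0" "hrefl \<theta> x = y"
      using trans[of x y] x sub_h by blast
    then show ?thesis using all x(1) by blast
  qed (use x in simp)
  have radialU: "y \<in> U" if x: "x \<in> U" "y \<in> hspace" "cosh_dist p x = cosh_dist p y" for x y
  proof (cases "x = y")
    case False
    have xh: "x \<in> hspace" using x sub_h by auto
    obtain \<theta> where th: "lor \<theta> \<theta> = 1" "lor \<theta> (hyp p) = 0" "hrefl \<theta> y = x"
      using trans[of y x] x xh False by metis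
    have "y \<notin> \<Omega>"
    proof
      assume "y \<in> \<Omega>"
      then have "x \<in> \<Omega>" using radial[of y x] x xh by simp
      then show False using x disj by auto
    qed
    moreover have "y \<notin> \<Gamma>"
    proof
      assume yG: "y \<in> \<Gamma>"
      have o: "open (hspace \<inter> hrefl \<theta> -` U)"
        by (rule continuous_open_preimage[OF continuous_on_hrefl[OF th(1)] open_hspace oU])
      have "y \<in> hspace \<inter> hrefl \<theta> -` U" using x th by simp
      then have "(hspace \<inter> hrefl \<theta> -` U) \<inter> closure \<Omega> \<noteq> {}" using boundary_closure(2)[OF yG] by blast
      then have "(hspace \<inter> hrefl \<theta> -` U) \<inter> \<Omega> \<noteq> {}" using open_Int_closure_eq_empty[OF o] by auto
      then obtain z where "z \<in> \<Omega>" "hrefl \<theta> z \<in> U" by auto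
      then show False using all[OF th(1,2)] disj by auto
    qed
    ultimately show ?thesis using x(2) cover by auto
  qed (use x in simp)
  have ck: "continuous_on S (cosh_dist p)" if "S \<subseteq> hspace" for S by (rule continuous_on_subset[OF continuous_on_cosh_dist that])
  have far: "\<exists>y\<in>\<Omega>. cosh_dist p y > m" for m
  proof (rule ccontr)
    assume n: "\<not> (\<exists>y\<in>\<Omega>. cosh_dist p y > m)"
    have "hspace \<subseteq> {x \<in> hspace. cosh_dist p x \<le> max m k}"
    proof
      fix x :: 'a assume x: "x \<in> hspace"
      then have "x \<in> U \<union> \<Gamma> \<or> x \<in> \<Omega>" using cover by auto
      then have "cosh_dist p x \<le> max m k"
      proof
        assume "x \<in> U \<union> \<Gamma>" then show ?thesis using k[of x] by simp
      next
        assume "x \<in> \<Omega>" then show ?thesis using n by force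
      qed
      then show "x \<in> {x \<in> hspace. cosh_dist p x \<le> max m k}" using x by simp
    qed
    then have "hspace = {x \<in> hspace. cosh_dist p x \<le> max m k}" by blast
    then have "compact (hspace :: 'a set)" using compact_cosh_dist[OF p] by metis
    then have "closed (hspace :: 'a set)" by (rule compact_imp_closed)
    then have "hspace = (UNIV :: 'a set)"
      using clopen[of "hspace :: 'a set"] open_hspace p by blast
    then have "bounded (UNIV :: 'a set)" using bounded_ball[of "0::'a" 1] by (simp add: hspace_def)
    then show False by simp
  qed
  have sep: "cosh_dist p x < cosh_dist p y" if x: "x \<in> U" and y: "y \<in> \<Omega>" for x y
  proof (rule ccontr)
    assume n: "\<not> cosh_dist p x < cosh_dist p y"
    obtain z where z: "z \<in> \<Omega>" "cosh_dist p z > cosh_dist p x" using far by blast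
    have "connected (cosh_dist p ` \<Omega>)" by (rule connected_continuous_image[OF ck[OF sub_h(2)] conOm])
    then have "cosh_dist p x \<in> cosh_dist p ` \<Omega>"
      using connectedD_interval[of "cosh_dist p ` \<Omega>" "cosh_dist p y" "cosh_dist p z" "cosh_dist p x"] y z n by auto
    then obtain v where "v \<in> \<Omega>" "cosh_dist p v = cosh_dist p x" by auto
    then have "x \<in> \<Omega>" using radial[of v x] x sub_h by auto
    then show False using x disj by auto
  qed
  have sepG: "cosh_dist p x \<le> cosh_dist p g" if x: "x \<in> U" and g: "g \<in> \<Gamma>" for x g
  proof (rule ccontr)
    assume n: "\<not> cosh_dist p x \<le> cosh_dist p g"
    have "g \<in> {z \<in> hspace. cosh_dist p z < cosh_dist p x}" using n g sub_h by auto
    then have "{z \<in> hspace. cosh_dist p z < cosh_dist p x} \<inter> closure \<Omega> \<noteq> {}" using boundary_closure(2)[OF g] by blast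
    then have "{z \<in> hspace. cosh_dist p z < cosh_dist p x} \<inter> \<Omega> \<noteq> {}" using open_Int_closure_eq_empty[OF open_cosh_dist(1)] by auto
    then show False using sep[OF x] by force
  qed
  have sepO: "cosh_dist p g \<le> cosh_dist p y" if g: "g \<in> \<Gamma>" and y: "y \<in> \<Omega>" for g y
  proof (rule ccontr)
    assume n: "\<not> cosh_dist p g \<le> cosh_dist p y"
    have "g \<in> {z \<in> hspace. cosh_dist p y < cosh_dist p z}" using n g sub_h by auto
    then have "{z \<in> hspace. cosh_dist p y < cosh_dist p z} \<inter> closure U \<noteq> {}" using boundary_closure(1)[OF g] by blast
    then have "{z \<in> hspace. cosh_dist p y < cosh_dist p z} \<inter> U \<noteq> {}" using open_Int_closure_eq_empty[OF open_cosh_dist(2)] by auto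
    then show False using sep[OF _ y] by force
  qed
  have kpp: "cosh_dist p p = 1" by (simp add: cosh_dist_def lor_hyp_self[OF p])
  have kgt: "cosh_dist p x > 1" if "x \<in> hspace" "x \<noteq> p" for x
    using lor_hyp_lt[OF p that(1)] that(2) by (auto simp: cosh_dist_def)
  obtain x0 where x0: "x0 \<in> U" using U_ne by blast
  have x0h: "x0 \<in> hspace" using x0 sub_h by auto
  have pU: "p \<in> U"
  proof (rule ccontr)
    assume pU: "p \<notin> U"
    then have gt: "cosh_dist p x0 > 1" using kgt[OF x0h] x0 by auto
    have "p \<in> \<Omega> \<or> p \<in> \<Gamma>" using pU p cover by auto
    then show False
    proof
      assume "p \<in> \<Omega>" then show False using sep[OF x0, of p] kpp gt by simp
    next
      assume "p \<in> \<Gamma>" then show False using sepG[OF x0, of p] kpp gt by simp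
    qed
  qed
  have "\<Gamma> \<noteq> {}"
  proof
    assume "\<Gamma> = {}"
    then have h: "hspace \<subseteq> U \<union> \<Omega>" using cover by auto
    have "connected (hspace :: 'a set)" by (simp add: hspace_def)
    then have "U \<inter> hspace = {} \<or> \<Omega> \<inter> hspace = {}"
      using connectedD[OF _ oU oOm _ h] disj by auto
    then show False using x0 far[of 0] sub_h by auto
  qed
  then obtain g where g: "g \<in> \<Gamma>" by blast
  have gh: "g \<in> hspace" using g sub_h by auto
  define k0 where "k0 = cosh_dist p g"
  have "g \<noteq> p" using pU g disj by auto
  then have k01: "k0 > 1" using kgt[OF gh] by (simp add: k0_def)
  have "U = {x \<in> hspace. cosh_dist p x < k0}"
  proof (intro equalityI subsetI)
    fix x assume x: "x \<in> U"
    have "cosh_dist p x \<noteq> k0"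
    proof
      assume "cosh_dist p x = k0"
      then have "g \<in> U" using radialU[OF x gh] by (simp add: k0_def)
      then show False using g disj by auto
    qed
    then show "x \<in> {x \<in> hspace. cosh_dist p x < k0}" using sepG[OF x g] x sub_h by (auto simp: k0_def)
  next
    fix x assume "x \<in> {x \<in> hspace. cosh_dist p x < k0}"
    then have x: "x \<in> hspace" "cosh_dist p x < k0" by auto
    have "x \<notin> \<Omega>" using sepO[OF g, of x] x by (auto simp: k0_def)
    moreover have "x \<notin> \<Gamma>"
    proof
      assume xG: "x \<in> \<Gamma>"
      have "g \<in> {z \<in> hspace. cosh_dist p x < cosh_dist p z}" using gh x by (simp add: k0_def)
      then have "{z \<in> hspace. cosh_dist p x < cosh_dist p z} \<inter> closure U \<noteq> {}" using boundary_closure(1)[OF g] by blast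
      then have "{z \<in> hspace. cosh_dist p x < cosh_dist p z} \<inter> U \<noteq> {}" using open_Int_closure_eq_empty[OF open_cosh_dist(2)] by auto
      then show False using sepG[OF _ xG] by force
    qed
    ultimately show "x \<in> U" using x cover by auto
  qed
  then show ?thesis using p k01 radial by (intro exI[of _ p] exI[of _ k0] conjI ballI impI) auto
qed

end

section \<open>The overdetermined problem in the ball model\<close>

lemma dird_expand:
  fixes v :: "'a::euclidean_space \<Rightarrow> real"
  assumes "v differentiable (at x)"
  shows "(v has_derivative (\<lambda>h. \<Sum>b\<in>Basis. (h \<bullet> b) * dird b v x)) (at x)"
proof -
  have d: "(v has_derivative frechet_derivative v (at x)) (at x)"
    using assms by (simp add: frechet_derivative_works)
  have lin: "linear (frechet_derivative v (at x))" using assms by (rule linear_frechet_derivative)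
  have "frechet_derivative v (at x) h = (\<Sum>b\<in>Basis. (h \<bullet> b) * dird b v x)" for h
  proof -
    have "frechet_derivative v (at x) h = frechet_derivative v (at x) (\<Sum>b\<in>Basis. (h \<bullet> b) *\<^sub>R b)"
      by (simp add: euclidean_representation)
    also have "\<dots> = (\<Sum>b\<in>Basis. (h \<bullet> b) * frechet_derivative v (at x) b)"
      by (simp add: linear_sum[OF lin] linear_scale[OF lin])
    finally show ?thesis by (simp add: dird_def)
  qed
  then have "frechet_derivative v (at x) = (\<lambda>h. \<Sum>b\<in>Basis. (h \<bullet> b) * dird b v x)" by (rule ext)
  with d show ?thesis by simp
qed

text \<open>
  Allowing \<open>g\<close> and \<open>h\<close> to be any extensions of the partial derivatives off \<open>S\<close> makes the continuous extensions
  to the boundary directly available as gradient and Hessian.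
\<close>
lemma C2_on_jets:
  fixes v :: "'a::euclidean_space \<Rightarrow> real"
  assumes C2: "C2_on S v" and S: "open S"
    and g: "\<And>b x. b \<in> Basis \<Longrightarrow> x \<in> S \<Longrightarrow> g b x = dird b v x"
    and h: "\<And>a b x. a \<in> Basis \<Longrightarrow> b \<in> Basis \<Longrightarrow> x \<in> S \<Longrightarrow> h a b x = dird a (dird b v) x"
  shows "jets S v (\<lambda>x. \<Sum>b\<in>Basis. g b x *\<^sub>R b) (\<lambda>x k. \<Sum>b\<in>Basis. (\<Sum>a\<in>Basis. (k \<bullet> a) * h a b x) *\<^sub>R b)"
  unfolding jets_def
proof (intro conjI ballI S)
  fix x assume x: "x \<in> S"
  have "(v has_derivative (\<lambda>h. \<Sum>b\<in>Basis. (h \<bullet> b) * dird b v x)) (at x)"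
    using C2 x by (intro dird_expand) (auto simp: C2_on_def)
  then show "(v has_derivative (\<lambda>k. (\<Sum>b\<in>Basis. g b x *\<^sub>R b) \<bullet> k)) (at x)"
  proof (rule has_derivative_eq_rhs, intro ext)
    fix k
    have "(\<Sum>b\<in>Basis. g b x *\<^sub>R b) \<bullet> k = (\<Sum>b\<in>Basis. g b x * (b \<bullet> k))" by (simp add: inner_sum_left)
    also have "\<dots> = (\<Sum>b\<in>Basis. (k \<bullet> b) * dird b v x)"
      by (intro sum.cong refl) (simp add: g x inner_commute mult.commute)
    finally show "(\<Sum>b\<in>Basis. (k \<bullet> b) * dird b v x) = (\<Sum>b\<in>Basis. g b x *\<^sub>R b) \<bullet> k" by simp
  qed
  have "((\<lambda>x. \<Sum>b\<in>Basis. dird b v x *\<^sub>R b) has_derivative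
     (\<lambda>k. \<Sum>b\<in>Basis. (\<Sum>a\<in>Basis. (k \<bullet> a) * dird a (dird b v) x) *\<^sub>R b)) (at x)"
    using C2 x by (intro has_derivative_sum has_derivative_scaleR_left dird_expand) (auto simp: C2_on_def)
  then have "((\<lambda>x. \<Sum>b\<in>Basis. g b x *\<^sub>R b) has_derivative
     (\<lambda>k. \<Sum>b\<in>Basis. (\<Sum>a\<in>Basis. (k \<bullet> a) * dird a (dird b v) x) *\<^sub>R b)) (at x)"
    by (rule has_derivative_transform_within_open[OF _ S x]) (simp add: g)
  then show "((\<lambda>x. \<Sum>b\<in>Basis. g b x *\<^sub>R b) has_derivative
     (\<lambda>k. \<Sum>b\<in>Basis. (\<Sum>a\<in>Basis. (k \<bullet> a) * h a b x) *\<^sub>R b)) (at x)"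
    by (rule has_derivative_eq_rhs) (simp add: fun_eq_iff h x)
qed

lemma hgrad_jets:
  assumes "jets S v G H" "x \<in> S"
  shows "hgrad v x = (1 / (2 * sg x)\<^sup>2) *\<^sub>R G x"
proof -
  have "dird b v x = G x \<bullet> b" for b
    unfolding dird_def using frechet_derivative_at[OF jetsD(1)[OF assms]] by metis
  then show ?thesis unfolding hgrad_def hconf_sg by (simp add: euclidean_representation)
qed

lemma zero_set_in_closure:
  assumes J: "jets V \<phi> g h" and x: "x \<in> V" and z: "\<phi> x = 0" and g: "g x \<noteq> 0"
  shows "x \<in> closure {y \<in> V. \<phi> y < 0}" "x \<in> closure {y \<in> V. \<phi> y > 0}"
proof -
  have gg: "g x \<bullet> - g x < 0" "g x \<bullet> g x > 0" using g by auto
  show "x \<in> closure {y \<in> V. \<phi> y < 0}"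
    by (rule ray_in_closure[where k="- g x"]) (use negative_along_ray[OF J x z gg(1)] in simp)
  show "x \<in> closure {y \<in> V. \<phi> y > 0}"
    by (rule ray_in_closure[where k="g x"]) (use positive_along_ray[OF J x z gg(2)] in simp)
qed

lemma C2_local_defining_jets:
  assumes "C2_local_defining S p V \<phi>"
  shows "\<exists>g h. jets V \<phi> g h \<and> p \<in> V \<and> V \<subseteq> hspace \<and> (\<forall>x\<in>V. g x \<noteq> 0) \<and> S \<inter> V = {x \<in> V. \<phi> x < 0}"
proof -
  have d: "open V" "V \<subseteq> hspace" "p \<in> V" "C2_on V \<phi>" "\<forall>x\<in>V. hgrad \<phi> x \<noteq> 0" "S \<inter> V = {x \<in> V. \<phi> x < 0}"
    using assms by (auto simp: C2_local_defining_def)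
  define g where "g x = (\<Sum>b\<in>Basis. dird b \<phi> x *\<^sub>R b)" for x
  define h where "h x k = (\<Sum>b\<in>Basis. (\<Sum>a\<in>Basis. (k \<bullet> a) * dird a (dird b \<phi>) x) *\<^sub>R b)" for x k
  have J: "jets V \<phi> g h" unfolding g_def[abs_def] h_def[abs_def] by (rule C2_on_jets[OF d(4,1)]) auto
  have "g x \<noteq> 0" if "x \<in> V" for x using d(5) that hgrad_jets[OF J that] by auto
  then show ?thesis using J d(2,3,6) by blast
qed

lemma hdist_cosh_dist: "x \<in> hspace \<Longrightarrow> y \<in> hspace \<Longrightarrow> hdist x y = arcosh (cosh_dist x y)"
  by (simp add: hdist_lor cosh_dist_def)

lemma hspace_not_compact: "\<not> compact (hspace :: 'a::euclidean_space set)"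
proof
  assume "compact (hspace :: 'a set)"
  then have "closed (hspace :: 'a set)" by (rule compact_imp_closed)
  moreover have "(0::'a) \<in> hspace" by (simp add: hspace_def)
  ultimately have "hspace = (UNIV :: 'a set)"
    using clopen[of "hspace :: 'a set"] open_hspace by blast
  then have "bounded (UNIV :: 'a set)" using bounded_ball[of "0::'a" 1] by (simp add: hspace_def)
  then show False by simp
qed

lemma hbounded_compact_closure:
  assumes "hbounded U"
  shows "compact (closure U)" "closure U \<subseteq> hspace"
proof -
  obtain c r where c: "c \<in> hspace" "U \<subseteq> hball c r" using assms by (auto simp: hbounded_def)
  define Q where "Q = {x \<in> hspace. cosh_dist c x \<le> cosh r}"
  have cQ: "compact Q" unfolding Q_def by (rule compact_cosh_dist[OF c(1)])
  have "U \<subseteq> Q"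
  proof
    fix x assume "x \<in> U"
    then have x: "x \<in> hspace" "arcosh (cosh_dist c x) < r" using c by (auto simp: hball_def hdist_cosh_dist)
    have k: "cosh_dist c x \<ge> 1" by (rule cosh_dist_ge1[OF c(1) x(1)])
    have a0: "arcosh (cosh_dist c x) \<ge> 0" using k by simp
    have "cosh_dist c x = cosh (arcosh (cosh_dist c x))" using k by simp
    also have "\<dots> \<le> cosh r" using a0 x(2) by (subst cosh_real_nonneg_le_iff) auto
    finally show "x \<in> Q" using x by (simp add: Q_def)
  qed
  then have sub: "closure U \<subseteq> Q" using compact_imp_closed[OF cQ] by (rule closure_minimal)
  then show "closure U \<subseteq> hspace" by (auto simp: Q_def)
  have "closure U = Q \<inter> closure U" using sub by blast
  then show "compact (closure U)" using compact_Int_closed[OF cQ closed_closure] by metis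
qed

text \<open>
  The distance to a fixed compact set tends to infinity at the ideal boundary, uniformly, so that the
  limit of \<open>u\<close> in the overdetermined problem is a limit as \<open>norm x\<close> tends to \<open>1\<close>.
\<close>
lemma distance_to_compact_at_infinity:
  assumes K: "compact K" "K \<subseteq> hspace" "K \<noteq> {}"
  shows "\<exists>r<1. \<forall>x\<in>hspace. norm x > r \<longrightarrow> hinfdist x K > B"
proof -
  have "continuous_on K norm" by (intro continuous_intros)
  then obtain q0 where q0: "q0 \<in> K" "\<And>q. q \<in> K \<Longrightarrow> norm q \<le> norm q0"
    using continuous_attains_sup[OF K(1,3)] by blast
  define s where "s = norm q0"
  have s: "0 \<le> s" "s < 1" using q0(1) K(2) by (auto simp: s_def hspace_def)
  define d where "d = (1 - s) / 2"
  have d: "d > 0" using s by (simp add: d_def)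
  define b where "b = max B 0 + 1"
  define M where "M = cosh b"
  have M: "M > 0" by (simp add: M_def)
  \<comment> \<open>The first bound keeps \<open>x\<close> at Euclidean distance at least \<open>d\<close> from \<open>K\<close>, the second makes \<open>sg x\<close> large.\<close>
  define r where "r = max ((1 + s) / 2) (1 - d\<^sup>2 / M)"
  have "r < 1" using s d M by (simp add: r_def)
  moreover have "hinfdist x K > B" if x: "x \<in> hspace" "norm x > r" for x
  proof -
    have nx: "norm x < 1" "norm x > (1 + s) / 2" "norm x > 1 - d\<^sup>2 / M" using x by (auto simp: hspace_def r_def)
    have "hdist x q \<ge> b" if q: "q \<in> K" for q
    proof -
      have qh: "q \<in> hspace" using q K by auto
      have "norm x - norm q \<le> norm (x - q)" by (rule norm_triangle_ineq2)
      then have "d \<le> norm (x - q)" using q0(2)[OF q] nx(2) by (simp add: d_def s_def field_simps)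
      then have "d\<^sup>2 \<le> (norm (x - q))\<^sup>2" using d by (intro power_mono) auto
      then have D: "d\<^sup>2 \<le> (x - q) \<bullet> (x - q)" by (simp add: power2_norm_eq_inner)
      have "1 - x \<bullet> x = (1 - norm x) * (1 + norm x)"
        by (simp add: power2_norm_eq_inner[symmetric] power2_eq_square algebra_simps)
      also have "\<dots> \<le> (1 - norm x) * 2" using nx by (intro mult_left_mono) auto
      also have "\<dots> \<le> 2 * (d\<^sup>2 / M)" using nx(3) by simp
      finally have "M * (1 - x \<bullet> x) \<le> 2 * d\<^sup>2" using M by (simp add: field_simps)
      then have "M * (1 - x \<bullet> x) * sg x \<le> 2 * d\<^sup>2 * sg x" using sg_pos[OF x(1)] by (intro mult_right_mono) auto
      moreover have "M * (1 - x \<bullet> x) * sg x = M" using sg_mult[OF x(1)] by (simp add: mult.assoc mult.commute)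
      ultimately have "M \<le> 2 * d\<^sup>2 * sg x" by simp
      also have "\<dots> \<le> 2 * ((x - q) \<bullet> (x - q)) * sg x" using D sg_pos[OF x(1)] by (intro mult_right_mono) auto
      also have "\<dots> \<le> 2 * ((x - q) \<bullet> (x - q)) * sg x * sg q"
        using mult_left_mono[OF sg_ge1[OF qh], of "2 * ((x - q) \<bullet> (x - q)) * sg x"] sg_pos[OF x(1)] by simp
      also have "\<dots> \<le> cosh_dist x q" proof -
        have e: "(q - x) \<bullet> (q - x) = (x - q) \<bullet> (x - q)" by (simp add: inner_diff inner_commute)
        show ?thesis unfolding cosh_dist_eq[OF x(1) qh] e by (simp add: mult_ac)
      qed
      finally have "M \<le> cosh_dist x q" .
      moreover have "M \<ge> 1" unfolding M_def by (rule cosh_real_ge_1)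
      ultimately have "arcosh M \<le> arcosh (cosh_dist x q)"
        using arcosh_less_iff_real[of "cosh_dist x q" M] cosh_dist_ge1[OF x(1) qh] by (simp add: linorder_not_less[symmetric])
      moreover have "arcosh M = b" unfolding M_def by (rule arcosh_cosh_real) (simp add: b_def)
      ultimately show ?thesis using hdist_cosh_dist[OF x(1) qh] by simp
    qed
    then have "b \<le> hinfdist x K" unfolding hinfdist_def by (intro cINF_greatest K) auto
    then show ?thesis by (simp add: b_def)
  qed
  ultimately show ?thesis by blast
qed

theorem theorem3p4:
  fixes f :: "real \<Rightarrow> real" and U \<Omega> :: "'a::euclidean_space set" and u :: "'a \<Rightarrow> real"
  assumes "2 \<le> DIM('a)"
    and "\<exists>L. L-lipschitz_on UNIV f" and "antimono f"
    and "hdomain U" and "hbounded U" and "C2_boundary U"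
    and "\<Omega> = hspace - hclosure U" and "connected \<Omega>"
    and "C2_on_hclosure \<Omega> u" and "OEP_solution \<Omega> f u"
  shows "\<exists>c\<in>hspace. \<exists>r>0. U = hball c r \<and> radially_symmetric_on c (hclosure \<Omega>) u"
proof -
  define \<Gamma> where "\<Gamma> = hfrontier \<Omega>"
  have Uh: "U \<subseteq> hspace" and Une: "U \<noteq> {}" and oU: "open U" and conU: "connected U"
    using assms(4) by (auto simp: hdomain_def)
  note clU = hbounded_compact_closure[OF assms(5)]
  have hcU: "hclosure U = closure U" using clU(2) by (auto simp: hclosure_def)
  have Om: "\<Omega> = hspace - closure U" using assms(7) hcU by simp
  have oOm: "open \<Omega>" unfolding Om using open_hspace by (rule open_Diff) simp
  have Omh: "\<Omega> \<subseteq> hspace" by (auto simp: Om)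
  have UOm: "U \<inter> closure \<Omega> = {}"
  proof -
    have "U \<inter> \<Omega> = {}" using closure_subset by (auto simp: Om)
    then show ?thesis using open_Int_closure_eq_empty[OF oU] by simp
  qed
  \<comment> \<open>A boundary point of \<open>U\<close> is a limit of points of \<open>\<Omega>\<close>: the defining function changes sign there.\<close>
  have Gcl: "\<Gamma> = closure U - U"
  proof (intro equalityI subsetI)
    fix x assume "x \<in> \<Gamma>"
    then have x: "x \<in> closure \<Omega>" "x \<notin> \<Omega>" "x \<in> hspace"
      using oOm by (auto simp: \<Gamma>_def hfrontier_def frontier_def interior_open)
    then show "x \<in> closure U - U" using UOm by (auto simp: Om)
  next
    fix x assume x: "x \<in> closure U - U"
    then have xh: "x \<in> hspace" using clU by auto
    have "x \<in> hfrontier U" using x xh oU by (auto simp: hfrontier_def frontier_def interior_open)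
    then obtain V \<phi> where lu: "C2_local_defining U x V \<phi>" using assms(6) by (auto simp: C2_boundary_def)
    obtain g h where Jg: "jets V \<phi> g h \<and> x \<in> V \<and> V \<subseteq> hspace \<and> (\<forall>y\<in>V. g y \<noteq> 0) \<and> U \<inter> V = {y \<in> V. \<phi> y < 0}"
      using C2_local_defining_jets[OF lu] by (elim exE)
    have J: "jets V \<phi> g h" "x \<in> V" "V \<subseteq> hspace" and UV: "U \<inter> V = {y \<in> V. \<phi> y < 0}"
      using Jg by simp_all
    have J4: "g y \<noteq> 0" if "y \<in> V" for y using Jg that by simp
    have oV: "open V" using jets_open[OF J(1)] .
    have "V \<inter> \<phi> -` {0<..} = {y \<in> V. \<phi> y > 0}" by auto
    then have oP: "open {y \<in> V. \<phi> y > 0}"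
      using continuous_open_preimage[OF jets_continuous(1)[OF J(1)] oV, of "{0<..}"] by simp
    have "{y \<in> V. \<phi> y > 0} \<inter> U = {}" using UV by force
    then have PU: "{y \<in> V. \<phi> y > 0} \<inter> closure U = {}" using oP by (simp add: open_Int_closure_eq_empty)
    have "\<not> \<phi> x < 0" using UV x J(2) by blast
    moreover have "\<not> \<phi> x > 0" using PU x J(2) by blast
    ultimately have "\<phi> x = 0" by simp
    then have "x \<in> closure {y \<in> V. \<phi> y > 0}" by (rule zero_set_in_closure(2)[OF J(1,2) _ J4[OF J(2)]])
    moreover have "{y \<in> V. \<phi> y > 0} \<subseteq> \<Omega>" using PU J(3) by (auto simp: Om)
    ultimately have "x \<in> closure \<Omega>" using closure_mono by blast
    moreover have "x \<notin> \<Omega>" using x by (auto simp: Om)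
    ultimately show "x \<in> \<Gamma>" using xh oOm by (auto simp: \<Gamma>_def hfrontier_def frontier_def interior_open)
  qed
  have cover: "U \<union> \<Gamma> \<union> \<Omega> = hspace" using Gcl Uh clU(2) closure_subset[of U] by (auto simp: Om)
  have UG: "U \<union> \<Gamma> = closure U" using Gcl closure_subset by auto
  have disj: "U \<inter> \<Gamma> = {}" "U \<inter> \<Omega> = {}" "\<Gamma> \<inter> \<Omega> = {}" using Gcl closure_subset[of U] by (auto simp: Om)
  have cpt: "compact (U \<union> \<Gamma>)" unfolding UG by (rule clU)
  have GcO: "\<Gamma> \<subseteq> closure \<Omega>" by (auto simp: \<Gamma>_def hfrontier_def frontier_def)
  have hcO: "hclosure \<Omega> = \<Omega> \<union> \<Gamma>"
    using Omh oOm closure_subset[of \<Omega>] by (auto simp: hclosure_def \<Gamma>_def hfrontier_def frontier_def interior_open)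
  have Gne: "\<Gamma> \<noteq> {}"
  proof
    assume e: "\<Gamma> = {}"
    have "connected (hspace :: 'a set)" by (simp add: hspace_def)
    moreover have "hspace \<subseteq> U \<union> \<Omega>" using cover e by auto
    ultimately have "U \<inter> hspace = {} \<or> \<Omega> \<inter> hspace = {}"
      using connectedD[OF _ oU oOm] disj by blast
    then have "hspace = U" using Une Uh Omh cover e by blast
    then show False using cpt e hspace_not_compact[where 'a='a] by simp
  qed
  have cG: "compact \<Gamma>" unfolding Gcl using clU(1) oU by (rule compact_diff)
  have Gh: "\<Gamma> \<subseteq> hspace" using cover by auto
  obtain C \<alpha> where oep: "\<alpha> \<le> 0 \<and>
        (\<forall>p\<in>\<Omega>. hlaplacian u p + f (u p) = 0) \<and>
        (\<forall>p\<in>\<Omega>. u p > 0) \<and>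
        bounded (u ` \<Omega>) \<and>
        (\<forall>p\<in>\<Gamma>. u p = 0) \<and>
        (\<forall>\<epsilon>>0. \<exists>R. \<forall>p\<in>\<Omega>. hinfdist p \<Gamma> > R \<longrightarrow> \<bar>u p - C\<bar> < \<epsilon>) \<and>
        (\<forall>p\<in>\<Gamma>. \<exists>v. is_outward_unit_normal \<Omega> p v \<and> hinner p (hgrad_bd \<Omega> u p) v = \<alpha>)"
    using assms(10) unfolding OEP_solution_def \<Gamma>_def by (elim exE)
  have al: "\<alpha> \<le> 0" using oep by (elim conjE)
  have pde: "hlaplacian u p + f (u p) = 0" if "p \<in> \<Omega>" for p using oep that by (elim conjE) (rule bspec)
  have upos: "u p > 0" if "p \<in> \<Omega>" for p using oep that by (elim conjE) (rule bspec)
  have u0: "u p = 0" if "p \<in> \<Gamma>" for p using oep that by (elim conjE) (rule bspec)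
  have inf: "\<exists>B. \<forall>p\<in>\<Omega>. hinfdist p \<Gamma> > B \<longrightarrow> \<bar>u p - C\<bar> < \<epsilon>" if "\<epsilon> > 0" for \<epsilon>
    using oep that by (elim conjE) simp
  have neu: "\<exists>v. is_outward_unit_normal \<Omega> p v \<and> hinner p (hgrad_bd \<Omega> u p) v = \<alpha>" if "p \<in> \<Gamma>" for p
    using oep that by (elim conjE) (rule bspec)
  have C2: "C2_on \<Omega> u" and cu: "continuous_on (\<Omega> \<union> \<Gamma>) u"
    and ex1: "\<forall>b\<in>Basis. \<exists>g. continuous_on (\<Omega> \<union> \<Gamma>) g \<and> (\<forall>x\<in>\<Omega>. g x = dird b u x)"
    and ex2: "\<forall>a\<in>Basis. \<forall>b\<in>Basis. \<exists>g. continuous_on (\<Omega> \<union> \<Gamma>) g \<and> (\<forall>x\<in>\<Omega>. g x = dird a (dird b u) x)"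
    using assms(9) unfolding C2_on_hclosure_def hcO by auto
  \<comment> \<open>Continuous extensions of the first and second partial derivatives.\<close>
  obtain g1 where g1: "\<forall>b\<in>Basis. continuous_on (\<Omega> \<union> \<Gamma>) (g1 b) \<and> (\<forall>x\<in>\<Omega>. g1 b x = dird b u x)"
    using bchoice[OF ex1] by blast
  have ex2': "\<forall>a\<in>Basis. \<exists>h. \<forall>b\<in>Basis. continuous_on (\<Omega> \<union> \<Gamma>) (h b) \<and> (\<forall>x\<in>\<Omega>. h b x = dird a (dird b u) x)"
    by (intro ballI bchoice) (use ex2 in blast)
  obtain g2 where g2: "\<forall>a\<in>Basis. \<forall>b\<in>Basis. continuous_on (\<Omega> \<union> \<Gamma>) (g2 a b) \<and> (\<forall>x\<in>\<Omega>. g2 a b x = dird a (dird b u) x)"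
    using bchoice[OF ex2'] by (elim exE)
  define G where "G x = (\<Sum>b\<in>Basis. g1 b x *\<^sub>R b)" for x
  define H where "H x k = (\<Sum>b\<in>Basis. (\<Sum>a\<in>Basis. (k \<bullet> a) * g2 a b x) *\<^sub>R b)" for x k
  have ju: "jets \<Omega> u G H" unfolding G_def[abs_def] H_def[abs_def]
    by (rule C2_on_jets[OF C2 oOm]) (use g1 g2 in auto)
  have cGr: "continuous_on (\<Omega> \<union> \<Gamma>) G" unfolding G_def by (intro continuous_intros) (use g1 in auto)
  have cH: "continuous_on (\<Omega> \<union> \<Gamma>) (\<lambda>x. H x h)" for h unfolding H_def by (intro continuous_intros) (use g2 in auto)
  have linH: "linear (H x)" for x
  proof (rule linearI)
    show "H x (k + k') = H x k + H x k'" for k k'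
      unfolding H_def by (simp only: inner_add_left distrib_right sum.distrib scaleR_add_left)
    show "H x (c *\<^sub>R k) = c *\<^sub>R H x k" for c k
      unfolding H_def
      by (simp only: inner_scaleR_left mult.assoc sum_distrib_left[symmetric] scaleR_scaleR[symmetric] scaleR_sum_right)
  qed
  have symH: "H x h \<bullet> k = H x k \<bullet> h" if x: "x \<in> \<Omega> \<union> \<Gamma>" for x h k
  proof -
    have "x \<in> closure \<Omega>" using x GcO closure_subset by auto
    then obtain s where s: "\<And>n. s n \<in> \<Omega>" "s \<longlonglongrightarrow> x" using closure_sequential by metis
    have l: "(\<lambda>n. H (s n) h) \<longlonglongrightarrow> H x h" for h
      by (rule continuous_on_tendsto_compose[OF cH s(2) x]) (use s(1) in auto)
    have "(\<lambda>n. H (s n) h \<bullet> k) \<longlonglongrightarrow> H x h \<bullet> k" "(\<lambda>n. H (s n) k \<bullet> h) \<longlonglongrightarrow> H x k \<bullet> h"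
      by (intro tendsto_intros l)+
    moreover have "(\<lambda>n. H (s n) h \<bullet> k) = (\<lambda>n. H (s n) k \<bullet> h)" using hessian_symmetric[OF ju s(1)] by simp
    ultimately show ?thesis by (metis LIMSEQ_unique)
  qed
  have defining: "\<exists>V \<phi> g h. jets V \<phi> g h \<and> p \<in> V \<and> V \<subseteq> hspace \<and>
        (\<forall>x\<in>V. x \<in> \<Omega> \<longleftrightarrow> \<phi> x < 0) \<and> (\<forall>x\<in>V. x \<in> \<Gamma> \<longleftrightarrow> \<phi> x = 0) \<and> g p \<noteq> 0 \<and>
        G p \<bullet> g p = \<alpha> * (2 * sg p) * norm (g p)" if p: "p \<in> \<Gamma>" for p
  proof -
    obtain v where v: "is_outward_unit_normal \<Omega> p v" "hinner p (hgrad_bd \<Omega> u p) v = \<alpha>" using neu[OF p] by blast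
    obtain V \<phi> where def: "C2_local_defining \<Omega> p V \<phi>" "v = (1 / hnorm p (hgrad \<phi> p)) *\<^sub>R hgrad \<phi> p"
      using v(1) by (auto simp: is_outward_unit_normal_def)
    obtain g h where Jg: "jets V \<phi> g h \<and> p \<in> V \<and> V \<subseteq> hspace \<and> (\<forall>y\<in>V. g y \<noteq> 0) \<and> \<Omega> \<inter> V = {y \<in> V. \<phi> y < 0}"
      using C2_local_defining_jets[OF def(1)] by (elim exE)
    have J: "jets V \<phi> g h" "p \<in> V" "V \<subseteq> hspace" and OV: "\<Omega> \<inter> V = {y \<in> V. \<phi> y < 0}"
      using Jg by simp_all
    have J4: "g y \<noteq> 0" if "y \<in> V" for y using Jg that by simp
    have oV: "open V" using jets_open[OF J(1)] .
    have V1: "\<forall>x\<in>V. x \<in> \<Omega> \<longleftrightarrow> \<phi> x < 0" using OV by blast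
    have "V \<inter> \<phi> -` {0<..} = {y \<in> V. \<phi> y > 0}" by auto
    then have oP: "open {y \<in> V. \<phi> y > 0}"
      using continuous_open_preimage[OF jets_continuous(1)[OF J(1)] oV, of "{0<..}"] by simp
    have "{y \<in> V. \<phi> y > 0} \<inter> \<Omega> = {}" using V1 by force
    then have PO: "{y \<in> V. \<phi> y > 0} \<inter> closure \<Omega> = {}" using oP by (simp add: open_Int_closure_eq_empty)
    have V2: "\<forall>x\<in>V. x \<in> \<Gamma> \<longleftrightarrow> \<phi> x = 0"
    proof (intro ballI iffI)
      fix x assume x: "x \<in> V" "x \<in> \<Gamma>"
      then have "\<not> \<phi> x < 0" using V1 disj by auto
      moreover have "\<not> \<phi> x > 0" using PO x GcO by blast
      ultimately show "\<phi> x = 0" by simp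
    next
      fix x assume x: "x \<in> V" "\<phi> x = 0"
      have "x \<in> closure {y \<in> V. \<phi> y < 0}" by (rule zero_set_in_closure(1)[OF J(1) x J4[OF x(1)]])
      moreover have "{y \<in> V. \<phi> y < 0} \<subseteq> \<Omega>" using OV by blast
      ultimately have "x \<in> closure \<Omega>" using closure_mono by blast
      moreover have "x \<notin> \<Omega>" using V1 x by auto
      ultimately show "x \<in> \<Gamma>" using x J(3) oOm by (auto simp: \<Gamma>_def hfrontier_def frontier_def interior_open)
    qed
    have ph: "p \<in> hspace" using p Gh by auto
    define s where "s = 2 * sg p"
    have s: "s > 0" using sg_pos[OF ph] by (simp add: s_def)
    have bd: "hgrad_bd \<Omega> u p = (1 / s\<^sup>2) *\<^sub>R G p"
    proof -
      have pO: "p \<in> \<Omega> \<union> \<Gamma>" using p by simp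
      have "continuous_on (\<Omega> \<union> \<Gamma>) (\<lambda>x. (1 / (2 * sg x)\<^sup>2) *\<^sub>R G x)"
      proof (intro continuous_intros cGr)
        show "continuous_on (\<Omega> \<union> \<Gamma>) sg" by (rule continuous_on_subset[OF continuous_on_sg]) (use Omh Gh in auto)
        show "\<forall>x\<in>\<Omega> \<union> \<Gamma>. (2 * sg x)\<^sup>2 \<noteq> 0" using sg_pos Omh Gh by force
      qed
      then have "((\<lambda>x. (1 / (2 * sg x)\<^sup>2) *\<^sub>R G x) \<longlongrightarrow> (1 / s\<^sup>2) *\<^sub>R G p) (at p within \<Omega> \<union> \<Gamma>)"
        using pO unfolding continuous_on_def s_def by blast
      then have "((\<lambda>x. (1 / (2 * sg x)\<^sup>2) *\<^sub>R G x) \<longlongrightarrow> (1 / s\<^sup>2) *\<^sub>R G p) (at p within \<Omega>)"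
        by (rule tendsto_within_subset) simp
      then have t: "(hgrad u \<longlongrightarrow> (1 / s\<^sup>2) *\<^sub>R G p) (at p within \<Omega>)"
        by (rule Lim_transform_eventually) (auto simp: eventually_at_filter hgrad_jets[OF ju])
      have "p islimpt \<Omega>" using GcO p disj by (auto simp: closure_def)
      then have "at p within \<Omega> \<noteq> bot" by (simp add: trivial_limit_within)
      then show ?thesis unfolding hgrad_bd_def using t by (rule tendsto_Lim)
    qed
    have gp: "g p \<noteq> 0" by (rule J4[OF J(2)])
    have hg: "hgrad \<phi> p = (1 / s\<^sup>2) *\<^sub>R g p" unfolding s_def by (rule hgrad_jets[OF J(1,2)])
    have hs: "hconf p = s" by (simp add: hconf_sg s_def)
    have "hnorm p (hgrad \<phi> p) = sqrt ((norm (g p) / s)\<^sup>2)"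
      unfolding hnorm_def hinner_def hg hs using s
      by (simp add: power2_norm_eq_inner[symmetric] power2_eq_square dot_square_norm field_simps)
    then have hn: "hnorm p (hgrad \<phi> p) = norm (g p) / s" using s by simp
    have "\<alpha> = s\<^sup>2 * ((1 / s\<^sup>2) * ((1 / (norm (g p) / s)) * ((1 / s\<^sup>2) * (G p \<bullet> g p))))"
      using v(2) unfolding def(2) hn bd unfolding hg hinner_def hs by (simp add: mult_ac)
    also have "\<dots> = (G p \<bullet> g p) / (s * norm (g p))" using s gp by (simp add: power2_eq_square)
    finally have "G p \<bullet> g p = \<alpha> * s * norm (g p)" using s gp by (simp add: field_simps)
    then show ?thesis using J(1-3) V1 V2 gp unfolding s_def by blast
  qed
  have pde': "lapl x (G x) (H x) = - f (u x)" if "x \<in> \<Omega>" for x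
    using hlaplacian_jets[OF ju that Omh assms(1)] pde[OF that] by simp
  have at_inf: "\<exists>r<1. \<forall>x\<in>\<Omega>. norm x > r \<longrightarrow> \<bar>u x - C\<bar> < \<epsilon>" if "\<epsilon> > 0" for \<epsilon>
  proof -
    obtain B where B: "\<forall>p\<in>\<Omega>. hinfdist p \<Gamma> > B \<longrightarrow> \<bar>u p - C\<bar> < \<epsilon>" using inf[OF \<open>\<epsilon> > 0\<close>] by blast
    obtain r where r: "r < 1" "\<forall>x\<in>hspace. norm x > r \<longrightarrow> hinfdist x \<Gamma> > B"
      using distance_to_compact_at_infinity[OF cG Gh Gne] by blast
    then show ?thesis using B Omh by blast
  qed
  obtain L where L: "L-lipschitz_on UNIV f" using assms(2) by blast
  have L0: "L \<ge> 0" using L by (rule lipschitz_on_nonneg)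
  have lip: "\<bar>f s - f t\<bar> \<le> L * \<bar>s - t\<bar>" for s t
    using lipschitz_onD[OF L, of s t] by (simp add: dist_real_def)
  interpret exterior U \<Omega> \<Gamma> u G H f \<alpha> C L
    by (rule exterior.intro) (fact assms(1) cover disj oU oOm cpt Une conU assms(8) defining ju cu cGr cH linH symH u0 upos pde' at_inf assms(3) L0 lip al)+
  obtain c k where ck: "c \<in> hspace \<and> k > 1 \<and> U = {x \<in> hspace. cosh_dist c x < k} \<and>
    (\<forall>x\<in>\<Omega>. \<forall>y\<in>hspace. cosh_dist c x = cosh_dist c y \<longrightarrow> y \<in> \<Omega> \<and> u y = u x)"
    using ball_and_radial by (elim exE)
  have c: "c \<in> hspace" "k > 1" and Uk: "U = {x \<in> hspace. cosh_dist c x < k}" by (rule conjunct1[OF ck] conjunct1[OF conjunct2[OF ck]] conjunct1[OF conjunct2[OF conjunct2[OF ck]]])+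
  have rad: "y \<in> \<Omega> \<and> u y = u x" if "x \<in> \<Omega>" "y \<in> hspace" "cosh_dist c x = cosh_dist c y" for x y
    using mp[OF bspec[OF bspec[OF conjunct2[OF conjunct2[OF conjunct2[OF ck]]] that(1)] that(2)] that(3)] .
  have "U = hball c (arcosh k)"
  proof -
    have "hdist c x < arcosh k \<longleftrightarrow> cosh_dist c x < k" if "x \<in> hspace" for x
      using arcosh_less_iff_real[of "cosh_dist c x" k] cosh_dist_ge1[OF c(1) that] c(2) hdist_cosh_dist[OF c(1) that] by simp
    then show ?thesis unfolding Uk hball_def by blast
  qed
  moreover have "arcosh k > 0" using c(2) by simp
  moreover have "radially_symmetric_on c (hclosure \<Omega>) u"
    unfolding radially_symmetric_on_def hcO
  proof (intro ballI impI)
    fix p q assume p: "p \<in> \<Omega> \<union> \<Gamma>" and q: "q \<in> \<Omega> \<union> \<Gamma>" and eq: "hdist c p = hdist c q"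
    have ph: "p \<in> hspace" and qh: "q \<in> hspace" using p q Omh Gh by auto
    have "cosh_dist c p = cosh (hdist c p)" "cosh_dist c q = cosh (hdist c q)"
      using hdist_cosh_dist[OF c(1) ph] hdist_cosh_dist[OF c(1) qh] cosh_dist_ge1[OF c(1) ph] cosh_dist_ge1[OF c(1) qh] by simp_all
    then have kk: "cosh_dist c p = cosh_dist c q" using eq by simp
    show "u p = u q"
    proof (cases "p \<in> \<Omega>")
      case True
      then show ?thesis using rad[OF True qh kk] by simp
    next
      case False
      then have "q \<notin> \<Omega>" using rad[OF _ ph] kk by metis
      then show ?thesis using False p q u0 by auto
    qed
  qed
  ultimately show ?thesis using c(1) by blast
qed

end
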